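(* Let $\mathcal{L} \subset \mathbb{R}^n$ be a full-rank lattice such that $\det(\mathcal{L}') \geq 1$ for all sublattices $\mathcal{L}' \subseteq \mathcal{L}$. Let $s > n/2$ and $0 \leq q \leq (2s-n)/(n+2)$. Then \[ \zeta'(\mathcal{L}, s; q) \leq \zeta'(\mathbb{Z}^n, s; q), \] with equality if and only if $\mathcal{L}$ is isomorphic to $\mathbb{Z}^n$.
   Context: A lattice of rank $d$ is the set of integer combinations of $d$ linearly independent vectors $\mathbf{B}=(\vec b_1,\dots,\vec b_d)\in\mathbb{R}^{n\times d}$; its determinant is $\det(\mathcal{L}) = \sqrt{\det(\mathbf{B}^T\mathbf{B})}$ (independent of the basis), with $\det(\{\vec 0\}) := 1$. A sublattice of $\mathcal{L}$ is any additive subgroup of $\mathcal{L}$ (of any rank). For $q \geq 0$ and $s > n/2$, $\zeta'(\mathcal{L}, s; q) := \sum_{\vec{y} \in \mathcal{L}\setminus\{\vec 0\}} (\|\vec{y}\|^2 + q)^{-s}$. Two lattices $\mathcal{L}_1,\mathcal{L}_2\subset\mathbb{R}^n$ are isomorphic if $R\mathcal{L}_2=\mathcal{L}_1$ for some orthogonal transformation $R \in \mathsf{O}_n(\mathbb{R})$. *)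

theory Defs
  imports "HOL-Analysis.Analysis"
begin

definition int_span :: "('a::real_vector) list \<Rightarrow> 'a set" where
  "int_span B = {(\<Sum>i<length B. of_int (c i) *\<^sub>R (B ! i)) | c. True}"

definition lattice_basis :: "('a::real_vector) list \<Rightarrow> 'a set \<Rightarrow> bool" where
  "lattice_basis B L \<longleftrightarrow> distinct B \<and> independent (set B) \<and> L = int_span B"

definition is_lattice :: "('a::real_vector) set \<Rightarrow> bool" where
  "is_lattice L \<longleftrightarrow> (\<exists>B. lattice_basis B L)"

definition full_rank_lattice :: "(real ^ 'n) set \<Rightarrow> bool" where
  "full_rank_lattice L \<longleftrightarrow> (\<exists>B. lattice_basis B L \<and> length B = CARD('n))"

text \<open>Gram determinant det(B^T B) of a list of vectors (Leibniz formula, d = length B).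
  For the empty list it is 1.\<close>
definition gram_det :: "('a::real_inner) list \<Rightarrow> real" where
  "gram_det B = (\<Sum>p | p permutes {..<length B}.
      of_int (sign p) * (\<Prod>i<length B. (B ! i) \<bullet> (B ! (p i))))"

text \<open>Determinant of a lattice: sqrt(det(B^T B)) for any basis B (basis-independent).\<close>
definition lattice_det :: "('a::real_inner) set \<Rightarrow> real" where
  "lattice_det L = sqrt (gram_det (SOME B. lattice_basis B L))"

definition sublattice :: "('a::real_vector) set \<Rightarrow> 'a set \<Rightarrow> bool" where
  "sublattice L' L \<longleftrightarrow> L' \<subseteq> L \<and> 0 \<in> L' \<and>
     (\<forall>x\<in>L'. \<forall>y\<in>L'. x + y \<in> L') \<and> (\<forall>x\<in>L'. - x \<in> L')"

definition zeta' :: "('a::real_normed_vector) set \<Rightarrow> real \<Rightarrow> real \<Rightarrow> real" where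
  "zeta' L s q = (\<Sum>\<^sub>\<infinity>y\<in>L - {0}. ((norm y)\<^sup>2 + q) powr (- s))"

definition integer_lattice :: "(real ^ 'n) set" where
  "integer_lattice = {x. \<forall>i. x $ i \<in> \<int>}"

definition lattice_isomorphic :: "(real ^ 'n) set \<Rightarrow> (real ^ 'n) set \<Rightarrow> bool" where
  "lattice_isomorphic L1 L2 \<longleftrightarrow> (\<exists>R. orthogonal_transformation R \<and> R ` L2 = L1)"

end

theory Submission
  imports Defs "Jordan_Normal_Form.Determinant"
begin

text \<open>
Among the lattices whose sublattices all have determinant at least 1 and whose covolume is at most
that of \<open>L\<close>, the function \<open>zeta'\<close> attains a maximum, because reduced bases of such lattices stay in a
bounded set. It remains to see that every maximizer \<open>M\<close> is isometric to \<open>\<int>\<^sup>n\<close>.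

If a sublattice of determinant 1 spans \<open>V\<close>, then the orthogonal sum of \<open>M \<inter> V\<close> and of the projection
of \<open>M\<close> to \<open>V\<^sup>\<bottom>\<close> is again admissible. A Gaussian sum over a coset of a lattice is less than the sum
over the lattice itself (a consequence of the parallelogram law), and \<open>(\<parallel>y\<parallel>\<^sup>2 + q)\<^sup>-\<^sup>s\<close> is a mixture of
Gaussians; hence \<open>M\<close> already is that orthogonal sum. A summand without sublattices of determinant 1
could be shrunk, so all summands have determinant 1. If an irreducible summand spans \<open>V\<close> with
\<open>dim V \<ge> 2\<close>, then shears \<open>y \<mapsto> y + \<epsilon> (v \<bullet> y) u\<close> with \<open>u, v \<in> V\<close> are admissible for small \<open>\<epsilon>\<close>,
whereas for \<open>v \<in> V\<close> and \<open>u \<in> V\<^sup>\<bottom>\<close> they do not increase \<open>zeta'\<close>, by the coset inequality. So all these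
second variations are nonpositive. But summed over an orthonormal frame of \<open>u\<close> and a plane of \<open>v\<close> in
\<open>V\<close>, each term becomes a nonnegative multiple of \<open>(2s - n) \<parallel>y\<parallel>\<^sup>2 - (n + 2) q\<close>, which is nonnegative as
\<open>\<parallel>y\<parallel> \<ge> 1\<close>, and not always zero. Hence all irreducible summands have rank 1.
\<close>

no_notation vec_index (infixl \<open>$\<close> 100)
no_notation scalar_prod (infix \<open>\<bullet>\<close> 70)

text \<open>The class in which \<open>zeta'\<close> is maximized has to be compact and yet leave
  room for variations. Bounding the covolume by that of \<open>L\<close>, instead of fixing it,
  admits contractions; and since \<open>L\<close> belongs to the class, equality makes
  \<open>L\<close> itself a maximizer, to which the structure argument applies directly. The
  obstacle is that a variation must not create a sublattice of determinant below 1. Inside a lattice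
  of the class the determinants exceeding 1 stay away from 1, so a small variation supported in
  \<open>V\<close> endangers only sublattices of determinant exactly 1. In an irreducible summand
  these are zero or of full rank in \<open>V\<close>, and a shear preserves full-rank volume. Shears
  from \<open>V\<close> into its complement lack this protection, so maximality says nothing about
  them and a direct comparison of zeta values has to replace it. The constant n + 2 is a trace: n -
  2 frame directions outside the chosen plane, and 4 from two orthonormal pairs in the plane, each
  with weight 2.\<close>

abbreviation zterm :: "real \<Rightarrow> real \<Rightarrow> 'a::real_normed_vector \<Rightarrow> real" where
  "zterm s q y \<equiv> ((norm y)\<^sup>2 + q) powr (- s)"

section \<open>Gram determinants as Gram-Schmidt volumes\<close>

lemma gram_det_eq_det:
  "gram_det B = Determinant.det (Matrix.mat (length B) (length B) (\<lambda>(i,j). (B ! i) \<bullet> (B ! j)))"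
proof -
  have "(\<Prod>i<length B. (B ! i) \<bullet> (B ! (p i)))
      = (\<Prod>i=0..<length B. Matrix.mat (length B) (length B) (\<lambda>(i,j). (B ! i) \<bullet> (B ! j)) $$ (i, p i))"
    if "p permutes {0..<length B}" for p
    using that by (intro prod.cong) (auto simp: permutes_in_image)
  then show ?thesis
    unfolding gram_det_def Determinant.det_def
    by (auto simp: atLeast0LessThan intro!: sum.cong)
qed

text \<open>With coefficient matrix \<open>U\<close>, the Gram matrix of \<open>B\<close> is the
  product of \<open>U\<close>, the Gram matrix of \<open>B'\<close> and the transpose of
  \<open>U\<close>. The lists may be dependent, so one identity serves integral, real and unipotent
  changes of basis.\<close>

lemma gram_det_change:
  assumes len: "length B = k" "length B' = k"
    and comb: "\<And>i. i < k \<Longrightarrow> B ! i = (\<Sum>j<k. U i j *\<^sub>R B' ! j)"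
  shows "gram_det B = (Determinant.det (Matrix.mat k k (\<lambda>(i,j). U i j)))\<^sup>2 * gram_det B'"
proof -
  let ?U = "Matrix.mat k k (\<lambda>(i,j). U i j)"
  let ?G = "\<lambda>B::'a list. Matrix.mat k k (\<lambda>(i,j). (B ! i) \<bullet> (B ! j))"
  have "?G B = ?U * (?G B' * transpose_mat ?U)"
  proof (rule eq_matI)
    fix i j assume "i < dim_row (?U * (?G B' * transpose_mat ?U))" "j < dim_col (?U * (?G B' * transpose_mat ?U))"
    then have ij: "i < k" "j < k" by auto
    have "(?U * (?G B' * transpose_mat ?U)) $$ (i,j)
        = (\<Sum>a<k. U i a * (\<Sum>b<k. (B' ! a \<bullet> B' ! b) * U j b))"
      using ij by (auto simp: scalar_prod_def atLeast0LessThan intro!: sum.cong)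
    also have "\<dots> = B ! i \<bullet> B ! j"
      using ij by (simp add: comb inner_sum_left inner_sum_right sum_distrib_left mult_ac)
        (rule sum.swap)
    finally show "?G B $$ (i,j) = (?U * (?G B' * transpose_mat ?U)) $$ (i,j)" using ij by simp
  qed auto
  then have "Determinant.det (?G B) = Determinant.det ?U * (Determinant.det (?G B') * Determinant.det (transpose_mat ?U))"
    by (simp add: det_mult[of _ k] mult_carrier_mat[of _ k k])
  then show ?thesis
    using len by (simp add: gram_det_eq_det det_transpose[of _ k] power2_eq_square)
qed

text \<open>The product of the squared Gram-Schmidt lengths, hence the square of a volume; the head
  contributes its distance to the span of all later entries. In this form projections and
  contractions are treated one vector at a time, and \<open>gvol B \<noteq> 0\<close> doubles as the
  statement that \<open>B\<close> consists of distinct independent vectors.\<close>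

primrec gvol :: "'a::euclidean_space list \<Rightarrow> real" where
  "gvol [] = 1"
| "gvol (w # B) = (infdist w (span (set B)))\<^sup>2 * gvol B"

lemma gvol_nonneg: "gvol B \<ge> 0"
  by (induction B) auto

lemma infdist_subspace_orthogonal:
  fixes S :: "'a::euclidean_space set"
  assumes "subspace S" "p \<in> S" "\<And>x. x \<in> S \<Longrightarrow> z \<bullet> x = 0"
  shows "infdist (p + z) S = norm z"
proof (rule antisym)
  show "infdist (p + z) S \<le> norm z"
    using infdist_le[OF \<open>p \<in> S\<close>, of "p + z"] by (simp add: dist_norm)
  show "norm z \<le> infdist (p + z) S"
  proof -
    have ne: "S \<noteq> {}" using assms by auto
    show "norm z \<le> infdist (p + z) S"
      unfolding infdist_notempty[OF ne]
    proof (rule cINF_greatest[OF ne])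
      fix x assume x: "x \<in> S"
      then have "z \<bullet> (p - x) = 0" using assms by (simp add: subspace_diff)
      then have "(norm (p + z - x))\<^sup>2 = (norm z)\<^sup>2 + (norm (p - x))\<^sup>2"
        by (simp add: power2_norm_eq_inner inner_simps inner_commute algebra_simps)
      then have "(norm z)\<^sup>2 \<le> (norm (p + z - x))\<^sup>2" by simp
      then show "norm z \<le> dist (p + z) x" by (simp add: dist_norm power2_le_iff_abs_le)
    qed
  qed
qed

lemma span_set_list_comb:
  assumes "x \<in> span (set B)"
  shows "\<exists>c. x = (\<Sum>j<length B. c j *\<^sub>R B ! j)"
  using assms
proof (induction rule: span_induct_alt)
  case base
  show ?case by (intro exI[of _ "\<lambda>_. 0"]) simp
next
  case (step a b y)
  then obtain c where c: "y = (\<Sum>j<length B. c j *\<^sub>R B ! j)" by auto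
  obtain i where i: "i < length B" "b = B ! i" using step by (metis in_set_conv_nth)
  have "a *\<^sub>R b = (\<Sum>j<length B. (if j = i then a else 0) *\<^sub>R B ! j)"
    using i by (simp add: if_distrib[of "\<lambda>x. x *\<^sub>R _"] cong: if_cong)
  then have "a *\<^sub>R b + y = (\<Sum>j<length B. (c j + (if j = i then a else 0)) *\<^sub>R B ! j)"
    by (simp add: c scaleR_add_left sum.distrib)
  then show ?case by (intro exI)
qed

lemma gram_det_Cons_orthogonal:
  assumes "\<And>x. x \<in> set B \<Longrightarrow> z \<bullet> x = 0"
  shows "gram_det (z # B) = (norm z)\<^sup>2 * gram_det B"
proof -
  let ?k = "length B"
  let ?G = "Matrix.mat ?k ?k (\<lambda>(i,j). (B ! i) \<bullet> (B ! j))"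
  let ?A = "Matrix.mat 1 1 (\<lambda>_. z \<bullet> z)"
  have "Matrix.mat (Suc ?k) (Suc ?k) (\<lambda>(i,j). ((z # B) ! i) \<bullet> ((z # B) ! j))
      = four_block_mat ?A (0\<^sub>m 1 ?k) (0\<^sub>m ?k 1) ?G"
  proof (intro eq_matI)
    have *: "z \<bullet> B ! i = 0" "B ! i \<bullet> z = 0" if "i < length B" for i
      using assms[of "B ! i"] that by (simp_all add: inner_commute)
    fix i j
    assume "i < dim_row (four_block_mat ?A (0\<^sub>m 1 ?k) (0\<^sub>m ?k 1) ?G)"
      "j < dim_col (four_block_mat ?A (0\<^sub>m 1 ?k) (0\<^sub>m ?k 1) ?G)"
    then show "Matrix.mat (Suc ?k) (Suc ?k) (\<lambda>(i,j). ((z # B) ! i) \<bullet> ((z # B) ! j)) $$ (i, j)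
      = four_block_mat ?A (0\<^sub>m 1 ?k) (0\<^sub>m ?k 1) ?G $$ (i, j)"
      by (cases i; cases j) (auto simp: *)
  qed auto
  then show ?thesis
    by (simp add: gram_det_eq_det det_four_block_mat_upper_right_zero[of _ 1 _ ?k] det_single power2_norm_eq_inner)
qed

text \<open>Subtracting from the head its projection to the span of the tail is a unipotent change
  of basis, and the orthogonal remainder splits off a 1-by-1 block of the Gram matrix.\<close>

theorem gram_det_eq_gvol: "gram_det B = gvol B"
proof (induction B)
  case Nil
  show ?case by (simp add: gram_det_def)
next
  case (Cons w B)
  obtain p z where pz: "p \<in> span (set B)" "\<And>x. x \<in> span (set B) \<Longrightarrow> z \<bullet> x = 0" "w = p + z"
    by (rule orthogonal_subspace_decomp_exists[of "set B" w]) (auto simp: real_inner_class.orthogonal_def)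
  obtain c where c: "p = (\<Sum>j<length B. c j *\<^sub>R B ! j)"
    using span_set_list_comb[OF pz(1)] by auto
  define k where "k = Suc (length B)"
  \<comment> \<open>The identity matrix with the coefficients of \<open>p\<close> added to row 0;
    the shift \<open>j - 1\<close> accounts for the head, which occupies column 0.\<close>
  define U :: "nat \<Rightarrow> nat \<Rightarrow> real" where "U = (\<lambda>i j. if i = j then 1 else if i = 0 then c (j - 1) else 0)"
  have "gram_det (w # B) = (Determinant.det (Matrix.mat k k (\<lambda>(i,j). U i j)))\<^sup>2 * gram_det (z # B)"
  proof (rule gram_det_change)
    fix i assume i: "i < k"
    have *: "(\<Sum>j<k. U i j *\<^sub>R (z # B) ! j) = U i 0 *\<^sub>R z + (\<Sum>j<length B. U i (Suc j) *\<^sub>R B ! j)"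
      unfolding k_def by (subst sum.lessThan_Suc_shift) simp
    show "(w # B) ! i = (\<Sum>j<k. U i j *\<^sub>R (z # B) ! j)"
    proof (cases i)
      case 0
      then show ?thesis unfolding * by (simp add: U_def pz(3) c)
    next
      case (Suc i')
      then have "(\<Sum>j<length B. U i (Suc j) *\<^sub>R B ! j) = (\<Sum>j<length B. (if j = i' then B ! j else 0))"
        by (intro sum.cong) (auto simp: U_def)
      also have "\<dots> = B ! i'" using i Suc by (simp add: k_def)
      finally show ?thesis unfolding * using Suc by (simp add: U_def)
    qed
  qed (auto simp: k_def)
  also have "Determinant.det (Matrix.mat k k (\<lambda>(i,j). U i j)) = 1"
  proof -
    have "Determinant.det (Matrix.mat k k (\<lambda>(i,j). U i j)) = prod_list (diag_mat (Matrix.mat k k (\<lambda>(i,j). U i j)))"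
      by (rule det_upper_triangular[of _ k]) (auto simp: upper_triangular_def U_def)
    also have "diag_mat (Matrix.mat k k (\<lambda>(i,j). U i j)) = map (\<lambda>_. 1) [0..<k]"
      by (auto simp: diag_mat_def U_def)
    also have "prod_list \<dots> = 1" by (induction k) auto
    finally show ?thesis .
  qed
  also have "gram_det (z # B) = (norm z)\<^sup>2 * gram_det B"
    using pz(2) by (intro gram_det_Cons_orthogonal) (auto simp: span_base)
  also have "norm z = infdist w (span (set B))"
    using pz by (simp add: infdist_subspace_orthogonal)
  finally show ?case using Cons by simp
qed

text \<open>\<open>d\<close> is the determinant of the integral coefficient matrix. For independent
  lists its absolute value is the index of \<open>int_span B\<close> in
  \<open>int_span B'\<close>.\<close>

lemma gvol_int_comb:
  assumes "set B \<subseteq> int_span B'" "length B = length B'"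
  shows "\<exists>d::int. gvol B = (of_int d)\<^sup>2 * gvol B'"
proof -
  let ?k = "length B'"
  have "\<forall>i<?k. \<exists>c :: nat \<Rightarrow> int. B ! i = (\<Sum>j<?k. of_int (c j) *\<^sub>R B' ! j)"
    using assms nth_mem[of _ B] by (fastforce simp: int_span_def)
  then obtain c :: "nat \<Rightarrow> nat \<Rightarrow> int" where c: "\<And>i. i < ?k \<Longrightarrow> B ! i = (\<Sum>j<?k. of_int (c i j) *\<^sub>R B' ! j)"
    by metis
  have "gram_det B = (Determinant.det (Matrix.mat ?k ?k (\<lambda>(i,j). real_of_int (c i j))))\<^sup>2 * gram_det B'"
    by (rule gram_det_change) (use assms c in auto)
  moreover have "Matrix.mat ?k ?k (\<lambda>(i,j). real_of_int (c i j)) = map_mat real_of_int (Matrix.mat ?k ?k (\<lambda>(i,j). c i j))"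
    by (intro eq_matI) auto
  ultimately show ?thesis
    by (metis gram_det_eq_gvol of_int_hom.hom_det)
qed

lemma int_square_ge_1:
  assumes "a = (of_int d)\<^sup>2 * b" "a \<noteq> 0"
  shows "(of_int d :: real)\<^sup>2 \<ge> 1"
proof -
  have "d \<noteq> 0" using assms by auto
  then have "d\<^sup>2 \<ge> 1" by (simp add: int_one_le_iff_zero_less)
  then show ?thesis by (metis of_int_1_le_iff of_int_power)
qed

text \<open>A nonzero integer has square at least 1, so a sublattice of the same rank cannot have
  smaller volume.\<close>

lemma gvol_le_of_int_span:
  assumes "set B \<subseteq> int_span B'" "length B = length B'" "gvol B \<noteq> 0"
  shows "gvol B' \<le> gvol B"
proof -
  obtain d :: int where d: "gvol B = (of_int d)\<^sup>2 * gvol B'" using gvol_int_comb[OF assms(1,2)] by auto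
  then show ?thesis
    using mult_right_mono[OF int_square_ge_1[OF d assms(3)] gvol_nonneg[of B']] by simp
qed

text \<open>The coefficients of \<open>B\<close> in terms of \<open>B'\<close> survive the
  application of \<open>T\<close>. The factor by which \<open>T\<close> changes volume can thus be
  read off from any convenient basis \<open>B'\<close> of the span.\<close>

lemma gvol_real_comb:
  assumes "set B \<subseteq> span (set B')" "length B = length B'" "linear T"
  shows "\<exists>d. gvol B = d\<^sup>2 * gvol B' \<and> gvol (map T B) = d\<^sup>2 * gvol (map T B')"
proof -
  let ?k = "length B'"
  have "\<forall>i<?k. \<exists>c. B ! i = (\<Sum>j<?k. c j *\<^sub>R B' ! j)"
    using assms nth_mem[of _ B] span_set_list_comb by fastforce
  then obtain c where c: "\<And>i. i < ?k \<Longrightarrow> B ! i = (\<Sum>j<?k. c i j *\<^sub>R B' ! j)"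
    by metis
  let ?d = "Determinant.det (Matrix.mat ?k ?k (\<lambda>(i,j). c i j))"
  have "gram_det B = ?d\<^sup>2 * gram_det B'"
    by (rule gram_det_change) (use assms c in auto)
  moreover have "gram_det (map T B) = ?d\<^sup>2 * gram_det (map T B')"
  proof (rule gram_det_change)
    fix i assume i: "i < ?k"
    show "map T B ! i = (\<Sum>j<?k. c i j *\<^sub>R map T B' ! j)"
      using i assms c by (simp add: linear_sum linear_cmul o_def)
  qed (use assms in auto)
  ultimately show ?thesis by (auto simp: gram_det_eq_gvol)
qed

lemma infdist_span_eq_0_iff:
  fixes w :: "'a::euclidean_space"
  shows "infdist w (span S) = 0 \<longleftrightarrow> w \<in> span S"
  using in_closed_iff_infdist_zero[OF closed_span, of S w] span_zero[of S] by blast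

lemma gvol_nonzero_iff: "gvol B \<noteq> 0 \<longleftrightarrow> distinct B \<and> independent (set B)"
  by (induction B) (auto simp: infdist_span_eq_0_iff independent_insert span_base independent_empty)

lemma gvol_nonzero_length:
  assumes "gvol B \<noteq> 0"
  shows "length B = dim (span (set B))"
  using assms by (simp add: gvol_nonzero_iff distinct_card dim_eq_card_independent)

text \<open>The vectors in front see the tail only through its span.\<close>

lemma gvol_append_cong:
  assumes "span (set X) = span (set X')" "gvol X = gvol X'"
  shows "gvol (Y @ X) = gvol (Y @ X')"
proof (induction Y)
  case (Cons y Y)
  have "span (set (Y @ X)) = span (set (Y @ X'))"
    using assms(1) by (simp add: span_Un)
  then show ?case using Cons by simp
qed (use assms in simp)

section \<open>Volumes under contractions and expansions\<close>

lemma infdist_linear_contraction: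
  fixes T :: "'a::euclidean_space \<Rightarrow> 'b::euclidean_space"
  assumes "linear T" "\<And>x. norm (T x) \<le> norm x" "S \<noteq> {}"
  shows "infdist (T y) (T ` S) \<le> infdist y S"
  unfolding infdist_notempty[OF assms(3)]
proof (rule cINF_greatest[OF assms(3)])
  fix x assume "x \<in> S"
  then have "infdist (T y) (T ` S) \<le> dist (T y) (T x)" by (intro infdist_le) auto
  also have "\<dots> \<le> dist y x"
    using assms(2)[of "y - x"] by (simp add: dist_norm linear_diff[OF assms(1)])
  finally show "infdist (T y) (T ` S) \<le> dist y x" .
qed

lemma infdist_linear_expansion:
  fixes T :: "'a::euclidean_space \<Rightarrow> 'b::euclidean_space"
  assumes "linear T" "subspace V" "\<And>x. x \<in> V \<Longrightarrow> m * norm x \<le> norm (T x)" "m \<ge> 0" "S \<noteq> {}" "S \<subseteq> V" "y \<in> V"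
  shows "m * infdist y S \<le> infdist (T y) (T ` S)"
proof -
  have ne: "T ` S \<noteq> {}" using assms by auto
  show ?thesis
    unfolding infdist_notempty[OF ne]
  proof (rule cINF_greatest[OF ne])
    fix z assume "z \<in> T ` S"
    then obtain x where x: "x \<in> S" "z = T x" by auto
    have "m * infdist y S \<le> m * dist y x"
      using infdist_le[OF x(1), of y] assms(4) by (intro mult_left_mono)
    also have "\<dots> \<le> norm (T (y - x))"
      using assms(3)[of "y - x"] x(1) assms(2,6,7) by (auto simp: dist_norm subspace_diff)
    finally show "m * infdist y S \<le> dist (T y) z"
      using x assms(1) by (simp add: dist_norm linear_diff)
  qed
qed

lemma gvol_map_le:
  fixes T :: "'a::euclidean_space \<Rightarrow> 'b::euclidean_space"
  assumes "linear T" "\<And>x. norm (T x) \<le> norm x"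
  shows "gvol (map T B) \<le> gvol B"
proof (induction B)
  case (Cons w B)
  have "infdist (T w) (span (set (map T B))) \<le> infdist w (span (set B))"
    using infdist_linear_contraction[OF assms, of "span (set B)" w] span_zero[of "set B"]
    by (auto simp: linear_span_image[OF assms(1)])
  then show ?case
    using Cons by (auto intro!: mult_mono power_mono gvol_nonneg infdist_nonneg)
qed simp

text \<open>Every Gram-Schmidt length shrinks at most by the factor \<open>m\<close>; the exponent
  is doubled because \<open>gvol\<close> is the square of a volume.\<close>

lemma gvol_map_ge:
  fixes T :: "'a::euclidean_space \<Rightarrow> 'b::euclidean_space"
  assumes "linear T" "subspace V" "\<And>x. x \<in> V \<Longrightarrow> m * norm x \<le> norm (T x)" "m \<ge> 0" "set B \<subseteq> V"
  shows "m ^ (2 * length B) * gvol B \<le> gvol (map T B)"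
  using assms(5)
proof (induction B)
  case (Cons w B)
  have "m * infdist w (span (set B)) \<le> infdist (T w) (T ` span (set B))"
    using Cons.prems span_zero[of "set B"] assms(1-4)
    by (intro infdist_linear_expansion[where V = V]) (auto intro: span_minimal[THEN subsetD])
  then have "(m * infdist w (span (set B)))\<^sup>2 * (m ^ (2 * length B) * gvol B)
      \<le> (infdist (T w) (T ` span (set B)))\<^sup>2 * gvol (map T B)"
    using Cons assms(4) by (intro mult_mono power_mono) (auto intro!: mult_nonneg_nonneg gvol_nonneg infdist_nonneg)
  then show ?case
    by (simp add: linear_span_image[OF assms(1)] power_mult_distrib mult_ac power2_eq_square)
qed simp

section \<open>Orthogonal projections\<close>

text \<open>\<open>perp V y\<close> is the component of \<open>y\<close> orthogonal to \<open>V\<close>; it is only meaningful for a subspace \<open>V\<close>.\<close>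

definition perp :: "'a::euclidean_space set \<Rightarrow> 'a \<Rightarrow> 'a" where
  "perp V y = (SOME z. y - z \<in> V \<and> (\<forall>x\<in>V. z \<bullet> x = 0))"

lemma perp:
  assumes "subspace V"
  shows perp_diff_in: "y - perp V y \<in> V" and perp_orthogonal: "x \<in> V \<Longrightarrow> perp V y \<bullet> x = 0"
proof -
  obtain p z where "p \<in> span V" "\<And>x. x \<in> span V \<Longrightarrow> real_inner_class.orthogonal z x" "y = p + z"
    using orthogonal_subspace_decomp_exists[of V y] by metis
  then have "y - z \<in> V \<and> (\<forall>x\<in>V. z \<bullet> x = 0)"
    using assms by (auto simp: real_inner_class.orthogonal_def span_eq_iff[THEN iffD2])
  then have "y - perp V y \<in> V \<and> (\<forall>x\<in>V. perp V y \<bullet> x = 0)"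
    unfolding perp_def by (rule someI)
  then show "y - perp V y \<in> V" "x \<in> V \<Longrightarrow> perp V y \<bullet> x = 0" by auto
qed

lemma perp_unique:
  assumes V: "subspace V" and "y - z \<in> V" "\<And>x. x \<in> V \<Longrightarrow> z \<bullet> x = 0"
  shows "perp V y = z"
proof -
  have "perp V y - z = (y - z) - (y - perp V y)" by simp
  then have "perp V y - z \<in> V" using assms perp_diff_in[OF V] subspace_diff[OF V] by metis
  then have "(perp V y - z) \<bullet> (perp V y - z) = 0"
    using assms(3) perp_orthogonal[OF V] by (simp add: inner_diff_left)
  then show ?thesis by simp
qed

lemma linear_perp:
  assumes V: "subspace V"
  shows "linear (perp V)"
proof (rule linearI)
  fix x y
  have "x + y - (perp V x + perp V y) = (x - perp V x) + (y - perp V y)" by simp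
  then show "perp V (x + y) = perp V x + perp V y"
    using perp_diff_in[OF V] perp_orthogonal[OF V] subspace_add[OF V]
    by (intro perp_unique[OF V]) (metis, simp add: inner_add_left)
next
  fix c x
  have "c *\<^sub>R x - c *\<^sub>R perp V x = c *\<^sub>R (x - perp V x)" by (simp add: scaleR_diff_right)
  then show "perp V (c *\<^sub>R x) = c *\<^sub>R perp V x"
    using perp_diff_in[OF V] perp_orthogonal[OF V] subspace_scale[OF V]
    by (intro perp_unique[OF V]) (metis, simp)
qed

lemma perp_eq_0:
  assumes "subspace V" "y \<in> V"
  shows "perp V y = 0"
  using assms by (intro perp_unique) auto

lemma perp_eq_self:
  assumes "subspace V" "\<And>x. x \<in> V \<Longrightarrow> y \<bullet> x = 0"
  shows "perp V y = y"
  using assms by (intro perp_unique) (auto simp: subspace_0)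

lemma norm_sq_perp:
  assumes V: "subspace V"
  shows "(norm y)\<^sup>2 = (norm (y - perp V y))\<^sup>2 + (norm (perp V y))\<^sup>2"
proof -
  have "perp V y \<bullet> (y - perp V y) = 0" using perp_orthogonal[OF V perp_diff_in[OF V]] .
  then show ?thesis
    unfolding power2_norm_eq_inner by (simp add: inner_diff_left inner_diff_right inner_commute)
qed

lemma norm_perp_le:
  assumes V: "subspace V"
  shows "norm (perp V y) \<le> norm y"
  using norm_sq_perp[OF V, of y] by (intro power2_le_imp_le[OF _ norm_ge_zero]) simp

lemma subspace_imp_nonempty: "subspace S \<Longrightarrow> S \<noteq> {}"
  using subspace_0 by blast

text \<open>Adding an element of \<open>V\<close> to a point of \<open>S\<close> does not leave
  \<open>S\<close>, so the distance to \<open>S\<close> ignores components in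
  \<open>V\<close>.\<close>

lemma infdist_perp:
  assumes S: "subspace S" and V: "subspace V" and "V \<subseteq> S"
  shows "infdist (perp V y) (perp V ` S) = infdist y S"
proof (rule antisym)
  show "infdist (perp V y) (perp V ` S) \<le> infdist y S"
    using S by (intro infdist_linear_contraction linear_perp norm_perp_le V subspace_imp_nonempty)
  have sub: "perp V ` S \<subseteq> S"
  proof
    fix z assume "z \<in> perp V ` S"
    then obtain x where x: "x \<in> S" "z = perp V x" by auto
    have "x - perp V x \<in> S" using perp_diff_in[OF V, of x] assms(3) by auto
    then have "x - (x - perp V x) \<in> S" using subspace_diff[OF S] x by blast
    then show "z \<in> S" using x by simp
  qed
  have "infdist y S \<le> infdist (perp V y) S"
    unfolding infdist_notempty[OF subspace_imp_nonempty[OF S]]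
  proof (rule cINF_greatest[OF subspace_imp_nonempty[OF S]])
    fix x assume x: "x \<in> S"
    then have "x + (y - perp V y) \<in> S"
      using perp_diff_in[OF V, of y] assms(3) subspace_add[OF S] by blast
    then have "(INF a\<in>S. dist y a) \<le> dist y (x + (y - perp V y))"
      using infdist_le[of _ S y] by (simp add: infdist_notempty[OF subspace_imp_nonempty[OF S]])
    then show "(INF a\<in>S. dist y a) \<le> dist (perp V y) x" by (simp add: dist_norm)
  qed
  also have "\<dots> \<le> infdist (perp V y) (perp V ` S)"
    using sub S by (intro infdist_mono) (auto dest: subspace_0)
  finally show "infdist y S \<le> infdist (perp V y) (perp V ` S)" .
qed

text \<open>\<open>P\<close> may annihilate more than the span of \<open>X\<close>, so distances can
  drop and only an inequality remains. It is applied with \<open>P\<close> equal to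
  \<open>perp V\<close> when \<open>X\<close> may span a proper part of \<open>V\<close>.\<close>

lemma gvol_append_ge:
  assumes P: "linear P" "\<And>x. norm (P x) \<le> norm x" and X: "\<And>x. x \<in> set X \<Longrightarrow> P x = 0"
  shows "gvol (map P Y) * gvol X \<le> gvol (Y @ X)"
proof (induction Y)
  case (Cons y Y)
  have "P ` span (set (Y @ X)) = span (P ` set Y \<union> P ` set X)"
    by (simp add: linear_span_image[OF P(1), symmetric] image_Un)
  also have "\<dots> = span (P ` set Y)"
  proof -
    have "P ` set X \<subseteq> {0}" using X by auto
    then show ?thesis
      by (intro span_eq[THEN iffD2] conjI) (auto simp: span_zero intro: span_base)
  qed
  finally have "infdist (P y) (span (P ` set Y)) \<le> infdist y (span (set (Y @ X)))"
    using infdist_linear_contraction[OF P, of "span (set (Y @ X))" y] span_zero by force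
  then have "(infdist (P y) (span (P ` set Y)))\<^sup>2 * (gvol (map P Y) * gvol X)
      \<le> (infdist y (span (set (Y @ X))))\<^sup>2 * gvol (Y @ X)"
    using Cons by (intro mult_mono power_mono) (auto intro!: mult_nonneg_nonneg gvol_nonneg infdist_nonneg)
  then show ?case by (simp add: mult_ac)
qed simp

text \<open>The equality case: projecting along exactly the span of \<open>X\<close> leaves every
  relevant distance unchanged, by \<open>infdist_perp\<close>.\<close>

lemma gvol_append_perp:
  "gvol (Y @ X) = gvol (map (perp (span (set X))) Y) * gvol X"
proof (induction Y)
  case (Cons y Y)
  let ?P = "perp (span (set X))"
  have "?P ` span (set (Y @ X)) = span (?P ` set Y \<union> ?P ` set X)"
    by (simp add: linear_span_image[OF linear_perp, symmetric] image_Un)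
  also have "\<dots> = span (?P ` set Y)"
  proof -
    have "?P ` set X \<subseteq> {0}" by (auto intro!: perp_eq_0 span_base)
    then show ?thesis
      by (intro span_eq[THEN iffD2] conjI) (auto simp: span_zero intro: span_base)
  qed
  finally have "infdist (?P y) (span (?P ` set Y)) = infdist y (span (set (Y @ X)))"
    using infdist_perp[of "span (set (Y @ X))" "span (set X)" y] by (simp add: span_mono)
  then show ?case using Cons by simp
qed simp

section \<open>Additive groups and integer spans\<close>

definition addgroup :: "'a::ab_group_add set \<Rightarrow> bool" where
  "addgroup G \<longleftrightarrow> 0 \<in> G \<and> (\<forall>x\<in>G. \<forall>y\<in>G. x + y \<in> G) \<and> (\<forall>x\<in>G. - x \<in> G)"

lemma addgroupD:
  assumes "addgroup G"
  shows "0 \<in> G" "x \<in> G \<Longrightarrow> y \<in> G \<Longrightarrow> x + y \<in> G" "x \<in> G \<Longrightarrow> - x \<in> G" "x \<in> G \<Longrightarrow> y \<in> G \<Longrightarrow> x - y \<in> G"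
  using assms unfolding addgroup_def diff_conv_add_uminus by blast+

lemma addgroup_of_nat:
  assumes "addgroup G" "x \<in> (G :: 'a::real_vector set)"
  shows "of_nat m *\<^sub>R x \<in> G"
  by (induction m) (use assms in \<open>auto simp: scaleR_add_left dest: addgroupD\<close>)

lemma addgroup_of_int:
  assumes "addgroup G" "x \<in> (G :: 'a::real_vector set)"
  shows "of_int m *\<^sub>R x \<in> G"
  using addgroup_of_nat[OF assms, of "nat m"] addgroup_of_nat[OF assms, of "nat (- m)"]
    addgroupD(3)[OF assms(1)]
  by (cases "m \<ge> 0") (force simp: scaleR_minus_left)+

lemma addgroup_linear_image:
  assumes "addgroup G" "linear T"
  shows "addgroup (T ` G)"
  unfolding addgroup_def
proof (intro conjI ballI)
  show "0 \<in> T ` G" using addgroupD(1)[OF assms(1)] linear_0[OF assms(2)] by force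
  show "x + y \<in> T ` G" if "x \<in> T ` G" "y \<in> T ` G" for x y
    using that addgroupD(2)[OF assms(1)] by (auto simp: linear_add[OF assms(2), symmetric])
  show "- x \<in> T ` G" if "x \<in> T ` G" for x
    using that addgroupD(3)[OF assms(1)] by (auto simp: linear_neg[OF assms(2), symmetric])
qed

lemma addgroup_Int: "addgroup G \<Longrightarrow> addgroup H \<Longrightarrow> addgroup (G \<inter> H)"
  unfolding addgroup_def by auto

lemma addgroup_subspace: "subspace V \<Longrightarrow> addgroup V"
  unfolding addgroup_def by (auto simp: subspace_0 subspace_add subspace_neg)

lemma int_span_Nil [simp]: "int_span [] = {0}"
  by (auto simp: int_span_def)

lemma int_span_Cons: "int_span (w # B) = {of_int a *\<^sub>R w + y | a y. y \<in> int_span B}"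
proof (rule subset_antisym; rule subsetI)
  fix z assume "z \<in> int_span (w # B)"
  then obtain c where "z = (\<Sum>i<length (w # B). of_int (c i) *\<^sub>R ((w # B) ! i))"
    by (auto simp: int_span_def)
  then have "z = of_int (c 0) *\<^sub>R w + (\<Sum>i<length B. of_int (c (Suc i)) *\<^sub>R (B ! i))"
    by (simp add: sum.lessThan_Suc_shift del: sum.lessThan_Suc)
  moreover have "(\<Sum>i<length B. of_int (c (Suc i)) *\<^sub>R (B ! i)) \<in> int_span B"
    unfolding int_span_def by (intro CollectI exI[of _ "\<lambda>i. c (Suc i)"]) simp
  ultimately show "z \<in> {of_int a *\<^sub>R w + y | a y. y \<in> int_span B}"
    by blast
next
  fix z assume "z \<in> {of_int a *\<^sub>R w + y | a y. y \<in> int_span B}"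
  then obtain a c where "z = of_int a *\<^sub>R w + (\<Sum>i<length B. of_int (c i) *\<^sub>R (B ! i))"
    by (auto simp: int_span_def)
  then have "z = (\<Sum>i<length (w # B). of_int (case_nat a c i) *\<^sub>R ((w # B) ! i))"
    by (simp add: sum.lessThan_Suc_shift del: sum.lessThan_Suc)
  then show "z \<in> int_span (w # B)" unfolding int_span_def by blast
qed

lemma addgroup_int_span: "addgroup (int_span B)"
proof (induction B)
  case Nil
  show ?case by (simp add: addgroup_def)
next
  case (Cons w B)
  show ?case
    unfolding addgroup_def int_span_Cons
  proof (intro conjI ballI)
    show "0 \<in> {of_int a *\<^sub>R w + y | a y. y \<in> int_span B}"
      using addgroupD(1)[OF Cons] by (intro CollectI exI[of _ 0]) auto
  next
    fix x y assume "x \<in> {of_int a *\<^sub>R w + y | a y. y \<in> int_span B}" "y \<in> {of_int a *\<^sub>R w + y | a y. y \<in> int_span B}"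
    then obtain a b x' y' where "x = of_int a *\<^sub>R w + x'" "y = of_int b *\<^sub>R w + y'" "x' \<in> int_span B" "y' \<in> int_span B"
      by auto
    then show "x + y \<in> {of_int a *\<^sub>R w + y | a y. y \<in> int_span B}"
      using addgroupD(2)[OF Cons, of x' y']
      by (intro CollectI exI[of _ "a + b"] exI[of _ "x' + y'"]) (auto simp: scaleR_add_left)
  next
    fix x assume "x \<in> {of_int a *\<^sub>R w + y | a y. y \<in> int_span B}"
    then obtain a x' where "x = of_int a *\<^sub>R w + x'" "x' \<in> int_span B" by auto
    then show "- x \<in> {of_int a *\<^sub>R w + y | a y. y \<in> int_span B}"
      using addgroupD(3)[OF Cons, of x'] by (intro CollectI exI[of _ "- a"] exI[of _ "- x'"]) auto
  qed
qed

lemma int_span_minimal: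
  assumes "addgroup G" "set B \<subseteq> G"
  shows "int_span B \<subseteq> (G :: 'a::real_vector set)"
  using assms(2) by (induction B) (auto simp: int_span_Cons addgroupD[OF assms(1)] addgroup_of_int[OF assms(1)])

lemma set_subset_int_span: "set B \<subseteq> int_span B"
proof (induction B)
  case (Cons w B)
  have "w \<in> int_span (w # B)"
    unfolding int_span_Cons using addgroupD(1)[OF addgroup_int_span[of B]]
    by (intro CollectI exI[of _ 1] exI[of _ 0]) auto
  moreover have "int_span B \<subseteq> int_span (w # B)"
  proof
    fix y assume "y \<in> int_span B"
    then show "y \<in> int_span (w # B)" unfolding int_span_Cons by (intro CollectI exI[of _ 0] exI[of _ y]) auto
  qed
  ultimately show ?case using Cons by auto
qed simp

lemma int_span_subset_span: "int_span B \<subseteq> span (set B)"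
  by (intro int_span_minimal addgroup_subspace subspace_span span_superset)

lemma int_span_map:
  assumes "linear T"
  shows "int_span (map T B) = T ` int_span B"
proof
  show "int_span (map T B) \<subseteq> T ` int_span B"
    using set_subset_int_span[of B]
    by (intro int_span_minimal addgroup_linear_image addgroup_int_span assms) auto
  show "T ` int_span B \<subseteq> int_span (map T B)"
  proof (rule image_subsetI)
    fix x assume "x \<in> int_span B"
    then obtain c where "x = (\<Sum>i<length B. of_int (c i) *\<^sub>R (B ! i))" by (auto simp: int_span_def)
    then have "T x = (\<Sum>i<length (map T B). of_int (c i) *\<^sub>R (map T B ! i))"
      by (simp add: linear_sum[OF assms] linear_cmul[OF assms])
    then show "T x \<in> int_span (map T B)" unfolding int_span_def by blast
  qed
qed

text \<open>Rounding every coordinate down leaves coefficients in the interval from 0 to 1. The sum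
  of the norms is a crude covering radius of the lattice in its span.\<close>

lemma int_span_round:
  assumes "y \<in> span (set B)"
  shows "\<exists>x\<in>int_span B. norm (y - x) \<le> (\<Sum>b\<leftarrow>B. norm b)"
  using assms
proof (induction B arbitrary: y)
  case (Cons w B)
  then obtain k where "y - k *\<^sub>R w \<in> span (set B)" by (auto simp: span_insert)
  from Cons.IH[OF this] obtain x where x: "x \<in> int_span B" "norm (y - k *\<^sub>R w - x) \<le> (\<Sum>b\<leftarrow>B. norm b)" by auto
  have "y - (of_int \<lfloor>k\<rfloor> *\<^sub>R w + x) = (y - k *\<^sub>R w - x) + (k - of_int \<lfloor>k\<rfloor>) *\<^sub>R w"
    by (simp add: scaleR_diff_left)
  also have "norm \<dots> \<le> norm (y - k *\<^sub>R w - x) + \<bar>k - of_int \<lfloor>k\<rfloor>\<bar> * norm w"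
    by (rule norm_triangle_le) simp
  also have "\<dots> \<le> (\<Sum>b\<leftarrow>B. norm b) + 1 * norm w"
    using x by (intro add_mono mult_right_mono) (auto, linarith)
  finally have "norm (y - (of_int \<lfloor>k\<rfloor> *\<^sub>R w + x)) \<le> (\<Sum>b\<leftarrow>w # B. norm b)" by simp
  moreover have "of_int \<lfloor>k\<rfloor> *\<^sub>R w + x \<in> int_span (w # B)"
    using x unfolding int_span_Cons by blast
  ultimately show ?case by blast
qed simp

text \<open>Local finiteness, which for subgroups is equivalent to topological discreteness. It
  gives minima over bounded pieces directly.\<close>

definition discrete_set :: "'a::real_normed_vector set \<Rightarrow> bool" where
  "discrete_set G \<longleftrightarrow> (\<forall>r. finite (G \<inter> cball 0 r))"

lemma discrete_set_subset: "discrete_set G \<Longrightarrow> H \<subseteq> G \<Longrightarrow> discrete_set H"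
  unfolding discrete_set_def by (meson Int_mono finite_subset order_refl)

text \<open>The norm of a vector controls its coefficient at \<open>w\<close>, since
  \<open>w\<close> keeps its distance from the span. The inductions over bases for discreteness,
  summability and coordinate bounds all rest on this.\<close>

lemma infdist_scale_le_norm:
  fixes w :: "'a::euclidean_space"
  assumes "y \<in> span S"
  shows "\<bar>a\<bar> * infdist w (span S) \<le> norm (a *\<^sub>R w + y)"
proof (cases "a = 0")
  case False
  have "infdist w (span S) \<le> dist w (- (1 / a) *\<^sub>R y)"
    using assms by (intro infdist_le span_scale)
  also have "\<dots> = norm (a *\<^sub>R w + y) / \<bar>a\<bar>"
  proof -
    have "a *\<^sub>R w + y = a *\<^sub>R (w - (- (1 / a) *\<^sub>R y))" using False by (simp add: algebra_simps)
    then show ?thesis using False by (simp only: norm_scaleR dist_norm) simp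
  qed
  finally show ?thesis using False by (simp add: field_simps)
qed simp

lemma discrete_int_span:
  assumes "gvol B \<noteq> 0"
  shows "discrete_set (int_span B)"
  using assms
proof (induction B)
  case (Cons w B)
  let ?d = "infdist w (span (set B))"
  have d: "?d > 0" using Cons.prems infdist_nonneg[of w "span (set B)"] by (auto simp: less_le)
  have IH: "\<And>r. finite (int_span B \<inter> cball 0 r)" using Cons by (simp add: discrete_set_def)
  show ?case
    unfolding discrete_set_def
  proof
    fix r :: real
    let ?I = "{a :: int. \<bar>of_int a\<bar> \<le> r / ?d}"
    let ?R = "r + (r / ?d) * norm w"
    have fin: "finite ?I"
      by (rule finite_subset[of _ "{- \<lceil>r / ?d\<rceil>..\<lceil>r / ?d\<rceil>}"]) (auto simp: abs_le_iff, linarith+)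
    have "int_span (w # B) \<inter> cball 0 r \<subseteq> (\<lambda>(a, y). of_int a *\<^sub>R w + y) ` (?I \<times> (int_span B \<inter> cball 0 ?R))"
    proof
      fix z assume "z \<in> int_span (w # B) \<inter> cball 0 r"
      then obtain a y where z: "z = of_int a *\<^sub>R w + y" "y \<in> int_span B" "norm z \<le> r"
        by (auto simp: int_span_Cons)
      have "\<bar>of_int a\<bar> * ?d \<le> r"
        using infdist_scale_le_norm[of y "set B" "of_int a" w] z int_span_subset_span[of B] by auto
      then have a: "\<bar>of_int a\<bar> \<le> r / ?d" using d by (simp add: field_simps)
      have "norm y \<le> norm z + norm (of_int a *\<^sub>R w)" using z norm_triangle_ineq4[of z "of_int a *\<^sub>R w"] by simp
      also have "\<dots> \<le> ?R" using z(3) mult_right_mono[OF a norm_ge_zero, of w] by simp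
      finally show "z \<in> (\<lambda>(a, y). of_int a *\<^sub>R w + y) ` (?I \<times> (int_span B \<inter> cball 0 ?R))"
        using z a by (intro image_eqI[of _ _ "(a, y)"]) auto
    qed
    then show "finite (int_span (w # B) \<inter> cball 0 r)"
      using fin IH by (auto intro: finite_subset)
  qed
qed (simp add: discrete_set_def)

section \<open>Discrete groups and reduced bases\<close>

lemma infdist_eq_norm_perp:
  assumes S: "subspace S"
  shows "infdist y S = norm (perp S y)"
  using infdist_subspace_orthogonal[OF S perp_diff_in[OF S, of y], of "perp S y"] perp_orthogonal[OF S]
  by simp

lemma perp_diff_subspace:
  assumes S: "subspace S" "x \<in> S"
  shows "perp S (y - x) = perp S y"
  by (simp add: linear_diff[OF linear_perp[OF S(1)]] perp_eq_0[OF S])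

text \<open>Reduced lists in the sense of Hermite, Korkine and Zolotarev; as for \<^const>\<open>gvol\<close>, the head of
  the list is the last vector of the Gram-Schmidt process.\<close>

primrec hkz :: "'a::euclidean_space set \<Rightarrow> 'a list \<Rightarrow> bool" where
  "hkz G [] \<longleftrightarrow> True"
| "hkz G (w # X) \<longleftrightarrow> hkz G X \<and> w \<in> G \<and> w \<notin> span (set X)
     \<and> (\<forall>z\<in>G. z \<notin> span (set X) \<longrightarrow> infdist w (span (set X)) \<le> infdist z (span (set X)))
     \<and> norm w \<le> infdist w (span (set X)) + (\<Sum>b\<leftarrow>X. norm b)"

lemma hkz_subset: "hkz G B \<Longrightarrow> set B \<subseteq> G"
  by (induction B) auto

lemma hkz_gvol: "hkz G B \<Longrightarrow> gvol B \<noteq> 0"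
  by (induction B) (auto simp: infdist_span_eq_0_iff)

lemma hkz_append: "hkz G (Y @ X) \<Longrightarrow> hkz G X"
  by (induction Y) auto

text \<open>Subtract the integer part of the coefficient at \<open>w\<close>. The result lies in
  \<open>G\<close> and is strictly closer to the span of the tail than \<open>w\<close>, so by
  minimality of \<open>w\<close> it lies in that span, and the induction hypothesis applies.\<close>

lemma hkz_primitive:
  assumes "addgroup G" "hkz G B"
  shows "G \<inter> span (set B) \<subseteq> int_span B"
  using assms(2)
proof (induction B)
  case (Cons w X)
  let ?S = "span (set X)"
  show ?case
  proof
    fix y assume y: "y \<in> G \<inter> span (set (w # X))"
    then obtain a where a: "y - a *\<^sub>R w \<in> ?S" by (auto simp: span_insert)
    let ?y = "y - of_int \<lfloor>a\<rfloor> *\<^sub>R w"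
    have yG: "?y \<in> G"
      using y Cons.prems by (auto intro!: addgroupD(4)[OF assms(1)] addgroup_of_int[OF assms(1)])
    have "?y = (y - a *\<^sub>R w) + (frac a) *\<^sub>R w" by (simp add: frac_def algebra_simps)
    then have "perp ?S ?y = frac a *\<^sub>R perp ?S w"
      using a by (simp only: linear_add[OF linear_perp] linear_cmul[OF linear_perp] subspace_span perp_eq_0) simp
    then have "infdist ?y ?S = frac a * infdist w ?S"
      by (simp add: infdist_eq_norm_perp)
    also have "\<dots> < infdist w ?S"
      using Cons.prems infdist_nonneg[of w ?S] frac_lt_1[of a]
      by (auto simp: infdist_span_eq_0_iff[symmetric] less_le)
    finally have "?y \<in> ?S" using Cons.prems yG by force
    then have "?y \<in> int_span X" using Cons yG by auto
    then show "y \<in> int_span (w # X)"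
      unfolding int_span_Cons by (intro CollectI exI[of _ "\<lfloor>a\<rfloor>"] exI[of _ ?y]) auto
  qed
qed simp

text \<open>The difficulty is that infinitely many vectors of \<open>G\<close> compete for the least
  positive distance to the span of \<open>X\<close>. Translating by integral combinations of
  \<open>X\<close> preserves the distance and bounds the norm, which leaves finitely many
  competitors. The same translation provides the norm bound demanded by \<open>hkz\<close>.\<close>

lemma hkz_extend:
  assumes G: "addgroup G" "discrete_set G" and X: "hkz G X" and "\<not> G \<subseteq> span (set X)"
  shows "\<exists>w. hkz G (w # X)"
proof -
  let ?S = "span (set X)" and ?\<sigma> = "\<Sum>b\<leftarrow>X. norm b"
  have shift: "\<exists>z'\<in>G. z' \<notin> ?S \<and> infdist z' ?S = infdist z ?S \<and> norm z' \<le> infdist z ?S + ?\<sigma>"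
    if z: "z \<in> G" "z \<notin> ?S" for z
  proof -
    obtain x where x: "x \<in> int_span X" "norm (z - perp ?S z - x) \<le> ?\<sigma>"
      using int_span_round[of "z - perp ?S z" X] perp_diff_in[OF subspace_span] by blast
    have xS: "x \<in> ?S" using x int_span_subset_span by blast
    have "x \<in> G" using x int_span_minimal[OF G(1) hkz_subset[OF X]] by blast
    moreover have eq: "infdist (z - x) ?S = infdist z ?S"
      using xS by (simp add: infdist_eq_norm_perp perp_diff_subspace)
    moreover have "z - x \<notin> ?S"
      using eq z by (simp add: infdist_span_eq_0_iff[symmetric])
    moreover have "norm (z - x) \<le> norm (perp ?S z) + norm (z - perp ?S z - x)"
      using norm_triangle_ineq[of "perp ?S z" "z - perp ?S z - x"] by simp
    ultimately show ?thesis
      using x z addgroupD(4)[OF G(1), of z x]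
      by (intro bexI[of _ "z - x"]) (auto simp: infdist_eq_norm_perp)
  qed
  obtain z0 where z0: "z0 \<in> G" "z0 \<notin> ?S" using assms(4) by auto
  let ?A = "{z \<in> G. z \<notin> ?S \<and> norm z \<le> infdist z0 ?S + ?\<sigma>}"
  have "finite ?A"
    by (rule finite_subset[of _ "G \<inter> cball 0 (infdist z0 ?S + ?\<sigma>)"])
      (use G(2) in \<open>auto simp: discrete_set_def\<close>)
  moreover have "?A \<noteq> {}" using shift[OF z0] by auto
  ultimately obtain w where w: "w \<in> ?A" "\<And>z. z \<in> ?A \<Longrightarrow> infdist w ?S \<le> infdist z ?S"
    using ex_is_arg_min_if_finite[of ?A "\<lambda>z. infdist z ?S"] by (auto simp: is_arg_min_linorder)
  have le0: "infdist w ?S \<le> infdist z0 ?S" using shift[OF z0] w(2) by force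
  have min: "infdist w ?S \<le> infdist z ?S" if z: "z \<in> G" "z \<notin> ?S" for z
  proof (rule ccontr)
    assume "\<not> ?thesis"
    then obtain z' where "z' \<in> ?A" "infdist z' ?S < infdist w ?S"
      using shift[OF z] le0 by fastforce
    then show False using w(2) by force
  qed
  obtain w' where "w' \<in> G" "w' \<notin> ?S" "infdist w' ?S = infdist w ?S" "norm w' \<le> infdist w ?S + ?\<sigma>"
    using shift[of w] w(1) by blast
  then show ?thesis using X min by (intro exI[of _ w']) auto
qed

text \<open>The length of an \<open>hkz\<close> list is at most the dimension. A longest one spans
  \<open>G\<close>, and primitivity turns spanning into generating.\<close>

lemma hkz_basis_exists:
  fixes G :: "'a::euclidean_space set"
  assumes G: "addgroup G" "discrete_set G"
  shows "\<exists>B. hkz G B \<and> G \<subseteq> int_span B"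
proof -
  have "length B < Suc DIM('a)" if "hkz G B" for B
    using gvol_nonzero_length[OF hkz_gvol[OF that]] dim_subset_UNIV[of "span (set B)"] by simp
  moreover have "hkz G []" by simp
  ultimately obtain B where B: "hkz G B" "\<And>B'. hkz G B' \<Longrightarrow> length B' \<le> length B"
    using ex_has_greatest_nat[of "hkz G" "[]" length "Suc DIM('a)"] by blast
  have "G \<subseteq> span (set B)"
  proof (rule ccontr)
    assume "\<not> ?thesis"
    then obtain w where "hkz G (w # B)" using hkz_extend[OF G B(1)] by auto
    then show False using B(2)[of "w # B"] by simp
  qed
  then show ?thesis using hkz_primitive[OF G(1) B(1)] B(1) by blast
qed

text \<open>Reducing \<open>w2\<close> modulo \<open>w1\<close> by the nearest integer yields a
  competitor for \<open>w1\<close>. If d1 and d2 are the two distances, that of the competitor is at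
  most d2 + d1 / 2, while minimality makes it at least d1.\<close>

lemma hkz_ratio:
  assumes G: "addgroup G" and H: "hkz G (w2 # w1 # X)"
  shows "infdist w1 (span (set X)) \<le> 2 * infdist w2 (span (set (w1 # X)))"
proof -
  let ?S = "span (set X)" and ?S1 = "span (set (w1 # X))"
  have "w2 - perp ?S1 w2 \<in> ?S1" by (simp add: perp_diff_in)
  then obtain a where a: "w2 - perp ?S1 w2 - a *\<^sub>R w1 \<in> ?S" by (auto simp: span_insert)
  let ?y = "w2 - of_int (round a) *\<^sub>R w1"
  have "?y \<in> G" using H by (auto intro!: addgroupD(4)[OF G] addgroup_of_int[OF G])
  moreover have "?y \<notin> ?S"
  proof
    assume "?y \<in> ?S"
    then have "?y + of_int (round a) *\<^sub>R w1 \<in> ?S1"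
      by (intro span_add span_scale) (auto intro: span_base span_mono[THEN subsetD])
    then show False using H by simp
  qed
  ultimately have "infdist w1 ?S \<le> infdist ?y ?S" using H by auto
  also have "?y = perp ?S1 w2 + (a - of_int (round a)) *\<^sub>R w1 + (w2 - perp ?S1 w2 - a *\<^sub>R w1)"
    by (simp add: algebra_simps)
  then have "perp ?S ?y = perp ?S (perp ?S1 w2) + (a - of_int (round a)) *\<^sub>R perp ?S w1"
    using a by (simp only: linear_add[OF linear_perp] linear_cmul[OF linear_perp] subspace_span perp_eq_0) simp
  then have "infdist ?y ?S \<le> norm (perp ?S (perp ?S1 w2)) + \<bar>a - of_int (round a)\<bar> * norm (perp ?S w1)"
    by (simp add: infdist_eq_norm_perp norm_triangle_le)
  also have "\<dots> \<le> infdist w2 ?S1 + 1 / 2 * infdist w1 ?S"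
    using of_int_round_abs_le[of a] norm_perp_le[OF subspace_span, of "set X" "perp ?S1 w2"]
    by (intro add_mono mult_mono) (auto simp: infdist_eq_norm_perp abs_minus_commute)
  finally show ?thesis by simp
qed

text \<open>By \<open>hkz_ratio\<close> each distance is at least half the preceding one, so a large
  distance \<open>d\<close> forces a large volume. The second conjunct, about the head of the whole
  list, carries the induction. The exponent of 4 is twice what the halving gives.\<close>

lemma hkz_tail_bound:
  assumes G: "addgroup G" and H: "hkz G (Y @ w # X)"
  defines "d \<equiv> infdist w (span (set X))"
  shows "gvol X * (d\<^sup>2) ^ Suc (length Y) / 4 ^ (length Y * Suc (length Y)) \<le> gvol (Y @ w # X)
    \<and> d / 2 ^ length Y \<le> infdist (hd (Y @ [w])) (span (set (tl (Y @ w # X))))"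
  using H
proof (induction Y)
  case Nil
  then show ?case by (simp add: d_def)
next
  case (Cons y Y)
  let ?m = "length Y"
  have hk: "hkz G (Y @ w # X)" using Cons.prems by auto
  note IH = Cons.IH[OF hk]
  have d0: "d \<ge> 0" by (simp add: d_def infdist_nonneg)
  obtain y' Z where Z: "Y @ w # X = y' # Z" by (cases Y) auto
  have hd: "hd (Y @ [w]) = y'" using Z by (cases Y) auto
  have "infdist y' (span (set Z)) \<le> 2 * infdist y (span (set (y' # Z)))"
    using Cons.prems by (intro hkz_ratio[OF G]) (simp add: Z)
  then have ratio: "d / 2 ^ Suc ?m \<le> infdist y (span (set (Y @ w # X)))"
    using IH hd by (simp add: Z)
  have "gvol X * (d\<^sup>2) ^ Suc (Suc ?m) / 4 ^ (Suc ?m * Suc (Suc ?m))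
     \<le> gvol X * (d\<^sup>2) ^ Suc (Suc ?m) / 4 ^ (Suc ?m * Suc ?m)"
    using d0 by (intro divide_left_mono power_increasing) (auto intro!: mult_nonneg_nonneg gvol_nonneg)
  also have "\<dots> = (d / 2 ^ Suc ?m)\<^sup>2 * (gvol X * (d\<^sup>2) ^ Suc ?m / 4 ^ (?m * Suc ?m))"
  proof -
    have "(2 ^ Suc ?m)\<^sup>2 = (4 :: real) ^ Suc ?m" by (simp add: power_mult[symmetric] mult.commute[of _ 2] power_mult)
    moreover have "(4 :: real) ^ (Suc ?m * Suc ?m) = 4 ^ Suc ?m * 4 ^ (?m * Suc ?m)"
      by (simp add: power_add[symmetric])
    ultimately show ?thesis by (simp add: power_divide field_simps del: power_Suc) (simp add: power2_eq_square)
  qed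
  also have "\<dots> \<le> (infdist y (span (set (Y @ w # X))))\<^sup>2 * gvol (Y @ w # X)"
    using IH ratio d0 by (intro mult_mono power_mono) (auto intro!: mult_nonneg_nonneg divide_nonneg_nonneg gvol_nonneg)
  finally show ?case using ratio by simp
qed

section \<open>Compactness: bounds on reduced bases\<close>

text \<open>Stated for lists instead of subgroups, so that it can be checked without choosing bases
  and transferred to projections by lifting vectors one by one. Dependent lists have volume
  0.\<close>

definition dets_ge_1 :: "'a::euclidean_space set \<Rightarrow> bool" where
  "dets_ge_1 G \<longleftrightarrow> (\<forall>B. set B \<subseteq> G \<longrightarrow> gvol B = 0 \<or> gvol B \<ge> 1)"

lemma dets_ge_1D: "dets_ge_1 G \<Longrightarrow> set B \<subseteq> G \<Longrightarrow> gvol B \<noteq> 0 \<Longrightarrow> gvol B \<ge> 1"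
  unfolding dets_ge_1_def by auto

lemma dets_ge_1_subset: "dets_ge_1 G \<Longrightarrow> H \<subseteq> G \<Longrightarrow> dets_ge_1 H"
  unfolding dets_ge_1_def by blast

text \<open>When \<open>d\<close> exceeds 1 it is at most its power in
  \<open>hkz_tail_bound\<close>. The inequality \<open>gvol X \<ge> 1\<close> prevents a small
  volume of the tail from compensating for a large \<open>d\<close>; this is where the lower bound
  on determinants enters reduction theory.\<close>

lemma hkz_infdist_bound:
  fixes G :: "'a::euclidean_space set"
  assumes G: "addgroup G" "dets_ge_1 G" and H: "hkz G (Y @ w # X)" and D: "gvol (Y @ w # X) \<le> D" "D \<ge> 1"
  shows "infdist w (span (set X)) \<le> D * 4 ^ (DIM('a) * Suc DIM('a))"
proof (cases "infdist w (span (set X)) \<le> 1")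
  case True
  have "1 * 1 \<le> D * 4 ^ (DIM('a) * Suc DIM('a))"
    using D(2) by (intro mult_mono) auto
  then show ?thesis using True by linarith
next
  case False
  let ?d = "infdist w (span (set X))" and ?m = "length Y"
  have "length (Y @ w # X) \<le> DIM('a)"
    using gvol_nonzero_length[OF hkz_gvol[OF H]] dim_subset_UNIV[of "span (set (Y @ w # X))"] by simp
  then have m: "?m \<le> DIM('a)" by simp
  have "hkz G X" using hkz_append[OF H] by simp
  then have X1: "1 \<le> gvol X" using dets_ge_1D[OF G(2) hkz_subset hkz_gvol] by blast
  have "?d * 1 \<le> ?d * ?d" using False by (intro mult_left_mono) auto
  also have "\<dots> = (?d\<^sup>2) ^ 1" by (simp add: power2_eq_square)
  also have "\<dots> \<le> (?d\<^sup>2) ^ Suc ?m" using False by (intro power_increasing) (auto simp: one_le_power)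
  also have "\<dots> \<le> gvol X * (?d\<^sup>2) ^ Suc ?m" using mult_right_mono[OF X1, of "(?d\<^sup>2) ^ Suc ?m"] by simp
  also have "\<dots> \<le> gvol (Y @ w # X) * 4 ^ (?m * Suc ?m)"
    using hkz_tail_bound[OF G(1) H] by (simp add: field_simps)
  also have "\<dots> \<le> D * 4 ^ (?m * Suc ?m)"
    using D(1) by (intro mult_right_mono) auto
  also have "\<dots> \<le> D * 4 ^ (DIM('a) * Suc DIM('a))"
    using m D(2) by (intro mult_left_mono power_increasing mult_le_mono) auto
  finally show ?thesis by simp
qed

text \<open>Each new norm is at most \<open>K\<close> plus the sum of the earlier ones, so every
  step takes the partial sum S to at most 2 S + \<open>K\<close>.\<close>

lemma hkz_norm_sum_bound:
  assumes "hkz G B" and "\<And>Y w X. B = Y @ w # X \<Longrightarrow> infdist w (span (set X)) \<le> K"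
  shows "(\<Sum>b\<leftarrow>B. norm b) \<le> K * (2 ^ length B - 1)"
  using assms
proof (induction B)
  case (Cons w X)
  have "(\<Sum>b\<leftarrow>X. norm b) \<le> K * (2 ^ length X - 1)"
  proof (rule Cons.IH)
    show "hkz G X" using Cons.prems by simp
    fix Y w' X' assume "X = Y @ w' # X'"
    then show "infdist w' (span (set X')) \<le> K" using Cons.prems(2)[of "w # Y" w' X'] by simp
  qed
  moreover have "norm w \<le> K + (\<Sum>b\<leftarrow>X. norm b)"
    using Cons.prems(1) Cons.prems(2)[of "[]" w X] by simp
  ultimately show ?case by (simp add: algebra_simps)
qed simp

lemma dim_eq_of_spans:
  assumes "set B \<subseteq> G" "G \<subseteq> span (set B)" "set B' \<subseteq> G" "G \<subseteq> span (set B')" "gvol B \<noteq> 0" "gvol B' \<noteq> 0"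
  shows "length B = length B'"
proof -
  have "span (set B) = span (set B')"
    using assms by (metis order_trans span_eq)
  then show ?thesis using assms gvol_nonzero_length by metis
qed

text \<open>The norm bound depends only on \<open>D\<close> and the dimension. Hence bases of all
  admissible lattices can be taken from one ball, and within a single discrete group of this kind
  only finitely many reduced bases have volume up to a given bound.\<close>

theorem reduced_basis_exists:
  fixes G :: "'a::euclidean_space set"
  assumes G: "addgroup G" "discrete_set G" "dets_ge_1 G"
    and B: "set B \<subseteq> G" "G \<subseteq> span (set B)" "gvol B \<noteq> 0" "gvol B \<le> D"
  shows "\<exists>B'. set B' \<subseteq> G \<and> G \<subseteq> int_span B' \<and> gvol B' \<noteq> 0 \<and> gvol B' \<le> gvol B \<and> length B' = length B
     \<and> (\<forall>b\<in>set B'. norm b \<le> D * 4 ^ (DIM('a) * Suc DIM('a)) * 2 ^ DIM('a))"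
proof -
  obtain B' where B': "hkz G B'" "G \<subseteq> int_span B'" using hkz_basis_exists[OF G(1,2)] by auto
  note sub = hkz_subset[OF B'(1)] and nz = hkz_gvol[OF B'(1)]
  have len: "length B = length B'"
    using sub nz B B'(2) int_span_subset_span[of B'] by (intro dim_eq_of_spans[of B G]) auto
  have le: "gvol B' \<le> gvol B"
    using B B'(2) len by (intro gvol_le_of_int_span) auto
  have D1: "D \<ge> 1" using dets_ge_1D[OF G(3) B(1,3)] B(4) by simp
  let ?K = "D * 4 ^ (DIM('a) * Suc DIM('a))"
  have K: "?K \<ge> 0" using D1 by simp
  have "(\<Sum>b\<leftarrow>B'. norm b) \<le> ?K * (2 ^ length B' - 1)"
  proof (rule hkz_norm_sum_bound[OF B'(1)])
    fix Y w X assume "B' = Y @ w # X"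
    then show "infdist w (span (set X)) \<le> ?K"
      using hkz_infdist_bound[OF G(1,3), of Y w X D] B' le B(4) D1 by auto
  qed
  also have "\<dots> \<le> ?K * 2 ^ DIM('a)"
  proof (rule mult_left_mono[OF _ K])
    have "length B' \<le> DIM('a)"
      using gvol_nonzero_length[OF nz] dim_subset_UNIV[of "span (set B')"] by simp
    then have "(2::real) ^ length B' \<le> 2 ^ DIM('a)" by (intro power_increasing) auto
    then show "(2::real) ^ length B' - 1 \<le> 2 ^ DIM('a)" by linarith
  qed
  finally have sum: "(\<Sum>b\<leftarrow>B'. norm b) \<le> ?K * 2 ^ DIM('a)" .
  have "norm b \<le> ?K * 2 ^ DIM('a)" if "b \<in> set B'" for b
  proof -
    have "norm b \<in> set (map norm B')" using that by auto
    then have "norm b \<le> (\<Sum>b\<leftarrow>B'. norm b)"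
      by (rule member_le_sum_list) auto
    then show ?thesis using sum by linarith
  qed
  then show ?thesis using sub nz B'(2) le len by auto
qed

section \<open>Constraints under orthogonal splitting and perturbation\<close>

text \<open>Subtracting lattice vectors of \<open>V\<close> gives each projected vector a preimage
  that is longer by at most a constant. The argument rests on \<open>V\<close> being spanned by
  vectors of \<open>G\<close>: along an irrational subspace the projection can accumulate.\<close>

lemma discrete_set_perp:
  assumes G: "addgroup G" "discrete_set G" and X: "set X \<subseteq> G"
  shows "discrete_set (perp (span (set X)) ` G)"
  unfolding discrete_set_def
proof
  fix r :: real
  let ?V = "span (set X)" and ?\<sigma> = "\<Sum>b\<leftarrow>X. norm b"
  have "perp ?V ` G \<inter> cball 0 r \<subseteq> perp ?V ` (G \<inter> cball 0 (r + ?\<sigma>))"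
  proof
    fix p assume "p \<in> perp ?V ` G \<inter> cball 0 r"
    then obtain z where z: "z \<in> G" "p = perp ?V z" "norm p \<le> r" by auto
    obtain x where x: "x \<in> int_span X" "norm (z - perp ?V z - x) \<le> ?\<sigma>"
      using int_span_round[of "z - perp ?V z" X] perp_diff_in[OF subspace_span] by blast
    have "x \<in> ?V" using x int_span_subset_span by blast
    then have "p = perp ?V (z - x)" by (simp add: z(2) perp_diff_subspace)
    moreover have "z - x \<in> G" using x int_span_minimal[OF G(1) X] z by (auto intro: addgroupD(4)[OF G(1)])
    moreover have "norm (z - x) \<le> norm (perp ?V z) + norm (z - perp ?V z - x)"
      using norm_triangle_ineq[of "perp ?V z" "z - perp ?V z - x"] by simp
    ultimately show "p \<in> perp ?V ` (G \<inter> cball 0 (r + ?\<sigma>))"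
      using x z by (intro image_eqI[of _ _ "z - x"]) auto
  qed
  then show "finite (perp ?V ` G \<inter> cball 0 r)"
    using G(2) by (meson discrete_set_def finite_imageI finite_subset)
qed

text \<open>\<open>X\<close> is a basis of \<open>G \<inter> V\<close> and \<open>Y\<close> lifts a
  basis of the projection. Discreteness of the projection is a hypothesis so that the lemma reaches
  subgroups whose part in \<open>V\<close> does not span \<open>V\<close>.\<close>

lemma adapted_basis:
  assumes G: "addgroup G" "discrete_set G" and V: "subspace V" and P: "discrete_set (perp V ` G)"
  obtains X Y where "set X \<subseteq> G \<inter> V" "G \<inter> V \<subseteq> int_span X" "set Y \<subseteq> G" "G \<subseteq> int_span (Y @ X)"
    "gvol X \<noteq> 0" "gvol (map (perp V) Y) \<noteq> 0" "perp V ` G \<subseteq> int_span (map (perp V) Y)" "gvol (Y @ X) \<noteq> 0"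
proof -
  note lin = linear_perp[OF V]
  obtain X where X: "hkz (G \<inter> V) X" "G \<inter> V \<subseteq> int_span X"
    using hkz_basis_exists[OF addgroup_Int[OF G(1) addgroup_subspace[OF V]] discrete_set_subset[OF G(2)]] by auto
  obtain Z where Z: "hkz (perp V ` G) Z" "perp V ` G \<subseteq> int_span Z"
    using hkz_basis_exists[OF addgroup_linear_image[OF G(1) lin] P] by auto
  have "\<forall>z\<in>set Z. \<exists>y. y \<in> G \<and> perp V y = z" using hkz_subset[OF Z(1)] by auto
  then obtain f where f: "\<And>z. z \<in> set Z \<Longrightarrow> f z \<in> G" "\<And>z. z \<in> set Z \<Longrightarrow> perp V (f z) = z" by metis
  define Y where "Y = map f Z"
  have Y: "set Y \<subseteq> G" "map (perp V) Y = Z" using f by (auto simp: Y_def intro: map_idI)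
  have X': "set X \<subseteq> G \<inter> V" using hkz_subset[OF X(1)] .
  have cover: "G \<subseteq> int_span (Y @ X)"
  proof
    fix g assume g: "g \<in> G"
    then have "perp V g \<in> perp V ` int_span Y" using Z(2) Y(2) int_span_map[OF lin, of Y] by auto
    then obtain y where y: "y \<in> int_span Y" "perp V y = perp V g" by auto
    have "g - y \<in> G" using addgroupD(4)[OF G(1) g] y(1) int_span_minimal[OF G(1) Y(1)] by blast
    moreover have "g - y \<in> V"
      using perp_diff_in[OF V, of "g - y"] y(2) by (simp add: linear_diff[OF lin])
    ultimately have "g - y \<in> int_span X" using X(2) by auto
    moreover have "int_span X \<subseteq> int_span (Y @ X)" "int_span Y \<subseteq> int_span (Y @ X)"
      using set_subset_int_span[of "Y @ X"] by (intro int_span_minimal addgroup_int_span; simp)+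
    ultimately have "y + (g - y) \<in> int_span (Y @ X)"
      using y(1) by (intro addgroupD(2)[OF addgroup_int_span]) blast+
    then show "g \<in> int_span (Y @ X)" by simp
  qed
  have "gvol (map (perp V) Y) * gvol X \<le> gvol (Y @ X)"
    using X' by (intro gvol_append_ge lin norm_perp_le V perp_eq_0) auto
  moreover have "gvol (map (perp V) Y) * gvol X > 0"
    using hkz_gvol[OF X(1)] hkz_gvol[OF Z(1)] gvol_nonneg[of X] gvol_nonneg[of Z] Y(2) by (simp add: less_le)
  ultimately have "gvol (Y @ X) \<noteq> 0" by linarith
  then show ?thesis
    using that[of X Y] X' X(2) Y cover hkz_gvol[OF X(1)] hkz_gvol[OF Z(1)] Z(2) by auto
qed

lemma gvol_map_nonzero:
  assumes "linear T" "gvol (map T B) \<noteq> 0"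
  shows "gvol B \<noteq> 0"
  using assms(2)
proof (induction B)
  case (Cons w B)
  have "w \<notin> span (set B)"
  proof
    assume "w \<in> span (set B)"
    then have "T w \<in> span (set (map T B))" by (auto simp: linear_span_image[OF assms(1)])
    then show False using Cons.prems by (simp add: infdist_span_eq_0_iff[symmetric])
  qed
  then show ?case using Cons by (simp add: infdist_span_eq_0_iff)
qed simp

text \<open>The volume of an image sublattice is at least that of its part in \<open>V\<close> times
  that of its projection along \<open>V\<close>. Since \<open>T\<close> leaves the projection
  unchanged, only sublattices inside \<open>V\<close> have to be watched.\<close>

lemma dets_ge_1_image:
  assumes L: "addgroup L" "discrete_set L" and V: "subspace V" and P: "discrete_set (perp V ` L)"
    and T: "linear T" "\<And>y. perp V (T y) = perp V y"
    and 1: "\<And>X. set X \<subseteq> L \<inter> V \<Longrightarrow> gvol X \<noteq> 0 \<Longrightarrow> gvol (map T X) \<ge> 1"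
    and 2: "dets_ge_1 (perp V ` L)"
  shows "dets_ge_1 (T ` L)"
  unfolding dets_ge_1_def
proof (intro allI impI)
  fix B assume B: "set B \<subseteq> T ` L"
  show "gvol B = 0 \<or> 1 \<le> gvol B"
  proof (cases "gvol B = 0")
    case False
    have "\<forall>b\<in>set B. \<exists>x. x \<in> L \<and> T x = b" using B by auto
    then obtain f where f: "\<And>b. b \<in> set B \<Longrightarrow> f b \<in> L" "\<And>b. b \<in> set B \<Longrightarrow> T (f b) = b" by metis
    define B0 where "B0 = map f B"
    have B0: "set B0 \<subseteq> L" "B = map T B0" using f by (auto simp: B0_def intro: map_idI[symmetric])
    have nz0: "gvol B0 \<noteq> 0" using gvol_map_nonzero[OF T(1)] B0 False by auto
    let ?G = "int_span B0"
    have GL: "?G \<subseteq> L" using int_span_minimal[OF L(1) B0(1)] .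
    obtain X Y where XY: "set X \<subseteq> ?G \<inter> V" "?G \<inter> V \<subseteq> int_span X" "set Y \<subseteq> ?G" "?G \<subseteq> int_span (Y @ X)"
      "gvol X \<noteq> 0" "gvol (map (perp V) Y) \<noteq> 0" "perp V ` ?G \<subseteq> int_span (map (perp V) Y)" "gvol (Y @ X) \<noteq> 0"
      by (rule adapted_basis[OF addgroup_int_span discrete_set_subset[OF L(2) GL] V
            discrete_set_subset[OF P image_mono[OF GL]]])
    have len: "length B0 = length (Y @ X)"
      using XY nz0 set_subset_int_span[of B0] int_span_subset_span[of B0] int_span_subset_span[of "Y @ X"]
      by (intro dim_eq_of_spans[of _ ?G]) auto
    have "set B \<subseteq> int_span (map T (Y @ X))"
      using XY(4) set_subset_int_span[of B0] unfolding int_span_map[OF T(1)] B0(2) by auto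
    then have "gvol (map T (Y @ X)) \<le> gvol B"
      using len False B0(2) by (intro gvol_le_of_int_span) auto
    moreover have "gvol (map (perp V) (map T Y)) * gvol (map T X) \<le> gvol (map T Y @ map T X)"
    proof (intro gvol_append_ge linear_perp norm_perp_le V)
      fix x assume "x \<in> set (map T X)"
      then show "perp V x = 0" using XY(1) T(2) perp_eq_0[OF V] by auto
    qed
    moreover have "map (perp V) (map T Y) = map (perp V) Y" by (simp add: T(2))
    moreover have Y1: "gvol (map (perp V) Y) \<ge> 1"
      using XY(3,6) GL by (intro dets_ge_1D[OF 2]) auto
    moreover have X1: "gvol (map T X) \<ge> 1"
      using XY(1,5) GL by (intro 1) auto
    moreover have "1 * 1 \<le> gvol (map (perp V) Y) * gvol (map T X)" using X1 Y1 by (intro mult_mono) auto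
    ultimately have "1 \<le> gvol B" unfolding map_append by (simp only:)
    then show ?thesis by simp
  qed simp
qed

section \<open>Admissible lattices and orthogonal splitting\<close>

text \<open>\<open>D\<close> bounds the squared covolume from above only, so contractions stay in
  the class. One basis is asked for; \<open>candidate_basis\<close> extends the bound to all of
  them.\<close>

definition candidate :: "real \<Rightarrow> 'a::euclidean_space set \<Rightarrow> bool" where
  "candidate D L \<longleftrightarrow> dets_ge_1 L \<and> (\<exists>B. L = int_span B \<and> gvol B \<noteq> 0 \<and> length B = DIM('a) \<and> gvol B \<le> D)"

lemma candidate_addgroup: "candidate D L \<Longrightarrow> addgroup L"
  and candidate_discrete: "candidate D L \<Longrightarrow> discrete_set L"
  and candidate_dets: "candidate D L \<Longrightarrow> dets_ge_1 L"
  unfolding candidate_def using addgroup_int_span discrete_int_span by blast+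

lemma candidate_basis:
  fixes L :: "'a::euclidean_space set"
  assumes "candidate D L" "set B \<subseteq> L" "L \<subseteq> int_span B" "gvol B \<noteq> 0"
  shows "length B = DIM('a)" "gvol B \<le> D" "L = int_span B"
proof -
  obtain B' where B': "L = int_span B'" "gvol B' \<noteq> 0" "length B' = DIM('a)" "gvol B' \<le> D"
    using assms(1) unfolding candidate_def by auto
  have "length B' = length B"
    using assms B' set_subset_int_span[of B'] int_span_subset_span[of B'] int_span_subset_span[of B]
    by (intro dim_eq_of_spans[of _ L]) auto
  moreover have "set B' \<subseteq> int_span B" using assms(3) B'(1) set_subset_int_span[of B'] by auto
  ultimately show "length B = DIM('a)" "gvol B \<le> D"
    using B' gvol_le_of_int_span[of B' B] by auto
  show "L = int_span B"
    using int_span_minimal[OF candidate_addgroup[OF assms(1)] assms(2)] assms(3) by auto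
qed

lemma candidate_span:
  assumes "candidate D (L :: 'a::euclidean_space set)"
  shows "span L = UNIV"
proof -
  obtain B where B: "L = int_span B" "gvol B \<noteq> 0" "length B = DIM('a)"
    using assms unfolding candidate_def by auto
  have "dim (span (set B)) = dim (UNIV :: 'a set)" using gvol_nonzero_length[OF B(2)] B(3) by simp
  then have "span (set B) = UNIV" using dim_eq_full[of "span (set B)"] by (simp add: span_span)
  moreover have "span (set B) \<subseteq> span L" using B(1) set_subset_int_span[of B] by (intro span_mono) auto
  ultimately show ?thesis by auto
qed

lemma candidate_image:
  fixes L :: "'a::euclidean_space set"
  assumes L: "candidate D L" and T: "linear (T :: 'a \<Rightarrow> 'a)" "inj T" "dets_ge_1 (T ` L)"
    and le: "\<And>B. length B = DIM('a) \<Longrightarrow> gvol B \<noteq> 0 \<Longrightarrow> gvol (map T B) \<le> gvol B"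
  shows "candidate D (T ` L)"
proof -
  obtain B where B: "L = int_span B" "gvol B \<noteq> 0" "length B = DIM('a)" "gvol B \<le> D"
    using L unfolding candidate_def by auto
  have "independent (T ` set B)"
    using B(2) T(2) by (intro linear_independent_injective_image[OF T(1)]) (auto simp: gvol_nonzero_iff intro: inj_on_subset)
  then have "gvol (map T B) \<noteq> 0"
    using B(2) T(2) unfolding gvol_nonzero_iff by (auto simp: distinct_map intro: inj_on_subset)
  then show ?thesis
    using B le[OF B(3,2)] T(3) unfolding candidate_def
    by (intro conjI exI[of _ "map T B"]) (auto simp: int_span_map[OF T(1)])
qed

definition split_sum :: "'a::euclidean_space set \<Rightarrow> 'a set \<Rightarrow> 'a set" where
  "split_sum V L = {c + perp V y | c y. c \<in> L \<inter> V \<and> y \<in> L}"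

text \<open>Because \<open>gvol X0 = 1\<close>, appending \<open>X0\<close> to lifts of projected
  vectors gives a list in \<open>L\<close> with the volume of the projected ones: a small
  determinant in the projection would already occur in \<open>L\<close>. The covolume is unchanged,
  being the product of the two parts both before and after.\<close>

lemma candidate_split_sum:
  fixes L :: "'a::euclidean_space set"
  assumes L: "candidate D L" and X0: "set X0 \<subseteq> L" "gvol X0 = 1"
  shows "candidate D (split_sum (span (set X0)) L)"
proof -
  define V where "V = span (set X0)"
  have V: "subspace V" by (simp add: V_def)
  note lin = linear_perp[OF V]
  note add = candidate_addgroup[OF L] and disc = candidate_discrete[OF L] and dets = candidate_dets[OF L]
  let ?M = "split_sum V L"
  have P: "discrete_set (perp V ` L)" unfolding V_def by (rule discrete_set_perp[OF add disc X0(1)])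
  obtain X Y where XY: "set X \<subseteq> L \<inter> V" "L \<inter> V \<subseteq> int_span X" "set Y \<subseteq> L" "L \<subseteq> int_span (Y @ X)"
      "gvol X \<noteq> 0" "gvol (map (perp V) Y) \<noteq> 0" "perp V ` L \<subseteq> int_span (map (perp V) Y)" "gvol (Y @ X) \<noteq> 0"
    by (rule adapted_basis[OF add disc V P])
  let ?B = "map (perp V) Y @ X"
  have spX: "span (set X) = V"
  proof (rule subset_antisym)
    show "span (set X) \<subseteq> V" using XY(1) V by (intro span_minimal) auto
    have "set X0 \<subseteq> L \<inter> V" using X0(1) by (auto simp: V_def intro: span_base)
    then have "set X0 \<subseteq> span (set X)" using XY(2) int_span_subset_span[of X] by blast
    then show "V \<subseteq> span (set X)" unfolding V_def by (simp add: span_minimal)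
  qed
  have pp: "perp V (perp V y) = perp V y" for y
    by (rule perp_eq_self[OF V perp_orthogonal[OF V]])
  have "gvol ?B = gvol (Y @ X)"
    unfolding gvol_append_perp spX by (simp add: o_def pp)
  then have B: "gvol ?B \<noteq> 0" "gvol ?B \<le> D" "length ?B = DIM('a)"
    using XY candidate_basis[OF L, of "Y @ X"] by auto
  have "int_span ?B \<subseteq> ?M"
  proof (rule int_span_minimal)
    show "addgroup ?M"
      unfolding addgroup_def
    proof (intro conjI ballI)
      show "0 \<in> ?M"
        unfolding split_sum_def using addgroupD(1)[OF add] V
        by (intro CollectI exI[of _ 0]) (auto simp: linear_0[OF lin] subspace_0)
    next
      fix x y assume "x \<in> ?M" "y \<in> ?M"
      then obtain c y1 c' y2 where "x = c + perp V y1" "y = c' + perp V y2" "c \<in> L" "c \<in> V" "c' \<in> L" "c' \<in> V" "y1 \<in> L" "y2 \<in> L"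
        by (auto simp: split_sum_def)
      then show "x + y \<in> ?M"
        unfolding split_sum_def using addgroupD(2)[OF add] subspace_add[OF V]
        by (intro CollectI exI[of _ "c + c'"] exI[of _ "y1 + y2"]) (auto simp: linear_add[OF lin])
    next
      fix x assume "x \<in> ?M"
      then obtain c y where "x = c + perp V y" "c \<in> L" "c \<in> V" "y \<in> L" by (auto simp: split_sum_def)
      then show "- x \<in> ?M"
        unfolding split_sum_def using addgroupD(3)[OF add] subspace_neg[OF V]
        by (intro CollectI exI[of _ "- c"] exI[of _ "- y"]) (auto simp: linear_neg[OF lin])
    qed
    show "set ?B \<subseteq> ?M"
    proof
      fix b assume "b \<in> set ?B"
      then consider "b \<in> set X" | y where "y \<in> set Y" "b = perp V y" by auto
      then show "b \<in> ?M"
      proof cases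
        case 1
        then show ?thesis unfolding split_sum_def using XY(1) addgroupD(1)[OF add]
          by (intro CollectI exI[of _ b] exI[of _ 0]) (auto simp: linear_0[OF lin])
      next
        case 2
        then show ?thesis unfolding split_sum_def using XY(3) addgroupD(1)[OF add] V
          by (intro CollectI exI[of _ 0] exI[of _ y]) (auto simp: subspace_0)
      qed
    qed
  qed
  moreover have "?M \<subseteq> int_span ?B"
  proof
    fix x assume "x \<in> ?M"
    then obtain c y where x: "x = c + perp V y" "c \<in> L" "c \<in> V" "y \<in> L" by (auto simp: split_sum_def)
    have "int_span X \<subseteq> int_span ?B" "int_span (map (perp V) Y) \<subseteq> int_span ?B"
      using set_subset_int_span[of ?B] by (intro int_span_minimal addgroup_int_span; simp)+
    then show "x \<in> int_span ?B"
      unfolding x(1) using x XY(2,7) by (intro addgroupD(2)[OF addgroup_int_span]) auto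
  qed
  ultimately have M: "?M = int_span ?B" by (intro subset_antisym)
  have MV: "?M \<inter> V \<subseteq> L \<inter> V"
  proof
    fix x assume "x \<in> ?M \<inter> V"
    then obtain c y where x: "x = c + perp V y" "c \<in> L" "c \<in> V" "y \<in> L" "x \<in> V" by (auto simp: split_sum_def)
    then have "perp V y \<in> V" using subspace_diff[OF V, of x c] by simp
    then have "perp V y = 0" using perp_eq_0[OF V] pp[of y] by simp
    then show "x \<in> L \<inter> V" using x by simp
  qed
  have MP: "perp V ` ?M \<subseteq> perp V ` L"
    by (auto simp: split_sum_def linear_add[OF lin] pp perp_eq_0[OF V])
  have "dets_ge_1 (id ` ?M)"
  proof (rule dets_ge_1_image[OF _ _ V])
    show "addgroup ?M" unfolding M by (rule addgroup_int_span)
    show "discrete_set ?M" unfolding M by (rule discrete_int_span[OF B(1)])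
    show "discrete_set (perp V ` ?M)" using discrete_set_subset[OF P MP] .
    show "linear id" by (rule linear_id)
    show "perp V (id y) = perp V y" for y by simp
    show "1 \<le> gvol (map id X)" if "set X \<subseteq> ?M \<inter> V" "gvol X \<noteq> 0" for X
    proof -
      have "set X \<subseteq> L" using that(1) MV by blast
      then show ?thesis using dets_ge_1D[OF dets _ that(2)] by simp
    qed
    have "dets_ge_1 (perp V ` L)"
      unfolding dets_ge_1_def
    proof (intro allI impI)
      fix Z assume "set Z \<subseteq> perp V ` L"
      then have "\<forall>z\<in>set Z. \<exists>y. y \<in> L \<and> perp V y = z" by auto
      then obtain f where f: "\<And>z. z \<in> set Z \<Longrightarrow> f z \<in> L" "\<And>z. z \<in> set Z \<Longrightarrow> perp V (f z) = z" by metis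
      define W where "W = map f Z"
      have W: "set W \<subseteq> L" "map (perp V) W = Z" using f by (auto simp: W_def intro: map_idI)
      have "gvol (W @ X0) = gvol Z" using W(2) X0(2) by (simp add: gvol_append_perp V_def)
      then show "gvol Z = 0 \<or> 1 \<le> gvol Z"
        using dets[unfolded dets_ge_1_def, rule_format, of "W @ X0"] W(1) X0(1) by simp
    qed
    then show "dets_ge_1 (perp V ` ?M)" by (rule dets_ge_1_subset[OF _ MP])
  qed
  then have "candidate D ?M"
    using M B unfolding candidate_def by (intro conjI exI[of _ ?B]) simp_all
  then show ?thesis by (simp only: V_def)
qed

section \<open>Perturbations that keep a lattice admissible\<close>

text \<open>A sublattice of squared volume at most 2 has a reduced basis chosen from finitely many
  vectors of \<open>C\<close>, so only finitely many volumes lie in that range and 1 is isolated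
  among them.\<close>

lemma gvol_gap:
  fixes C :: "'a::euclidean_space set"
  assumes C: "addgroup C" "discrete_set C" "dets_ge_1 C"
  shows "\<exists>\<delta>>0. \<forall>X. set X \<subseteq> C \<longrightarrow> gvol X \<noteq> 0 \<longrightarrow> gvol X = 1 \<or> gvol X \<ge> 1 + \<delta>"
proof -
  define R where "R = (2::real) * 4 ^ (DIM('a) * Suc DIM('a)) * 2 ^ DIM('a)"
  \<comment> \<open>\<open>R\<close> is the norm bound of \<open>reduced_basis_exists\<close> for
    \<open>D = 2\<close>.\<close>
  let ?Vals = "gvol ` {B. set B \<subseteq> C \<inter> cball 0 R \<and> length B \<le> DIM('a)}"
  have fin: "finite ?Vals"
    using C(2) by (intro finite_imageI finite_lists_length_le) (auto simp: discrete_set_def)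
  \<comment> \<open>Inserting 1 keeps the minimum defined when no value exceeds 1, and yields
    \<open>\<delta> \<le> 1\<close>, which takes care of volumes above 2.\<close>
  define \<delta> where "\<delta> = Min (insert 1 ((\<lambda>v. v - 1) ` {v\<in>?Vals. v > 1}))"
  have \<delta>: "\<delta> > 0" "\<delta> \<le> 1" "\<And>v. v \<in> ?Vals \<Longrightarrow> v > 1 \<Longrightarrow> \<delta> \<le> v - 1"
    using fin unfolding \<delta>_def by (auto intro!: Min_le simp del: Min_insert)
  have "gvol X = 1 \<or> gvol X \<ge> 1 + \<delta>" if X: "set X \<subseteq> C" "gvol X \<noteq> 0" for X
  proof (cases "gvol X \<le> 2")
    case True
    have GC: "int_span X \<subseteq> C" using int_span_minimal[OF C(1) X(1)] .
    obtain B' where B': "set B' \<subseteq> int_span X" "int_span X \<subseteq> int_span B'" "gvol B' \<noteq> 0"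
        "length B' = length X" "\<forall>b\<in>set B'. norm b \<le> R"
      using reduced_basis_exists[OF addgroup_int_span discrete_int_span[OF X(2)] dets_ge_1_subset[OF C(3) GC]
          set_subset_int_span int_span_subset_span X(2) True] unfolding R_def by auto
    obtain d :: int where d: "gvol X = (of_int d)\<^sup>2 * gvol B'"
      using gvol_int_comb[of X B'] B'(2,4) set_subset_int_span[of X] by auto
    have B1: "gvol B' \<ge> 1" using B'(1,3) GC by (intro dets_ge_1D[OF C(3)]) auto
    \<comment> \<open>\<open>B'\<close> need not be a basis of anything smaller than
      \<open>C\<close>, so the index has to be excluded: absolute value 2 or more would force
      squared volume at least 4.\<close>
    have "\<bar>d\<bar> = 1"
    proof (rule ccontr)
      assume "\<bar>d\<bar> \<noteq> 1"
      moreover have "d \<noteq> 0" using d X(2) by auto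
      ultimately have "\<bar>d\<bar> \<ge> 2" by linarith
      then have "\<bar>d\<bar>\<^sup>2 \<ge> 2\<^sup>2" by (intro power_mono) auto
      then have "of_int 4 \<le> (of_int (d\<^sup>2) :: real)" unfolding of_int_le_iff by simp
      then have "(of_int d :: real)\<^sup>2 \<ge> 4" by simp
      then have "4 * 1 \<le> gvol X" unfolding d using B1 by (intro mult_mono) auto
      then show False using True by simp
    qed
    then have "d = 1 \<or> d = -1" by linarith
    then have "(of_int d :: real)\<^sup>2 = 1" by auto
    then have "gvol X = gvol B'" using d by simp
    moreover have "length B' \<le> DIM('a)"
      using gvol_nonzero_length[OF B'(3)] dim_subset_UNIV[of "span (set B')"] by simp
    ultimately have "gvol X \<in> ?Vals"
      using B'(1,5) GC by (intro image_eqI[of _ _ B']) auto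
    then show ?thesis using \<delta>(3)[of "gvol X"] dets_ge_1D[OF C(3) X] by fastforce
  qed (use \<delta>(2) in auto)
  then show ?thesis using \<delta>(1) by blast
qed

definition shear :: "'a::euclidean_space \<Rightarrow> 'a \<Rightarrow> real \<Rightarrow> 'a \<Rightarrow> 'a" where
  "shear u v \<epsilon> y = y + (\<epsilon> * (v \<bullet> y)) *\<^sub>R u"

lemma linear_shear: "linear (shear u v \<epsilon>)"
  by (rule linearI) (simp_all add: shear_def algebra_simps inner_simps)

lemma inj_shear:
  assumes "u \<bullet> v = 0"
  shows "inj (shear u v \<epsilon>)"
proof (rule inj_on_inverseI)
  show "shear u v (- \<epsilon>) (shear u v \<epsilon> y) = y" for y
    using assms by (simp add: shear_def inner_simps inner_commute[of v u])
qed

text \<open>For lists of \<open>dim V\<close> vectors of \<open>V\<close>, the volume changes by the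
  determinant of the shear on \<open>V\<close>, which is 1. This is read off from a basis of
  \<open>V\<close> made of \<open>u\<close>, \<open>v\<close> and vectors orthogonal to
  \<open>v\<close>, which the shear fixes.\<close>

lemma gvol_shear:
  assumes V: "subspace V" and uv: "u \<in> V" "v \<in> V" "u \<bullet> v = 0" "norm u = 1" "norm v = 1"
    and X: "set X \<subseteq> V" "length X = dim V"
  shows "gvol (map (shear u v \<epsilon>) X) = gvol X"
proof -
  define V' where "V' = {x \<in> V. v \<bullet> x = 0}"
  have V': "subspace V'"
    using V unfolding V'_def subspace_def by (auto simp: inner_simps)
  have "u \<noteq> 0" "v \<noteq> 0" using uv by auto
  have vv: "v \<bullet> v = 1" using uv by (simp add: norm_eq_1)
  have uV': "{u} \<subseteq> V'" using uv by (auto simp: V'_def inner_commute)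
  have "independent {u}" using \<open>u \<noteq> 0\<close> by simp
  from maximal_independent_subset_extend[OF uV' this]
  obtain E where E: "{u} \<subseteq> E" "E \<subseteq> V'" "independent E" "V' \<subseteq> span E" by blast
  have "finite E" using E(3) by (rule independent_imp_finite)
  obtain es where es: "set es = E - {u}" "distinct es" using finite_distinct_list[of "E - {u}"] \<open>finite E\<close> by auto
  \<comment> \<open>\<open>u\<close> stands last and is therefore the first Gram-Schmidt vector, so
    adding a multiple of it to \<open>v\<close> does not alter the distance of \<open>v\<close> to
    its span.\<close>
  define F where "F = es @ [v, u]"
  have spE: "span E \<subseteq> V'" using E(2) V' by (rule span_minimal)
  have vE: "v \<notin> span E" using spE vv by (auto simp: V'_def)
  have setF: "set F = insert v E" using es E(1) by (auto simp: F_def)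
  have "u \<noteq> v" using uv(3) vv by auto
  moreover have "v \<notin> E" using vE span_base by blast
  ultimately have "distinct F"
    using es by (simp add: F_def)
  moreover have "independent (set F)"
    unfolding setF independent_insert using E(3) vE by auto
  ultimately have nz: "gvol F \<noteq> 0" by (simp add: gvol_nonzero_iff)
  have "span (set F) = V"
  proof (rule subset_antisym)
    show "span (set F) \<subseteq> V"
      unfolding setF using E(2) uv V by (intro span_minimal) (auto simp: V'_def)
    show "V \<subseteq> span (set F)"
    proof
      fix x assume x: "x \<in> V"
      have "x - (v \<bullet> x) *\<^sub>R v \<in> V'"
        using x uv vv V by (auto simp: V'_def inner_simps subspace_diff subspace_scale)
      then have "x - (v \<bullet> x) *\<^sub>R v \<in> span E" using E(4) by auto
      then show "x \<in> span (set F)" unfolding setF span_insert by blast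
    qed
  qed
  then have "length X = length F" using gvol_nonzero_length[OF nz] X(2) by simp
  then obtain d where d: "gvol X = d\<^sup>2 * gvol F" "gvol (map (shear u v \<epsilon>) X) = d\<^sup>2 * gvol (map (shear u v \<epsilon>) F)"
    using gvol_real_comb[OF _ _ linear_shear[of u v \<epsilon>], of X F] X(1) \<open>span (set F) = V\<close> by auto
  have "map (shear u v \<epsilon>) es = es"
    using es(1) E(2) by (intro map_idI) (auto simp: shear_def V'_def)
  then have F': "map (shear u v \<epsilon>) F = es @ [v + \<epsilon> *\<^sub>R u, u]"
    using uv vv by (simp add: F_def shear_def inner_commute)
  have "gvol (es @ [v + \<epsilon> *\<^sub>R u, u]) = gvol (es @ [v, u])"
  proof (rule gvol_append_cong)
    have "v + \<epsilon> *\<^sub>R u \<in> span {v, u}" by (intro span_add span_scale) (auto intro: span_base)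
    moreover have "(v + \<epsilon> *\<^sub>R u) - \<epsilon> *\<^sub>R u \<in> span {v + \<epsilon> *\<^sub>R u, u}" by (intro span_diff span_scale) (auto intro: span_base)
    ultimately show "span (set [v + \<epsilon> *\<^sub>R u, u]) = span (set [v, u])"
      by (subst span_eq) (auto intro: span_base)
    have "- \<epsilon> *\<^sub>R u \<in> span {u}" by (intro span_scale span_base) simp
    from perp_diff_subspace[OF subspace_span this, of v]
    have "perp (span {u}) (v + \<epsilon> *\<^sub>R u) = perp (span {u}) v" by simp
    then show "gvol [v + \<epsilon> *\<^sub>R u, u] = gvol [v, u]"
      by (simp add: infdist_eq_norm_perp)
  qed
  then show ?thesis using d F' by (simp add: F_def)
qed

lemma perturb_power_bound:
  fixes \<delta> \<epsilon> :: real
  assumes "0 < \<delta>" "0 \<le> \<epsilon>" "\<epsilon> * (2 * real n * (1 + \<delta>)) \<le> \<delta>" "\<epsilon> \<le> 1" "k \<le> n"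
  shows "1 \<le> (1 - \<epsilon>) ^ (2 * k) * (1 + \<delta>)"
proof -
  have "1 + real (2 * n) * (- \<epsilon>) \<le> (1 + (- \<epsilon>)) ^ (2 * n)"
    using assms by (intro Bernoulli_inequality) auto
  also have "\<dots> \<le> (1 - \<epsilon>) ^ (2 * k)"
    using assms by (auto intro!: power_decreasing)
  finally have "(1 - 2 * real n * \<epsilon>) * (1 + \<delta>) \<le> (1 - \<epsilon>) ^ (2 * k) * (1 + \<delta>)"
    using assms(1) by (intro mult_right_mono) auto
  moreover have "(1 - 2 * real n * \<epsilon>) * (1 + \<delta>) = 1 + (\<delta> - \<epsilon> * (2 * real n * (1 + \<delta>)))"
    by (simp add: algebra_simps)
  ultimately show ?thesis using assms(3) by linarith
qed

text \<open>\<open>J\<close> selects lists whose volume \<open>T\<close> preserves. Any other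
  nonempty independent list in \<open>L \<inter> V\<close> has squared volume at least 1 + \<delta>,
  and a map shrinking lengths on \<open>V\<close> at most by the factor 1 - \<epsilon> cannot bring
  that below 1. The threshold \<open>\<epsilon>0\<close> is chosen before \<open>T\<close>, because
  the maps to which it is applied depend on \<epsilon>.\<close>

lemma candidate_perturb:
  fixes L :: "'a::euclidean_space set"
  assumes L: "candidate D L" and V: "subspace V" and split: "perp V ` L \<subseteq> L"
    and J: "\<And>X. set X \<subseteq> L \<inter> V \<Longrightarrow> gvol X = 1 \<Longrightarrow> X = [] \<or> J X"
  shows "\<exists>\<epsilon>0>0. \<forall>T \<epsilon>. linear T \<and> inj T \<and> (\<forall>y. perp V (T y) = perp V y) \<and> 0 \<le> \<epsilon> \<and> \<epsilon> \<le> \<epsilon>0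
       \<and> (\<forall>x\<in>V. (1 - \<epsilon>) * norm x \<le> norm (T x))
       \<and> (\<forall>X. set X \<subseteq> L \<inter> V \<longrightarrow> J X \<longrightarrow> gvol (map T X) = gvol X)
       \<and> (\<forall>B. length B = DIM('a) \<longrightarrow> gvol (map T B) \<le> gvol B)
       \<longrightarrow> candidate D (T ` L)"
proof -
  note add = candidate_addgroup[OF L] and disc = candidate_discrete[OF L] and dets = candidate_dets[OF L]
  have LV: "L \<inter> V \<subseteq> L" by auto
  obtain \<delta> where \<delta>: "\<delta> > 0" "\<And>X. set X \<subseteq> L \<inter> V \<Longrightarrow> gvol X \<noteq> 0 \<Longrightarrow> gvol X = 1 \<or> gvol X \<ge> 1 + \<delta>"
    using gvol_gap[OF addgroup_Int[OF add addgroup_subspace[OF V]] discrete_set_subset[OF disc LV] dets_ge_1_subset[OF dets LV]]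
    by blast
  \<comment> \<open>The second entry solves the condition of \<open>perturb_power_bound\<close> with
    the dimension for \<open>n\<close>; the first keeps \<open>1 - \<epsilon>\<close>
    nonnegative.\<close>
  define \<epsilon>0 where "\<epsilon>0 = min 1 (\<delta> / (2 * real DIM('a) * (1 + \<delta>)))"
  show ?thesis
  proof (intro exI[of _ \<epsilon>0] conjI allI impI; (elim conjE)?)
    show "\<epsilon>0 > 0" using \<delta>(1) by (simp add: \<epsilon>0_def)
    fix T :: "'a \<Rightarrow> 'a" and \<epsilon> :: real
    assume T0: "linear T" "inj T" "\<forall>y. perp V (T y) = perp V y" and \<epsilon>: "0 \<le> \<epsilon>" "\<epsilon> \<le> \<epsilon>0"
      and lower0: "\<forall>x\<in>V. (1 - \<epsilon>) * norm x \<le> norm (T x)"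
      and TJ0: "\<forall>X. set X \<subseteq> L \<inter> V \<longrightarrow> J X \<longrightarrow> gvol (map T X) = gvol X"
      and le0: "\<forall>B. length B = DIM('a) \<longrightarrow> gvol (map T B) \<le> gvol B"
    have T: "linear T" "inj T" "\<And>y. perp V (T y) = perp V y"
      and lower: "\<And>x. x \<in> V \<Longrightarrow> (1 - \<epsilon>) * norm x \<le> norm (T x)"
      and TJ: "\<And>X. set X \<subseteq> L \<inter> V \<Longrightarrow> J X \<Longrightarrow> gvol (map T X) = gvol X"
      and le: "\<And>B. length B = DIM('a) \<Longrightarrow> gvol (map T B) \<le> gvol B"
      using T0 lower0 TJ0 le0 by blast+
    have pos: "2 * real DIM('a) * (1 + \<delta>) > 0" using \<delta>(1) by simp
    have eps: "\<epsilon> * (2 * real DIM('a) * (1 + \<delta>)) \<le> \<delta>" "\<epsilon> \<le> 1"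
      using \<epsilon>(2) pos_le_divide_eq[OF pos, of \<epsilon> \<delta>] by (auto simp: \<epsilon>0_def)
    have "dets_ge_1 (T ` L)"
    proof (rule dets_ge_1_image[OF add disc V discrete_set_subset[OF disc split] T(1,3)])
      show "dets_ge_1 (perp V ` L)" by (rule dets_ge_1_subset[OF dets split])
      fix X assume X: "set X \<subseteq> L \<inter> V" "gvol X \<noteq> 0"
      have "gvol X \<ge> 1" using X by (intro dets_ge_1D[OF dets]) auto
      consider "X = []" | "J X" | "gvol X \<ge> 1 + \<delta>" using \<delta>(2)[OF X] J[OF X(1)] by auto
      then show "1 \<le> gvol (map T X)"
      proof cases
        case 2
        then show ?thesis using TJ[OF X(1)] \<open>gvol X \<ge> 1\<close> by simp
      next
        case 3
        have "length X \<le> DIM('a)"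
          using gvol_nonzero_length[OF X(2)] dim_subset_UNIV[of "span (set X)"] by simp
        then have "1 \<le> (1 - \<epsilon>) ^ (2 * length X) * (1 + \<delta>)"
          by (intro perturb_power_bound[OF \<delta>(1) \<epsilon>(1) eps])
        also have "\<dots> \<le> (1 - \<epsilon>) ^ (2 * length X) * gvol X"
          using 3 eps(2) by (intro mult_left_mono) auto
        also have "\<dots> \<le> gvol (map T X)"
          using X(1) eps(2) lower by (intro gvol_map_ge[OF T(1) V]) auto
        finally show ?thesis .
      qed simp
    qed
    then show "candidate D (T ` L)"
      using le by (intro candidate_image[OF L T(1,2)]) auto
  qed
qed

text \<open>Here \<open>J\<close> means full rank in \<open>V\<close>, where
  \<open>gvol_shear\<close> gives exact preservation of volume in both directions of
  \<epsilon>.\<close>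

lemma candidate_shear:
  fixes L :: "'a::euclidean_space set"
  assumes L: "candidate D L" and V: "subspace V" and split: "perp V ` L \<subseteq> L"
    and J: "\<And>X. set X \<subseteq> L \<inter> V \<Longrightarrow> gvol X = 1 \<Longrightarrow> X = [] \<or> length X = dim V"
    and uv: "u \<in> V" "v \<in> V" "u \<bullet> v = 0" "norm u = 1" "norm v = 1"
  obtains \<epsilon>0 where "\<epsilon>0 > 0" "\<And>\<epsilon>. \<bar>\<epsilon>\<bar> \<le> \<epsilon>0 \<Longrightarrow> candidate D (shear u v \<epsilon> ` L)"
proof -
  obtain \<epsilon>0 where \<epsilon>0: "\<epsilon>0 > 0"
    and *: "\<forall>T \<epsilon>. linear T \<and> inj T \<and> (\<forall>y. perp V (T y) = perp V y) \<and> 0 \<le> \<epsilon> \<and> \<epsilon> \<le> \<epsilon>0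
       \<and> (\<forall>x\<in>V. (1 - \<epsilon>) * norm x \<le> norm (T x))
       \<and> (\<forall>X. set X \<subseteq> L \<inter> V \<longrightarrow> length X = dim V \<longrightarrow> gvol (map T X) = gvol X)
       \<and> (\<forall>B. length B = DIM('a) \<longrightarrow> gvol (map T B) \<le> gvol B)
       \<longrightarrow> candidate D (T ` L)"
    using candidate_perturb[OF L V split J] by blast
  show ?thesis
  proof (rule that[OF \<epsilon>0])
    fix \<epsilon> :: real assume "\<bar>\<epsilon>\<bar> \<le> \<epsilon>0"
    then show "candidate D (shear u v \<epsilon> ` L)"
    proof (intro *[THEN spec[of _ "shear u v \<epsilon>"], THEN spec[of _ "\<bar>\<epsilon>\<bar>"], THEN mp] conjI allI ballI impI
        linear_shear inj_shear uv)
      show "perp V (shear u v \<epsilon> y) = perp V y" for y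
        using perp_diff_subspace[OF V, of "- (\<epsilon> * (v \<bullet> y)) *\<^sub>R u" y] uv(1) V
        by (simp add: shear_def subspace_scale subspace_neg)
      show "(1 - \<bar>\<epsilon>\<bar>) * norm x \<le> norm (shear u v \<epsilon> x)" for x
      proof -
        have "norm ((\<epsilon> * (v \<bullet> x)) *\<^sub>R u) \<le> \<bar>\<epsilon>\<bar> * norm x"
          using Cauchy_Schwarz_ineq2[of v x] uv by (simp add: abs_mult mult_left_mono)
        moreover have "norm x - norm ((\<epsilon> * (v \<bullet> x)) *\<^sub>R u) \<le> norm (shear u v \<epsilon> x)"
          unfolding shear_def by (rule norm_diff_ineq)
        ultimately show ?thesis by (simp add: algebra_simps)
      qed
      show "gvol (map (shear u v \<epsilon>) X) = gvol X" if "set X \<subseteq> L \<inter> V" "length X = dim V" for X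
        using that by (intro gvol_shear[OF V uv]) auto
      show "gvol (map (shear u v \<epsilon>) B) \<le> gvol B" if "length B = DIM('a)" for B
        using gvol_shear[OF subspace_UNIV, of u v B \<epsilon>] that uv by simp
    qed auto
  qed
qed

text \<open>Without nonempty lists of unit volume in \<open>V\<close> the exceptional predicate
  \<open>J\<close> is \<open>False\<close>: every independent list has room to shrink. The map
  contracts \<open>V\<close> and fixes its complement.\<close>

lemma candidate_shrink:
  fixes L :: "'a::euclidean_space set"
  assumes L: "candidate D L" and V: "subspace V" and split: "perp V ` L \<subseteq> L"
    and J: "\<And>X. set X \<subseteq> L \<inter> V \<Longrightarrow> gvol X = 1 \<Longrightarrow> X = []"
  obtains \<epsilon> where "0 < \<epsilon>" "\<epsilon> < 1" "candidate D ((\<lambda>y. y - \<epsilon> *\<^sub>R (y - perp V y)) ` L)"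
proof -
  have J': "\<And>X. set X \<subseteq> L \<inter> V \<Longrightarrow> gvol X = 1 \<Longrightarrow> X = [] \<or> False" using J by auto
  obtain \<epsilon>0 where \<epsilon>0: "\<epsilon>0 > 0"
    and *: "\<forall>T \<epsilon>. linear T \<and> inj T \<and> (\<forall>y. perp V (T y) = perp V y) \<and> 0 \<le> \<epsilon> \<and> \<epsilon> \<le> \<epsilon>0
       \<and> (\<forall>x\<in>V. (1 - \<epsilon>) * norm x \<le> norm (T x))
       \<and> (\<forall>X. set X \<subseteq> L \<inter> V \<longrightarrow> False \<longrightarrow> gvol (map T X) = gvol X)
       \<and> (\<forall>B. length B = DIM('a) \<longrightarrow> gvol (map T B) \<le> gvol B)
       \<longrightarrow> candidate D (T ` L)"
    using candidate_perturb[OF L V split J'] by blast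
  define \<epsilon> where "\<epsilon> = min (1/2) \<epsilon>0"
  have \<epsilon>: "0 < \<epsilon>" "\<epsilon> < 1" "\<epsilon> \<le> \<epsilon>0" using \<epsilon>0 by (auto simp: \<epsilon>_def)
  let ?T = "\<lambda>y. y - \<epsilon> *\<^sub>R (y - perp V y)"
  have lin: "linear ?T"
    by (rule linearI) (simp_all add: linear_add[OF linear_perp[OF V]] linear_cmul[OF linear_perp[OF V]] algebra_simps)
  have pT: "perp V (?T y) = perp V y" for y
    by (rule perp_diff_subspace[OF V subspace_scale[OF V perp_diff_in[OF V]]])
  show ?thesis
  proof (rule that[OF \<epsilon>(1,2)],
      intro *[THEN spec[of _ ?T], THEN spec[of _ \<epsilon>], THEN mp] conjI allI ballI impI lin pT \<epsilon>(3))
    show "inj ?T"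
      unfolding linear_injective_0[OF lin]
    proof (intro allI impI)
      fix x assume x: "?T x = 0"
      then have "perp V x = 0" using pT[of x] by (simp add: perp_eq_0[OF V] subspace_0[OF V])
      then have "(1 - \<epsilon>) *\<^sub>R x = 0" using x by (simp add: algebra_simps)
      then show "x = 0" using \<epsilon>(2) by simp
    qed
    show "(1 - \<epsilon>) * norm x \<le> norm (?T x)" if "x \<in> V" for x
    proof -
      have "?T x = (1 - \<epsilon>) *\<^sub>R x" using that by (simp add: perp_eq_0[OF V] algebra_simps)
      then show ?thesis using \<epsilon> by simp
    qed
    show "gvol (map ?T B) \<le> gvol B" for B
    proof (rule gvol_map_le[OF lin])
      fix x
      have "?T x = (1 - \<epsilon>) *\<^sub>R x + \<epsilon> *\<^sub>R perp V x" by (simp add: algebra_simps)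
      also have "norm \<dots> \<le> (1 - \<epsilon>) * norm x + \<epsilon> * norm (perp V x)"
        using \<epsilon> by (intro norm_triangle_le) simp
      also have "\<dots> \<le> (1 - \<epsilon>) * norm x + \<epsilon> * norm x"
        using \<epsilon> norm_perp_le[OF V, of x] by (intro add_left_mono mult_left_mono) auto
      finally show "norm (?T x) \<le> norm x" by (simp add: algebra_simps)
    qed
  qed (use \<epsilon> in auto)
qed

section \<open>Gaussian sums over cosets\<close>

lemma has_sum_times_nonneg:
  fixes f :: "'i \<Rightarrow> real" and g :: "'j \<Rightarrow> real"
  assumes "(f has_sum a) A" "(g has_sum b) B" "\<And>x. x \<in> A \<Longrightarrow> f x \<ge> 0" "\<And>y. y \<in> B \<Longrightarrow> g y \<ge> 0"
  shows "((\<lambda>(x, y). f x * g y) has_sum (a * b)) (A \<times> B)"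
proof (rule has_sum_SigmaI)
  show *: "((\<lambda>y. case (x, y) of (x, y) \<Rightarrow> f x * g y) has_sum (f x * b)) B" for x
    using has_sum_cmult_right[OF assms(2), of "f x"] by simp
  show **: "((\<lambda>x. f x * b) has_sum (a * b)) A"
    by (rule has_sum_cmult_left[OF assms(1)])
  show "(\<lambda>(x, y). f x * g y) summable_on A \<times> B"
    using assms by (intro summable_on_SigmaI[OF * has_sum_imp_summable[OF **]]) auto
qed

definition gauss_sum :: "real \<Rightarrow> 'a::euclidean_space set \<Rightarrow> 'a \<Rightarrow> real" where
  "gauss_sum t A x = (\<Sum>\<^sub>\<infinity>y\<in>A. exp (- t * (norm (y + x))\<^sup>2))"

text \<open>Demanded for every \<open>t\<close>, because the doubling argument passes to
  \<open>t / 2\<close> and to \<open>2 * t\<close>.\<close>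

definition gauss_summable :: "'a::euclidean_space set \<Rightarrow> bool" where
  "gauss_summable A \<longleftrightarrow> (\<forall>t>0. (\<lambda>y. exp (- t * (norm y)\<^sup>2)) summable_on A)"

lemma gauss_summable_subset: "gauss_summable A \<Longrightarrow> B \<subseteq> A \<Longrightarrow> gauss_summable B"
  unfolding gauss_summable_def using summable_on_subset_banach by blast

text \<open>Half of \<open>t\<close> is sacrificed to remove the shift, since the square of the norm
  of y is at most twice the sum of those of y + x and x.\<close>

lemma exp_shift_le:
  fixes x y :: "'a::euclidean_space"
  assumes "t > 0"
  shows "exp (- t * (norm (y + x))\<^sup>2) \<le> exp (t * (norm x)\<^sup>2) * exp (- (t / 2) * (norm y)\<^sup>2)"
proof -
  have "(norm y)\<^sup>2 \<le> (norm (y + x) + norm x)\<^sup>2"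
    using norm_triangle_ineq4[of "y + x" x] by (intro power_mono) auto
  also have "\<dots> \<le> 2 * (norm (y + x))\<^sup>2 + 2 * (norm x)\<^sup>2"
    using sum_squares_bound[of "norm (y + x)" "norm x"] by (simp add: power2_sum)
  finally have "t * (norm y)\<^sup>2 \<le> t * (2 * (norm (y + x))\<^sup>2 + 2 * (norm x)\<^sup>2)"
    using assms by (intro mult_left_mono) auto
  then show ?thesis
    by (simp add: exp_add[symmetric] algebra_simps)
qed

lemma gauss_shift_summable:
  assumes "gauss_summable A" "t > 0"
  shows "(\<lambda>y. exp (- t * (norm (y + x))\<^sup>2)) summable_on A"
proof (rule summable_on_comparison_test)
  show "(\<lambda>y. exp (t * (norm x)\<^sup>2) * exp (- (t / 2) * (norm y)\<^sup>2)) summable_on A"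
    using assms(1)[unfolded gauss_summable_def, rule_format, of "t / 2"] assms(2)
    by (intro summable_on_cmult_right) simp
qed (use exp_shift_le[OF assms(2)] in auto)

lemma gauss_sum_has_sum:
  assumes "gauss_summable A" "t > 0"
  shows "((\<lambda>y. exp (- t * (norm (y + x))\<^sup>2)) has_sum gauss_sum t A x) A"
  unfolding gauss_sum_def using gauss_shift_summable[OF assms] by (rule has_sum_infsum)

lemma gauss_sum_nonneg: "gauss_sum t A x \<ge> 0"
  unfolding gauss_sum_def by (intro infsum_nonneg) auto

lemma gauss_sum_0_ge_1:
  assumes "gauss_summable A" "t > 0" "0 \<in> A"
  shows "gauss_sum t A 0 \<ge> 1"
  using infsum_mono_neutral[of "\<lambda>y. exp (- t * (norm (y + 0))\<^sup>2)" "{0}" "\<lambda>y. exp (- t * (norm (y + 0))\<^sup>2)" A]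
    gauss_shift_summable[OF assms(1,2), of 0] assms(3) unfolding gauss_sum_def by simp

lemma gauss_sum_uminus:
  assumes "addgroup G"
  shows "gauss_sum t G (- x) = gauss_sum t G x"
  unfolding gauss_sum_def
proof (rule infsum_reindex_bij_witness[of _ uminus uminus])
  show "exp (- t * (norm (- y + x))\<^sup>2) = exp (- t * (norm (y + - x))\<^sup>2)" for y
    using norm_minus_cancel[of "y + - x"] by simp
qed (use addgroupD(3)[OF assms] in auto)

lemma gauss_sum_periodic:
  assumes "addgroup G" "y \<in> G"
  shows "gauss_sum t G (x - y) = gauss_sum t G x"
  unfolding gauss_sum_def
  by (rule infsum_reindex_bij_witness[of _ "\<lambda>z. z + y" "\<lambda>z. z - y"])
    (use assms addgroupD in \<open>auto simp: algebra_simps\<close>)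

text \<open>A coset of 2 G. The entries of (y + y', y - y') lie in one such coset; conversely, two
  elements of the same coset of 2 G in \<open>G\<close> have half-sum and half-difference in
  \<open>G\<close>.\<close>

definition parity_class :: "'a::euclidean_space set \<Rightarrow> 'a \<Rightarrow> 'a set" where
  "parity_class G u = {u + 2 *\<^sub>R w | w. w \<in> G}"

lemma parity_class_eq:
  assumes "addgroup G" "v \<in> parity_class G u"
  shows "parity_class G v = parity_class G u"
proof -
  obtain w where w: "w \<in> G" "v = u + 2 *\<^sub>R w" using assms(2) by (auto simp: parity_class_def)
  show ?thesis
  proof (rule subset_antisym; rule subsetI)
    fix x assume "x \<in> parity_class G v"
    then obtain w' where "w' \<in> G" "x = v + 2 *\<^sub>R w'" by (auto simp: parity_class_def)
    then show "x \<in> parity_class G u"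
      unfolding parity_class_def using addgroupD(2)[OF assms(1) w(1), of w'] w(2)
      by (intro CollectI exI[of _ "w + w'"]) (simp add: scaleR_add_right)
  next
    fix x assume "x \<in> parity_class G u"
    then obtain w' where "w' \<in> G" "x = u + 2 *\<^sub>R w'" by (auto simp: parity_class_def)
    then show "x \<in> parity_class G v"
      unfolding parity_class_def using addgroupD(4)[OF assms(1) _ w(1), of w'] w(2)
      by (intro CollectI exI[of _ "w' - w"]) (simp add: scaleR_diff_right)
  qed
qed

lemma parity_class_subset:
  assumes "addgroup G" "u \<in> G"
  shows "parity_class G u \<subseteq> G"
  using assms addgroup_of_nat[OF assms(1), of _ 2] by (auto simp: parity_class_def addgroupD)

text \<open>The map \<open>(y, y') \<mapsto> (y + y', y - y')\<close> together with the parallelogram law.\<close>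

lemma gauss_sum_doubling:
  assumes G: "addgroup G" "gauss_summable G" and t: "t > 0"
  shows "((\<lambda>c. gauss_sum (t/2) c (x + x') * gauss_sum (t/2) c (x - x'))
    has_sum gauss_sum t G x * gauss_sum t G x') (parity_class G ` G)"
proof -
  let ?Q = "parity_class G ` G"
  let ?h = "\<lambda>(c :: 'a set, u, v). exp (- (t/2) * (norm (u + (x + x')))\<^sup>2) * exp (- (t/2) * (norm (v + (x - x')))\<^sup>2)"
  have "((\<lambda>(y, y'). exp (- t * (norm (y + x))\<^sup>2) * exp (- t * (norm (y' + x'))\<^sup>2))
      has_sum gauss_sum t G x * gauss_sum t G x') (G \<times> G)"
    by (intro has_sum_times_nonneg gauss_sum_has_sum G t) auto
  also have "?this \<longleftrightarrow> (?h has_sum gauss_sum t G x * gauss_sum t G x') (Sigma ?Q (\<lambda>c. c \<times> c))"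
  proof (rule has_sum_reindex_bij_witness[where j = "\<lambda>(y, y'). (parity_class G (y + y'), (y + y', y - y'))"
        and i = "\<lambda>(c, (u, v)). ((1/2) *\<^sub>R (u + v), (1/2) *\<^sub>R (u - v))"])
    fix a assume a: "a \<in> G \<times> G"
    obtain y y' where y: "a = (y, y')" "y \<in> G" "y' \<in> G" using a by auto
    show "(case case a of (y, y') \<Rightarrow> (parity_class G (y + y'), y + y', y - y') of
        (c, u, v) \<Rightarrow> ((1/2) *\<^sub>R (u + v), (1/2) *\<^sub>R (u - v))) = a"
      unfolding y by (simp add: algebra_simps scaleR_2[symmetric])
    have "y + y' = (y + y') + 2 *\<^sub>R 0" "y - y' = (y + y') + 2 *\<^sub>R (- y')" by (auto simp: scaleR_2)
    then have "y + y' \<in> parity_class G (y + y')" "y - y' \<in> parity_class G (y + y')"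
      using addgroupD(1)[OF G(1)] addgroupD(3)[OF G(1) y(3)] unfolding parity_class_def by blast+
    then show "(case a of (y, y') \<Rightarrow> (parity_class G (y + y'), y + y', y - y')) \<in> Sigma ?Q (\<lambda>c. c \<times> c)"
      using y addgroupD(2)[OF G(1)] by auto
    have "(norm (y + x + (y' + x')))\<^sup>2 + (norm (y + x - (y' + x')))\<^sup>2 = 2 * (norm (y + x))\<^sup>2 + 2 * (norm (y' + x'))\<^sup>2"
      unfolding power2_norm_eq_inner by (simp add: inner_simps)
    moreover have "y + x + (y' + x') = y + y' + (x + x')" "y + x - (y' + x') = y - y' + (x - x')" by auto
    ultimately have "(norm (y + y' + (x + x')))\<^sup>2 + (norm (y - y' + (x - x')))\<^sup>2 = 2 * (norm (y + x))\<^sup>2 + 2 * (norm (y' + x'))\<^sup>2"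
      by (simp only:)
    from arg_cong[OF this, of "\<lambda>z. - (t/2) * z"]
    have "- (t/2) * (norm (y + y' + (x + x')))\<^sup>2 + - (t/2) * (norm (y - y' + (x - x')))\<^sup>2
        = - t * (norm (y + x))\<^sup>2 + - t * (norm (y' + x'))\<^sup>2"
      by (simp add: algebra_simps)
    then show "?h (case a of (y, y') \<Rightarrow> (parity_class G (y + y'), y + y', y - y')) =
       (case a of (y, y') \<Rightarrow> exp (- t * (norm (y + x))\<^sup>2) * exp (- t * (norm (y' + x'))\<^sup>2))"
      unfolding y by (simp only: prod.case exp_add[symmetric])
  next
    fix b assume b: "b \<in> Sigma ?Q (\<lambda>c. c \<times> c)"
    then obtain z u v where z: "b = (parity_class G z, u, v)" "z \<in> G" "u \<in> parity_class G z" "v \<in> parity_class G z"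
      by auto
    then obtain w w' where w: "w \<in> G" "w' \<in> G" "u = z + 2 *\<^sub>R w" "v = z + 2 *\<^sub>R w'"
      by (auto simp: parity_class_def)
    have "(1/2) *\<^sub>R (u + v) = z + w + w'" "(1/2) *\<^sub>R (u - v) = w - w'"
      unfolding w by (simp_all add: algebra_simps scaleR_2[symmetric])
    then show "(case b of (c, u, v) \<Rightarrow> ((1/2) *\<^sub>R (u + v), (1/2) *\<^sub>R (u - v))) \<in> G \<times> G"
      using z w addgroupD[OF G(1)] by simp
    have "(1/2) *\<^sub>R (u + v) + (1/2) *\<^sub>R (u - v) = u" "(1/2) *\<^sub>R (u + v) - (1/2) *\<^sub>R (u - v) = v"
      by (simp_all add: algebra_simps scaleR_2[symmetric])
    then show "(case case b of (c, u, v) \<Rightarrow> ((1/2) *\<^sub>R (u + v), (1/2) *\<^sub>R (u - v)) of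
        (y, y') \<Rightarrow> (parity_class G (y + y'), y + y', y - y')) = b"
      using z parity_class_eq[OF G(1) z(3)] by simp
  qed simp
  finally show ?thesis
  proof (rule has_sum_SigmaD)
    fix c assume "c \<in> ?Q"
    then have "c \<subseteq> G" using parity_class_subset[OF G(1)] by auto
    then have c: "gauss_summable c" using gauss_summable_subset[OF G(2)] by blast
    have "((\<lambda>(u, v). exp (- (t/2) * (norm (u + (x + x')))\<^sup>2) * exp (- (t/2) * (norm (v + (x - x')))\<^sup>2))
        has_sum gauss_sum (t/2) c (x + x') * gauss_sum (t/2) c (x - x')) (c \<times> c)"
      using t by (intro has_sum_times_nonneg gauss_sum_has_sum c) auto
    then show "((\<lambda>y. ?h (c, y)) has_sum gauss_sum (t/2) c (x + x') * gauss_sum (t/2) c (x - x')) (c \<times> c)"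
      by simp
  qed
qed

text \<open>The square is expanded, and each product is an instance of
  \<open>gauss_sum_doubling\<close>: at (2 x, 0), at (0, 0) and, for the mixed term, at (x, - x),
  where evenness of the Gaussian sum is used.\<close>

lemma gauss_sum_square_defect:
  assumes G: "addgroup G" "gauss_summable G" and t: "t > 0"
  shows "((\<lambda>c. (gauss_sum (t/2) c (2 *\<^sub>R x) - gauss_sum (t/2) c 0)\<^sup>2) has_sum
    gauss_sum t G (2 *\<^sub>R x) * gauss_sum t G 0 + (gauss_sum t G 0)\<^sup>2 - 2 * (gauss_sum t G x)\<^sup>2) (parity_class G ` G)"
proof -
  let ?A = "gauss_sum (t/2)" and ?f = "gauss_sum t G"
  have 1: "((\<lambda>c. ?A c (2 *\<^sub>R x) * ?A c (2 *\<^sub>R x)) has_sum ?f (2 *\<^sub>R x) * ?f 0) (parity_class G ` G)"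
    using gauss_sum_doubling[OF assms, of "2 *\<^sub>R x" 0] by simp
  have 2: "((\<lambda>c. ?A c 0 * ?A c 0) has_sum ?f 0 * ?f 0) (parity_class G ` G)"
    using gauss_sum_doubling[OF assms, of 0 0] by simp
  have 3: "((\<lambda>c. - 2 * (?A c 0 * ?A c (2 *\<^sub>R x))) has_sum - 2 * (?f x * ?f x)) (parity_class G ` G)"
    using has_sum_cmult_right[OF gauss_sum_doubling[OF assms, of x "- x"], of "- 2"]
    by (simp add: gauss_sum_uminus[OF G(1)] scaleR_2)
  show ?thesis
    using has_sum_add[OF has_sum_add[OF 1 2] 3]
    by (simp add: power2_eq_square algebra_simps)
qed

lemma gauss_sum_bounded:
  assumes G: "addgroup G" "gauss_summable G" and t: "t > 0" and R: "y \<in> G" "norm (x - y) \<le> R"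
  shows "gauss_sum t G x \<le> exp (t * R\<^sup>2) * gauss_sum (t/2) G 0"
proof -
  have "gauss_sum t G x = gauss_sum t G (x - y)" using gauss_sum_periodic[OF G(1) R(1)] by simp
  also have "\<dots> \<le> exp (t * (norm (x - y))\<^sup>2) * gauss_sum (t/2) G 0"
    unfolding gauss_sum_def infsum_cmult_right'[symmetric]
  proof (rule infsum_mono)
    show "(\<lambda>z. exp (- t * (norm (z + (x - y)))\<^sup>2)) summable_on G" by (rule gauss_shift_summable[OF G(2) t])
    show "(\<lambda>z. exp (t * (norm (x - y))\<^sup>2) * exp (- (t/2) * (norm (z + 0))\<^sup>2)) summable_on G"
      using t by (intro summable_on_cmult_right gauss_shift_summable[OF G(2)]) auto
    show "exp (- t * (norm (z + (x - y)))\<^sup>2) \<le> exp (t * (norm (x - y))\<^sup>2) * exp (- (t/2) * (norm (z + 0))\<^sup>2)" for z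
      using exp_shift_le[OF t, of z "x - y"] by simp
  qed
  also have "\<dots> \<le> exp (t * R\<^sup>2) * gauss_sum (t/2) G 0"
    using R(2) t by (intro mult_right_mono gauss_sum_nonneg) (auto intro!: power_mono)
  finally show ?thesis .
qed

text \<open>Write f for the Gaussian sum and M for its supremum over \<open>V\<close>, which the
  covering hypothesis and periodicity make finite. Nonnegativity of the square defect gives 2 f(x)^2
  \<le> M f(0) + f(0)^2; passing to the supremum, (M - f(0)) (2 M + f(0)) \<le> 0.\<close>

theorem gauss_sum_le:
  assumes G: "addgroup G" "gauss_summable G" and t: "t > 0"
    and V: "subspace V" "\<And>x. x \<in> V \<Longrightarrow> \<exists>y\<in>G. norm (x - y) \<le> R" and x: "x \<in> V"
  shows "gauss_sum t G x \<le> gauss_sum t G 0"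
proof -
  let ?f = "gauss_sum t G"
  have f0: "?f 0 \<ge> 1" using gauss_sum_0_ge_1[OF G(2) t addgroupD(1)[OF G(1)]] .
  have bdd: "bdd_above (?f ` V)"
    using gauss_sum_bounded[OF G t] V(2) by (intro bdd_aboveI2) blast
  define M where "M = (SUP x\<in>V. ?f x)"
  have fM: "?f x \<le> M" if "x \<in> V" for x
    unfolding M_def using that bdd by (rule cSUP_upper)
  have M0: "M \<ge> ?f 0" using fM[OF subspace_0[OF V(1)]] .
  have "?f x \<le> sqrt ((M * ?f 0 + (?f 0)\<^sup>2) / 2)" if "x \<in> V" for x
  proof (rule real_le_rsqrt)
    have "0 \<le> ?f (2 *\<^sub>R x) * ?f 0 + (?f 0)\<^sup>2 - 2 * (?f x)\<^sup>2"
      by (rule has_sum_nonneg[OF gauss_sum_square_defect[OF G t]]) auto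
    moreover have "?f (2 *\<^sub>R x) * ?f 0 \<le> M * ?f 0"
      using f0 that V(1) by (intro mult_right_mono fM) (auto simp: subspace_scale)
    ultimately show "(?f x)\<^sup>2 \<le> (M * ?f 0 + (?f 0)\<^sup>2) / 2" by simp
  qed
  then have "M \<le> sqrt ((M * ?f 0 + (?f 0)\<^sup>2) / 2)"
    unfolding M_def using V(1) by (intro cSUP_least) (auto dest: subspace_0)
  then have "M\<^sup>2 \<le> (sqrt ((M * ?f 0 + (?f 0)\<^sup>2) / 2))\<^sup>2"
    using M0 f0 by (intro power_mono) auto
  also have "\<dots> = (M * ?f 0 + (?f 0)\<^sup>2) / 2"
    using M0 f0 by (intro real_sqrt_pow2) auto
  finally have "(M - ?f 0) * (2 * M + ?f 0) \<le> 0" by (simp add: algebra_simps power2_eq_square)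
  then have "M \<le> ?f 0" using M0 f0 by (simp add: mult_le_0_iff)
  then show ?thesis using fM[OF x] by simp
qed

lemma discrete_set_gap:
  fixes x :: "'a::euclidean_space"
  assumes "discrete_set G" "x \<notin> G"
  shows "\<exists>d>0. \<forall>y\<in>G. d \<le> norm (y - x)"
proof -
  let ?F = "G \<inter> cball 0 (norm x + 1)"
  define d where "d = Min (insert 1 ((\<lambda>y. norm (y - x)) ` ?F))"
  have fin: "finite ?F" using assms(1) by (simp add: discrete_set_def)
  have "d > 0" using fin assms(2) unfolding d_def by auto
  moreover have "d \<le> norm (y - x)" if "y \<in> G" for y
  proof (cases "norm y \<le> norm x + 1")
    case True
    then show ?thesis using fin that unfolding d_def by (intro Min_le) auto
  next
    case False
    have "d \<le> 1" using fin unfolding d_def by (intro Min_le) auto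
    moreover have "norm y - norm x \<le> norm (y - x)" by (rule norm_triangle_ineq2)
    ultimately show ?thesis using False by simp
  qed
  ultimately show ?thesis by blast
qed

text \<open>Equality at \<open>t\<close> forces equality on each parity class; the class of \<open>0\<close> turns this into
  equality at \<open>2 * t\<close>, and so on, whereas off \<open>G\<close> the Gaussian sum vanishes as \<open>t\<close> grows.\<close>

theorem gauss_sum_less:
  assumes G: "addgroup G" "gauss_summable G" "discrete_set G" and t: "t > 0"
    and V: "subspace V" "\<And>x. x \<in> V \<Longrightarrow> \<exists>y\<in>G. norm (x - y) \<le> R" and x: "x \<in> V" "x \<notin> G"
  shows "gauss_sum t G x < gauss_sum t G 0"
proof (rule ccontr)
  assume "\<not> ?thesis"
  then have eq: "gauss_sum t G x = gauss_sum t G 0" using gauss_sum_le[OF G(1,2) t V x(1)] by simp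
  have step: "gauss_sum (2 * t) G x = gauss_sum (2 * t) G 0"
    if t: "t > 0" and eq: "gauss_sum t G x = gauss_sum t G 0" for t
  proof -
    let ?A = "gauss_sum (t/2)" and ?f = "gauss_sum t G"
    let ?c = "parity_class G 0"
    have c: "?c \<in> parity_class G ` G" using addgroupD(1)[OF G(1)] by blast
    \<comment> \<open>By \<open>gauss_sum_le\<close> at \<open>2 *\<^sub>R x\<close> the total
      defect is at most 0, so each of its nonnegative summands vanishes; the one for the class of 0
      is kept.\<close>
    have "?f (2 *\<^sub>R x) * ?f 0 \<le> ?f 0 * ?f 0"
      using gauss_sum_le[OF G(1,2) t V, of "2 *\<^sub>R x"] x(1) V(1)
      by (intro mult_right_mono gauss_sum_nonneg) (auto simp: subspace_scale)
    moreover note gauss_sum_square_defect[OF G(1,2) t, of x]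
    then have hs: "((\<lambda>c. (?A c (2 *\<^sub>R x) - ?A c 0)\<^sup>2) has_sum ?f (2 *\<^sub>R x) * ?f 0 - ?f 0 * ?f 0) (parity_class G ` G)"
      unfolding eq by (simp add: power2_eq_square)
    moreover have "(?A ?c (2 *\<^sub>R x) - ?A ?c 0)\<^sup>2 \<le> ?f (2 *\<^sub>R x) * ?f 0 - ?f 0 * ?f 0"
    proof (rule has_sum_mono_neutral[OF _ hs])
      show "((\<lambda>c. (?A c (2 *\<^sub>R x) - ?A c 0)\<^sup>2) has_sum (?A ?c (2 *\<^sub>R x) - ?A ?c 0)\<^sup>2) {?c}"
        by (rule has_sum_finiteI) auto
    qed (use c in auto)
    ultimately have "(?A ?c (2 *\<^sub>R x) - ?A ?c 0)\<^sup>2 \<le> 0" by linarith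
    then have A: "?A ?c (2 *\<^sub>R x) = ?A ?c 0" by simp
    \<comment> \<open>Scaling by 2 identifies the sum over 2 G with parameter \<open>t / 2\<close>
      at 2 z with the sum over \<open>G\<close> with parameter \<open>2 * t\<close> at z.\<close>
    have "?A ?c (2 *\<^sub>R z) = gauss_sum (2 * t) G z" for z
      unfolding gauss_sum_def
    proof (rule infsum_reindex_bij_witness[of _ "\<lambda>w. 2 *\<^sub>R w" "\<lambda>u. (1/2) *\<^sub>R u"])
      fix u assume "u \<in> ?c"
      then obtain w where w: "u = 2 *\<^sub>R w" "w \<in> G" by (auto simp: parity_class_def)
      show "2 *\<^sub>R (1/2) *\<^sub>R u = u" by simp
      show "(1/2) *\<^sub>R u \<in> G" using w by simp
      have "u + 2 *\<^sub>R z = 2 *\<^sub>R ((1/2) *\<^sub>R u + z)" by (simp add: scaleR_add_right)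
      then have "(norm (u + 2 *\<^sub>R z))\<^sup>2 = 4 * (norm ((1/2) *\<^sub>R u + z))\<^sup>2"
        by (simp only: norm_scaleR power_mult_distrib) simp
      then show "exp (- (2 * t) * (norm ((1/2) *\<^sub>R u + z))\<^sup>2) = exp (- (t/2) * (norm (u + 2 *\<^sub>R z))\<^sup>2)"
        by simp
    qed (auto simp: parity_class_def)
    from this[of x] this[of 0] A show ?thesis by simp
  qed
  have all: "gauss_sum (2 ^ k * t) G x = gauss_sum (2 ^ k * t) G 0" for k
  proof (induction k)
    case (Suc k)
    then show ?case using step[of "2 ^ k * t"] t by (simp add: mult.assoc)
  qed (use eq in simp)
  have "- x \<notin> G" using addgroupD(3)[OF G(1), of "- x"] x(2) by auto
  then obtain d where d: "d > 0" "\<And>y. y \<in> G \<Longrightarrow> d \<le> norm (y + x)"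
    using discrete_set_gap[OF G(3), of "- x"] by auto
  have decay: "1 \<le> exp (- (real k * (t * d\<^sup>2))) * gauss_sum t G x" for k
  proof -
    \<comment> \<open>Of the k + 1 copies of \<open>t\<close> available in 2^k t, one is kept for
      convergence and k produce the decay.\<close>
    have kt: "real k * t + t \<le> 2 ^ k * t"
    proof -
      have "Suc k \<le> 2 ^ k" by (rule Suc_leI) simp
      then have "real (Suc k) \<le> real (2 ^ k)" by (rule of_nat_mono)
      then have "real (Suc k) * t \<le> 2 ^ k * t" using t by (intro mult_right_mono) auto
      then show ?thesis by (simp add: algebra_simps)
    qed
    have "1 \<le> gauss_sum (2 ^ k * t) G x"
      unfolding all using t by (intro gauss_sum_0_ge_1[OF G(2)] addgroupD(1)[OF G(1)]) auto
    also have "\<dots> \<le> exp (- (real k * (t * d\<^sup>2))) * gauss_sum t G x"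
      unfolding gauss_sum_def infsum_cmult_right'[symmetric]
    proof (rule infsum_mono)
      show "(\<lambda>z. exp (- (2 ^ k * t) * (norm (z + x))\<^sup>2)) summable_on G"
        using t by (intro gauss_shift_summable[OF G(2)]) auto
      show "(\<lambda>z. exp (- (real k * (t * d\<^sup>2))) * exp (- t * (norm (z + x))\<^sup>2)) summable_on G"
        using t by (intro summable_on_cmult_right gauss_shift_summable[OF G(2)]) auto
      fix z assume "z \<in> G"
      then have "d\<^sup>2 \<le> (norm (z + x))\<^sup>2" using d by (intro power_mono) auto
      then have "real k * t * d\<^sup>2 \<le> real k * t * (norm (z + x))\<^sup>2"
        using t by (intro mult_left_mono) auto
      moreover have "(real k * t + t) * (norm (z + x))\<^sup>2 \<le> 2 ^ k * t * (norm (z + x))\<^sup>2"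
        using kt by (intro mult_right_mono) auto
      ultimately have "real k * t * d\<^sup>2 + t * (norm (z + x))\<^sup>2 \<le> 2 ^ k * t * (norm (z + x))\<^sup>2"
        unfolding distrib_right by linarith
      then show "exp (- (2 ^ k * t) * (norm (z + x))\<^sup>2) \<le> exp (- (real k * (t * d\<^sup>2))) * exp (- t * (norm (z + x))\<^sup>2)"
        by (simp add: exp_add[symmetric] mult.assoc)
    qed
    finally show ?thesis .
  qed
  have "t * d\<^sup>2 > 0" using t d by simp
  then obtain k :: nat where k: "gauss_sum t G x < real k * (t * d\<^sup>2)"
    using reals_Archimedean3 by blast
  have "real k * (t * d\<^sup>2) < exp (real k * (t * d\<^sup>2))"
    using exp_ge_add_one_self[of "real k * (t * d\<^sup>2)"] by linarith
  moreover have "exp (real k * (t * d\<^sup>2)) \<le> gauss_sum t G x"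
    using decay[of k] by (simp add: exp_minus field_simps)
  ultimately show False using k by simp
qed

section \<open>From Gaussian sums to zeta functions\<close>

text \<open>The Gamma integral after scaling the variable by \<open>c\<close>. It presents a
  negative power as a positive mixture of exponentials, stated for nonnegative integrals so that
  Tonelli applies.\<close>

lemma mellin_exp:
  fixes c s :: real
  assumes "c > 0" "s > 0"
  shows "(\<integral>\<^sup>+t. ennreal (indicator {0..} t * t powr (s - 1) * exp (- t * c)) \<partial>lborel) = ennreal (Gamma s * c powr (- s))"
proof -
  let ?g = "\<lambda>t::real. ennreal (indicator {0..} t * t powr (s - 1) / exp t)"
  have "ennreal (Gamma s) = c * (\<integral>\<^sup>+t. ?g (0 + c * t) \<partial>lborel)"
    unfolding Gamma_conv_nn_integral_real[OF assms(2)] using assms(1)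
    by (subst nn_integral_real_affine[of _ c 0]) auto
  also have "(\<integral>\<^sup>+t. ?g (0 + c * t) \<partial>lborel)
      = (\<integral>\<^sup>+t. ennreal (c powr (s - 1)) * ennreal (indicator {0..} t * t powr (s - 1) * exp (- t * c)) \<partial>lborel)"
    using assms(1)
    by (intro nn_integral_cong)
      (auto simp: ennreal_mult'[symmetric] powr_mult exp_minus field_simps indicator_def zero_le_mult_iff)
  also have "\<dots> = ennreal (c powr (s - 1)) * (\<integral>\<^sup>+t. ennreal (indicator {0..} t * t powr (s - 1) * exp (- t * c)) \<partial>lborel)"
    by (rule nn_integral_cmult) auto
  finally have *: "ennreal (Gamma s) = ennreal (c powr s) * (\<integral>\<^sup>+t. ennreal (indicator {0..} t * t powr (s - 1) * exp (- t * c)) \<partial>lborel)"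
    using assms(1) by (simp add: mult.assoc[symmetric] ennreal_mult'[symmetric] powr_diff)
  have "ennreal (Gamma s * c powr (- s)) = ennreal (c powr (- s)) * ennreal (Gamma s)"
    using Gamma_real_pos[OF assms(2)] by (simp add: ennreal_mult mult.commute)
  also have "\<dots> = (ennreal (c powr (- s)) * ennreal (c powr s)) * (\<integral>\<^sup>+t. ennreal (indicator {0..} t * t powr (s - 1) * exp (- t * c)) \<partial>lborel)"
    unfolding * by (simp add: mult.assoc)
  also have "ennreal (c powr (- s)) * ennreal (c powr s) = 1"
    using assms(1) by (simp add: ennreal_mult'[symmetric] powr_add[symmetric])
  finally show ?thesis by simp
qed

lemma nn_integral_count_space_infsum:
  fixes f :: "'i \<Rightarrow> real"
  assumes "f summable_on I" "\<And>i. i \<in> I \<Longrightarrow> f i \<ge> 0"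
  shows "(\<integral>\<^sup>+i. ennreal (f i) \<partial>count_space I) = ennreal (infsum f I)"
proof -
  have "(\<lambda>i. norm (f i)) summable_on I"
    using assms by (subst summable_on_cong[where g = f]) auto
  then have "Infinite_Set_Sum.abs_summable_on f I"
    by (rule abs_summable_equivalent[THEN iffD1])
  then show ?thesis
    using nn_integral_conv_infsetsum[of f I] assms(2) infsetsum_infsum[of f I] by simp
qed

text \<open>The exponential sums are integrated against t^(s - 1) over the positive half-line;
  Tonelli exchanges sum and integral, and monotonicity transfers the comparison. Strictness at every
  positive \<open>t\<close> means strictness on a set of positive measure, and finiteness of the
  integrals preserves it.\<close>

lemma mellin_compare:
  fixes f h :: "'i \<Rightarrow> real"
  assumes I: "countable I" and s: "s > 0"
    and pos: "\<And>i. i \<in> I \<Longrightarrow> f i > 0" "\<And>i. i \<in> I \<Longrightarrow> h i > 0"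
    and ef: "\<And>t. t > 0 \<Longrightarrow> (\<lambda>i. exp (- t * f i)) summable_on I"
    and eh: "\<And>t. t > 0 \<Longrightarrow> (\<lambda>i. exp (- t * h i)) summable_on I"
    and sf: "(\<lambda>i. f i powr (- s)) summable_on I" and sh: "(\<lambda>i. h i powr (- s)) summable_on I"
    and le: "\<And>t. t > 0 \<Longrightarrow> (\<Sum>\<^sub>\<infinity>i\<in>I. exp (- t * f i)) \<le> (\<Sum>\<^sub>\<infinity>i\<in>I. exp (- t * h i))"
  shows "(\<Sum>\<^sub>\<infinity>i\<in>I. f i powr (- s)) \<le> (\<Sum>\<^sub>\<infinity>i\<in>I. h i powr (- s))"
    and "(\<And>t. t > 0 \<Longrightarrow> (\<Sum>\<^sub>\<infinity>i\<in>I. exp (- t * f i)) < (\<Sum>\<^sub>\<infinity>i\<in>I. exp (- t * h i))) \<Longrightarrow>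
      (\<Sum>\<^sub>\<infinity>i\<in>I. f i powr (- s)) < (\<Sum>\<^sub>\<infinity>i\<in>I. h i powr (- s))"
proof -
  define W where "W = (\<lambda>(g :: 'i \<Rightarrow> real) t. \<integral>\<^sup>+i. ennreal (indicator {0..} t * t powr (s - 1) * exp (- t * g i)) \<partial>count_space I)"
  have G: "Gamma s > 0" using s by (rule Gamma_real_pos)
  have intW: "(\<integral>\<^sup>+t. W g t \<partial>lborel) = ennreal (Gamma s * (\<Sum>\<^sub>\<infinity>i\<in>I. g i powr (- s)))"
    if "\<And>i. i \<in> I \<Longrightarrow> g i > 0" "(\<lambda>i. g i powr (- s)) summable_on I" for g
  proof -
    have "(\<integral>\<^sup>+t. W g t \<partial>lborel) = (\<integral>\<^sup>+i. \<integral>\<^sup>+t. ennreal (indicator {0..} t * t powr (s - 1) * exp (- t * g i)) \<partial>lborel \<partial>count_space I)"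
      unfolding W_def by (rule nn_integral_count_space_nn_integral[OF I]) auto
    also have "\<dots> = (\<integral>\<^sup>+i. ennreal (Gamma s * g i powr (- s)) \<partial>count_space I)"
      using that(1) s by (intro nn_integral_cong mellin_exp) auto
    also have "\<dots> = ennreal (\<Sum>\<^sub>\<infinity>i\<in>I. Gamma s * g i powr (- s))"
      using G that(2) by (intro nn_integral_count_space_infsum summable_on_cmult_right) auto
    finally show ?thesis by (simp add: infsum_cmult_right')
  qed
  have W_pos: "W g t = ennreal (t powr (s - 1) * (\<Sum>\<^sub>\<infinity>i\<in>I. exp (- t * g i)))"
    if "t > 0" "(\<lambda>i. exp (- t * g i)) summable_on I" for g t
  proof -
    have "W g t = (\<integral>\<^sup>+i. ennreal (t powr (s - 1) * exp (- t * g i)) \<partial>count_space I)"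
      using that(1) by (simp add: W_def)
    also have "\<dots> = ennreal (\<Sum>\<^sub>\<infinity>i\<in>I. t powr (s - 1) * exp (- t * g i))"
      using that(2) by (intro nn_integral_count_space_infsum summable_on_cmult_right) auto
    finally show ?thesis by (simp add: infsum_cmult_right')
  qed
  have W_nonpos: "W g t = 0" if "t \<le> 0" for g t
    using that by (cases "t = 0") (auto simp: W_def)
  have Wle: "W f t \<le> W h t" for t
  proof (cases "t > 0")
    case True
    show ?thesis
      unfolding W_pos[OF True ef[OF True]] W_pos[OF True eh[OF True]]
      by (intro ennreal_leI mult_left_mono le[OF True]) auto
  qed (simp add: W_nonpos)
  have nn: "0 \<le> (\<Sum>\<^sub>\<infinity>i\<in>I. h i powr (- s))" by (intro infsum_nonneg) auto
  have "ennreal (Gamma s * (\<Sum>\<^sub>\<infinity>i\<in>I. f i powr (- s))) \<le> ennreal (Gamma s * (\<Sum>\<^sub>\<infinity>i\<in>I. h i powr (- s)))"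
    using nn_integral_mono[of lborel "W f" "W h"] Wle intW[of f, OF pos(1) sf] intW[of h, OF pos(2) sh] by simp
  then show "(\<Sum>\<^sub>\<infinity>i\<in>I. f i powr (- s)) \<le> (\<Sum>\<^sub>\<infinity>i\<in>I. h i powr (- s))"
    using G nn by (simp add: ennreal_le_iff mult_nonneg_nonneg)
  assume less: "\<And>t. t > 0 \<Longrightarrow> (\<Sum>\<^sub>\<infinity>i\<in>I. exp (- t * f i)) < (\<Sum>\<^sub>\<infinity>i\<in>I. exp (- t * h i))"
  interpret sigma_finite_measure "count_space I"
    using I by (rule sigma_finite_measure_count_space_countable)
  have meas: "W g \<in> borel_measurable lborel" for g
    unfolding W_def
  proof (rule borel_measurable_nn_integral)
    have "(\<lambda>(i, t). ennreal (indicator {0..} t * t powr (s - 1) * exp (- t * g i))) \<in> borel_measurable (count_space I \<Otimes>\<^sub>M lborel)"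
      by (rule measurable_pair_measure_countable1[OF I]) simp
    from measurable_compose[OF measurable_pair_swap' this]
    show "(\<lambda>(t, i). ennreal (indicator {0..} t * t powr (s - 1) * exp (- t * g i))) \<in> borel_measurable (lborel \<Otimes>\<^sub>M count_space I)"
      by (simp add: case_prod_beta)
  qed
  have "(\<integral>\<^sup>+t. W f t \<partial>lborel) < (\<integral>\<^sup>+t. W h t \<partial>lborel)"
  proof (rule nn_integral_less[OF meas meas])
    show "(\<integral>\<^sup>+t. W f t \<partial>lborel) \<noteq> \<infinity>" using intW[of f, OF pos(1) sf] by simp
    show "AE t in lborel. W f t \<le> W h t" using Wle by simp
    show "\<not> (AE t in lborel. W h t \<le> W f t)"
    proof
      assume "AE t in lborel. W h t \<le> W f t"
      moreover have "\<not> W h t \<le> W f t" if t: "t > 0" for t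
        unfolding W_pos[OF t ef[OF t]] W_pos[OF t eh[OF t]] not_le
        using less[OF t] t
        by (subst ennreal_less_iff) (auto intro!: mult_nonneg_nonneg infsum_nonneg mult_strict_left_mono)
      ultimately have "AE t in lborel. t \<notin> {0<..<1::real}"
        by (auto elim!: eventually_mono)
      then have "emeasure lborel {0<..<1::real} = 0"
        by (subst (asm) AE_iff_measurable[of "{0<..<1}"]) auto
      then show False by simp
    qed
  qed
  then show "(\<Sum>\<^sub>\<infinity>i\<in>I. f i powr (- s)) < (\<Sum>\<^sub>\<infinity>i\<in>I. h i powr (- s))"
    using intW[of f, OF pos(1) sf] intW[of h, OF pos(2) sh] G nn
    by (simp add: ennreal_less_iff infsum_nonneg mult_nonneg_nonneg)
qed

lemma countable_discrete_set:
  fixes G :: "'a::euclidean_space set"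
  assumes "discrete_set G"
  shows "countable G"
proof -
  have "G = (\<Union>n::nat. G \<inter> cball 0 (real n))"
    using real_arch_simple by auto
  moreover have "countable (\<Union>n::nat. G \<inter> cball 0 (real n))"
    using assms by (intro countable_UN[OF _ countable_finite]) (auto simp: discrete_set_def)
  ultimately show ?thesis by simp
qed

text \<open>Orthogonal sum of \<open>G \<subseteq> V\<close> and \<open>H \<subseteq> V\<^sup>\<bottom>\<close>, where the fibre over \<open>b \<in> H\<close> is shifted by \<open>x b \<in> V\<close>.\<close>

theorem zeta_shift:
  fixes G H :: "'a::euclidean_space set" and x :: "'a \<Rightarrow> 'a"
  assumes G: "addgroup G" "gauss_summable G" "discrete_set G"
    and H: "gauss_summable H" "0 \<in> H" "discrete_set H"
    and V: "subspace V" "\<And>z. z \<in> V \<Longrightarrow> \<exists>y\<in>G. norm (z - y) \<le> R" "G \<subseteq> V"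
    and orth: "\<And>b v. b \<in> H \<Longrightarrow> v \<in> V \<Longrightarrow> b \<bullet> v = 0"
    and x: "\<And>b. b \<in> H \<Longrightarrow> x b \<in> V" "x 0 = 0"
    and s: "s > 0" "q \<ge> 0"
  defines "I \<equiv> H \<times> G - {(0, 0)}"
  assumes sum: "(\<lambda>(b, a). zterm s q (a + x b + b)) summable_on I"
      "(\<lambda>(b, a). zterm s q (a + b)) summable_on I"
  shows zeta_shift_le: "(\<Sum>\<^sub>\<infinity>(b, a)\<in>I. zterm s q (a + x b + b)) \<le> (\<Sum>\<^sub>\<infinity>(b, a)\<in>I. zterm s q (a + b))"
    and zeta_shift_less: "b0 \<in> H \<Longrightarrow> x b0 \<notin> G \<Longrightarrow>
      (\<Sum>\<^sub>\<infinity>(b, a)\<in>I. zterm s q (a + x b + b)) < (\<Sum>\<^sub>\<infinity>(b, a)\<in>I. zterm s q (a + b))"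
proof -
  let ?f = "\<lambda>(b, a). (norm (a + x b + b))\<^sup>2 + q" and ?h = "\<lambda>(b, a). (norm (a + b))\<^sup>2 + q"
  have pyth: "(norm (v + b))\<^sup>2 = (norm v)\<^sup>2 + (norm b)\<^sup>2" if "b \<in> H" "v \<in> V" for b v
    using orth[OF that] unfolding power2_norm_eq_inner by (simp add: inner_simps inner_commute)
  have cI: "countable I"
    unfolding I_def using countable_discrete_set[OF G(3)] countable_discrete_set[OF H(3)] by auto
  have zero: "(0, 0) \<in> H \<times> G" using H(2) addgroupD(1)[OF G(1)] by auto
  have e: "((\<lambda>(b, a). exp (- t * ((norm (a + z b + b))\<^sup>2 + q))) has_sum
        exp (- t * q) * ((\<Sum>\<^sub>\<infinity>b\<in>H. exp (- t * (norm b)\<^sup>2) * gauss_sum t G (z b)) - 1)) I"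
    and sH: "(\<lambda>b. exp (- t * (norm b)\<^sup>2) * gauss_sum t G (z b)) summable_on H"
    if t: "t > 0" and z: "\<And>b. b \<in> H \<Longrightarrow> z b \<in> V" "z 0 = 0" for t z
  proof -
    show sH: "(\<lambda>b. exp (- t * (norm b)\<^sup>2) * gauss_sum t G (z b)) summable_on H"
    proof (rule summable_on_comparison_test)
      show "(\<lambda>b. exp (- t * (norm b)\<^sup>2) * gauss_sum t G 0) summable_on H"
        using H(1) t unfolding gauss_summable_def by (intro summable_on_cmult_left) auto
    qed (use gauss_sum_le[OF G(1,2) t V(1,2)] z(1) in \<open>auto intro!: mult_left_mono mult_nonneg_nonneg gauss_sum_nonneg\<close>)
    let ?e = "\<lambda>(b, a). exp (- t * (norm b)\<^sup>2) * exp (- t * (norm (a + z b))\<^sup>2)"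
    have inner: "((\<lambda>a. ?e (b, a)) has_sum exp (- t * (norm b)\<^sup>2) * gauss_sum t G (z b)) G" for b
      using has_sum_cmult_right[OF gauss_sum_has_sum[OF G(2) t, of "z b"], of "exp (- t * (norm b)\<^sup>2)"] by simp
    have "(?e has_sum (\<Sum>\<^sub>\<infinity>b\<in>H. exp (- t * (norm b)\<^sup>2) * gauss_sum t G (z b))) (H \<times> G)"
      by (rule has_sum_SigmaI[OF inner has_sum_infsum[OF sH]], rule summable_on_SigmaI[OF inner sH]) auto
    then have "(?e has_sum (\<Sum>\<^sub>\<infinity>b\<in>H. exp (- t * (norm b)\<^sup>2) * gauss_sum t G (z b)) - ?e (0, 0)) I"
      unfolding I_def by (rule has_sum_Diff) (use zero in \<open>auto intro: has_sum_finiteI\<close>)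
    from has_sum_cmult_right[OF this, of "exp (- t * q)"]
    have "((\<lambda>i. exp (- t * q) * ?e i) has_sum
        exp (- t * q) * ((\<Sum>\<^sub>\<infinity>b\<in>H. exp (- t * (norm b)\<^sup>2) * gauss_sum t G (z b)) - 1)) I"
      using z(2) by simp
    also have "?this \<longleftrightarrow> ((\<lambda>(b, a). exp (- t * ((norm (a + z b + b))\<^sup>2 + q))) has_sum
        exp (- t * q) * ((\<Sum>\<^sub>\<infinity>b\<in>H. exp (- t * (norm b)\<^sup>2) * gauss_sum t G (z b)) - 1)) I"
    proof (rule has_sum_cong)
      fix i assume "i \<in> I"
      then obtain b a where i: "i = (b, a)" "b \<in> H" "a \<in> G" by (auto simp: I_def)
      have "(norm (a + z b + b))\<^sup>2 = (norm (a + z b))\<^sup>2 + (norm b)\<^sup>2"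
        using i V(1,3) z(1) by (intro pyth) (auto intro: subspace_add)
      then show "exp (- t * q) * ?e i = (case i of (b, a) \<Rightarrow> exp (- t * ((norm (a + z b + b))\<^sup>2 + q)))"
        unfolding i by (simp add: exp_add[symmetric] algebra_simps)
    qed
    finally show "((\<lambda>(b, a). exp (- t * ((norm (a + z b + b))\<^sup>2 + q))) has_sum
        exp (- t * q) * ((\<Sum>\<^sub>\<infinity>b\<in>H. exp (- t * (norm b)\<^sup>2) * gauss_sum t G (z b)) - 1)) I" .
  qed
  have z0: "(\<lambda>b. 0 :: 'a) b \<in> V" for b using V(1) by (simp add: subspace_0)
  have ef: "((\<lambda>i. exp (- t * ?f i)) has_sum
        exp (- t * q) * ((\<Sum>\<^sub>\<infinity>b\<in>H. exp (- t * (norm b)\<^sup>2) * gauss_sum t G (x b)) - 1)) I" if "t > 0" for t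
    using e[of t x, OF that x] by (simp add: case_prod_unfold)
  have eh: "((\<lambda>i. exp (- t * ?h i)) has_sum
        exp (- t * q) * ((\<Sum>\<^sub>\<infinity>b\<in>H. exp (- t * (norm b)\<^sup>2) * gauss_sum t G 0) - 1)) I" if "t > 0" for t
    using e[of t "\<lambda>_. 0", OF that z0 refl] by (simp add: case_prod_unfold)
  have term_le: "exp (- t * (norm b)\<^sup>2) * gauss_sum t G (x b) \<le> exp (- t * (norm b)\<^sup>2) * gauss_sum t G 0"
    if "t > 0" "b \<in> H" for t b
    using gauss_sum_le[OF G(1,2) that(1) V(1,2) x(1)[OF that(2)]] by (intro mult_left_mono) auto
  have le: "(\<Sum>\<^sub>\<infinity>i\<in>I. exp (- t * ?f i)) \<le> (\<Sum>\<^sub>\<infinity>i\<in>I. exp (- t * ?h i))" if t: "t > 0" for t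
    unfolding infsumI[OF ef[OF t]] infsumI[OF eh[OF t]]
    using sH[of t x, OF t x] sH[of t "\<lambda>_. 0", OF t z0 refl] term_le[OF t]
    by (intro mult_left_mono diff_right_mono infsum_mono) auto
  have pos: "?f i > 0" "?h i > 0" if "i \<in> I" for i
  proof -
    obtain b a where i: "i = (b, a)" "b \<in> H" "a \<in> G" "b \<noteq> 0 \<or> a \<noteq> 0" using \<open>i \<in> I\<close> by (auto simp: I_def)
    have a: "a \<in> V" "a + x b \<in> V" using i V(1,3) x(1) by (auto intro: subspace_add)
    have "b \<noteq> 0 \<or> a + x b \<noteq> 0" using i(4) x(2) by auto
    then have "(norm (a + x b))\<^sup>2 + (norm b)\<^sup>2 > 0" "(norm a)\<^sup>2 + (norm b)\<^sup>2 > 0"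
      using i(4) by (auto simp: sum_power2_gt_zero_iff)
    then show "?f i > 0" "?h i > 0"
      using s(2) pyth[OF i(2) a(1)] pyth[OF i(2) a(2)] by (auto simp: i(1))
  qed
  have sm: "(\<lambda>i. ?f i powr (- s)) summable_on I" "(\<lambda>i. ?h i powr (- s)) summable_on I"
    using sum by (simp_all add: case_prod_unfold)
  note M = mellin_compare[OF cI s(1) pos has_sum_imp_summable[OF ef] has_sum_imp_summable[OF eh] sm le]
  show "(\<Sum>\<^sub>\<infinity>(b, a)\<in>I. zterm s q (a + x b + b)) \<le> (\<Sum>\<^sub>\<infinity>(b, a)\<in>I. zterm s q (a + b))"
    using M(1) by (simp add: case_prod_unfold)
  assume b0: "b0 \<in> H" "x b0 \<notin> G"
  have "(\<Sum>\<^sub>\<infinity>i\<in>I. exp (- t * ?f i)) < (\<Sum>\<^sub>\<infinity>i\<in>I. exp (- t * ?h i))" if t: "t > 0" for t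
    unfolding infsumI[OF ef[OF t]] infsumI[OF eh[OF t]]
  proof (intro mult_strict_left_mono diff_strict_right_mono)
    show "(\<Sum>\<^sub>\<infinity>b\<in>H. exp (- t * (norm b)\<^sup>2) * gauss_sum t G (x b)) < (\<Sum>\<^sub>\<infinity>b\<in>H. exp (- t * (norm b)\<^sup>2) * gauss_sum t G 0)"
    proof (rule has_sum_strict_mono[OF has_sum_infsum has_sum_infsum])
      show "(\<lambda>b. exp (- t * (norm b)\<^sup>2) * gauss_sum t G (x b)) summable_on H" using sH[of t x, OF t x] .
      show "(\<lambda>b. exp (- t * (norm b)\<^sup>2) * gauss_sum t G 0) summable_on H" using sH[of t "\<lambda>_. 0", OF t z0 refl] by simp
      show "exp (- t * (norm b0)\<^sup>2) * gauss_sum t G (x b0) < exp (- t * (norm b0)\<^sup>2) * gauss_sum t G 0"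
        using gauss_sum_less[OF G t V(1,2) x(1)[OF b0(1)] b0(2)] by simp
    qed (use term_le[OF t] b0 in auto)
  qed auto
  then show "(\<Sum>\<^sub>\<infinity>(b, a)\<in>I. zterm s q (a + x b + b)) < (\<Sum>\<^sub>\<infinity>(b, a)\<in>I. zterm s q (a + b))"
    using M(2) by (simp add: case_prod_unfold)
qed

section \<open>Convergence\<close>

lemma summable_on_int_powr:
  assumes "p > 1"
  shows "(\<lambda>a::int. (1 + \<bar>real_of_int a\<bar>) powr (- p)) summable_on UNIV"
proof -
  let ?g = "\<lambda>a::int. (1 + \<bar>real_of_int a\<bar>) powr (- p)"
  have "summable (\<lambda>n. real n powr (- p))"
    using assms by (subst summable_real_powr_iff) simp
  then have "summable (\<lambda>n. real (Suc n) powr (- p))"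
    by (subst summable_Suc_iff)
  then have N: "(\<lambda>n. (1 + real n) powr (- p)) summable_on UNIV"
    by (subst summable_on_UNIV_nonneg_real_iff) (auto simp: add.commute)
  have "?g summable_on (range int)"
    by (subst summable_on_reindex) (use N in \<open>auto simp: o_def inj_on_def\<close>)
  moreover have "?g summable_on (range (\<lambda>n. - int n))"
    by (subst summable_on_reindex) (use N in \<open>auto simp: o_def inj_on_def\<close>)
  ultimately have "?g summable_on (range int \<union> range (\<lambda>n. - int n))"
    by (rule summable_on_union)
  also have "range int \<union> range (\<lambda>n. - int n) = UNIV"
  proof -
    have "a \<in> range int \<union> range (\<lambda>n. - int n)" for a :: int
      by (cases a rule: int_cases2) auto
    then show ?thesis by auto
  qed
  finally show ?thesis .
qed

lemma powr_minus_scale: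
  fixes C x y p :: real
  assumes "0 < C" "0 < x" "0 < y" "y \<le> C * x" "0 \<le> p"
  shows "x powr (- p) \<le> C powr p * y powr (- p)"
proof -
  have "(C * x) powr (- p) = C powr (- p) * x powr (- p)" using assms by (simp add: powr_mult)
  then have "x powr (- p) = C powr p * (C * x) powr (- p)"
    using assms(1) by (simp add: mult.assoc[symmetric] powr_add[symmetric])
  also have "\<dots> \<le> C powr p * y powr (- p)"
    using assms by (intro mult_left_mono powr_mono2') auto
  finally show ?thesis .
qed

text \<open>The norm controls both the integer coefficient of \<open>w\<close> and the remaining
  vector of \<open>int_span B\<close>, so the term is dominated by a product of a one-dimensional
  term and one for the shorter basis.\<close>

lemma int_span_powr_summable:
  fixes B :: "'a::euclidean_space list" and p :: real
  assumes "gvol B \<noteq> 0" "p > length B"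
  shows "(\<lambda>y. (1 + norm y) powr (- p)) summable_on int_span B"
  using assms
proof (induction B arbitrary: p)
  case (Cons w B)
  \<comment> \<open>The excess of \<open>p\<close> over \<open>length B + 1\<close> is shared
    equally, so that the two exponents exceed their thresholds 1 and
    \<open>length B\<close>.\<close>
  define p1 p2 where "p1 = 1 + (p - length B - 1) / 2" and "p2 = length B + (p - length B - 1) / 2"
  have p: "p = p1 + p2" "p1 > 1" "p2 > length B" "p2 \<ge> 0"
    using Cons.prems(2) by (auto simp: p1_def p2_def field_simps)
  let ?d = "infdist w (span (set B))"
  have d: "?d > 0" using Cons.prems infdist_nonneg[of w "span (set B)"] by (auto simp: less_le)
  define C1 where "C1 = 1 + 1 / ?d"
  define C2 where "C2 = 1 + norm w / ?d"
  have C: "C1 > 0" "C2 > 0" using d by (auto simp: C1_def C2_def add_pos_nonneg)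
  let ?j = "\<lambda>(a::int, y). of_int a *\<^sub>R w + y"
  have inj: "inj_on ?j (UNIV \<times> int_span B)"
  proof (rule inj_onI)
    fix z z' assume "z \<in> UNIV \<times> int_span B" "z' \<in> UNIV \<times> int_span B" "?j z = ?j z'"
    then obtain a y a' y' where z: "z = (a, y)" "z' = (a', y')" "y \<in> int_span B" "y' \<in> int_span B"
      and eq: "of_int a *\<^sub>R w + y = of_int a' *\<^sub>R w + y'" by auto
    have "y - y' \<in> span (set B)" using z int_span_subset_span by (auto intro: span_diff)
    from infdist_scale_le_norm[OF this, of "of_int (a - a')" w]
    have "\<bar>real_of_int (a - a')\<bar> * ?d \<le> 0" using eq by (simp add: algebra_simps)
    then have "a = a'" using d by (simp add: mult_le_0_iff)
    then show "z = z'" using z eq by simp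
  qed
  have img: "?j ` (UNIV \<times> int_span B) = int_span (w # B)"
    by (auto simp: int_span_Cons image_iff)
  have "(\<lambda>z. (1 + norm (?j z)) powr (- p)) summable_on UNIV \<times> int_span B"
  proof (rule summable_on_comparison_test)
    have f: "((\<lambda>a::int. (1 + \<bar>real_of_int a\<bar>) powr (- p1)) has_sum (\<Sum>\<^sub>\<infinity>a. (1 + \<bar>real_of_int a\<bar>) powr (- p1))) UNIV"
      by (rule has_sum_infsum[OF summable_on_int_powr[OF p(2)]])
    have g: "((\<lambda>y. (1 + norm y) powr (- p2)) has_sum (\<Sum>\<^sub>\<infinity>y\<in>int_span B. (1 + norm y) powr (- p2))) (int_span B)"
      using Cons p(3) by (intro has_sum_infsum) auto
    show "(\<lambda>z. C1 powr p1 * C2 powr p2 * (\<lambda>(a, y). (1 + \<bar>real_of_int a\<bar>) powr (- p1) * (1 + norm y) powr (- p2)) z) summable_on UNIV \<times> int_span B"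
      by (intro summable_on_cmult_right has_sum_imp_summable[OF has_sum_times_nonneg[OF f g]]) auto
    fix z assume "z \<in> (UNIV :: int set) \<times> int_span B"
    then obtain a y where z: "z = (a, y)" "y \<in> int_span B" by auto
    let ?N = "1 + norm (of_int a *\<^sub>R w + y)"
    have a: "\<bar>real_of_int a\<bar> \<le> norm (of_int a *\<^sub>R w + y) / ?d"
      using infdist_scale_le_norm[of y "set B" "of_int a" w] z int_span_subset_span[of B] d
      by (auto simp: field_simps)
    have 1: "1 + \<bar>real_of_int a\<bar> \<le> C1 * ?N"
      using a d by (simp add: C1_def algebra_simps add_increasing)
    have "norm y \<le> norm (of_int a *\<^sub>R w + y) + \<bar>real_of_int a\<bar> * norm w"
      using norm_triangle_ineq4[of "of_int a *\<^sub>R w + y" "of_int a *\<^sub>R w"] by simp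
    also have "\<dots> \<le> norm (of_int a *\<^sub>R w + y) + norm (of_int a *\<^sub>R w + y) / ?d * norm w"
      using a by (intro add_left_mono mult_right_mono) auto
    finally have y: "norm y \<le> norm (of_int a *\<^sub>R w + y) + norm (of_int a *\<^sub>R w + y) / ?d * norm w" .
    have 2: "1 + norm y \<le> C2 * ?N"
    proof -
      have "0 \<le> norm w / ?d" using d by simp
      then show ?thesis
        using y by (simp add: C2_def algebra_simps)
    qed
    have N: "?N > 0" by (simp add: add_pos_nonneg)
    have "?N powr (- p1) \<le> C1 powr p1 * (1 + \<bar>real_of_int a\<bar>) powr (- p1)"
      using 1 p(2) C N by (intro powr_minus_scale) auto
    moreover have "?N powr (- p2) \<le> C2 powr p2 * (1 + norm y) powr (- p2)"
      using 2 p(4) C N by (intro powr_minus_scale) (auto simp: add_pos_nonneg)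
    ultimately have "?N powr (- p1) * ?N powr (- p2)
        \<le> (C1 powr p1 * (1 + \<bar>real_of_int a\<bar>) powr (- p1)) * (C2 powr p2 * (1 + norm y) powr (- p2))"
      by (intro mult_mono) auto
    then show "(1 + norm (?j z)) powr (- p) \<le> C1 powr p1 * C2 powr p2 * (\<lambda>(a, y). (1 + \<bar>real_of_int a\<bar>) powr (- p1) * (1 + norm y) powr (- p2)) z"
      unfolding z(1) p(1) using N by (simp add: powr_add[symmetric] mult_ac)
  qed auto
  then show ?case
    unfolding img[symmetric] summable_on_reindex[OF inj] by (simp add: o_def)
qed simp

lemma gauss_summable_int_span:
  assumes "gvol B \<noteq> 0"
  shows "gauss_summable (int_span B)"
  unfolding gauss_summable_def
proof (intro allI impI)
  fix t :: real assume t: "t > 0"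
  define m where "m = real (length B) + 1"
  show "(\<lambda>y. exp (- t * (norm y)\<^sup>2)) summable_on int_span B"
  proof (rule summable_on_comparison_test)
    show "(\<lambda>y. exp (m\<^sup>2 / (4 * t)) * (1 + norm y) powr (- m)) summable_on int_span B"
      using int_span_powr_summable[OF assms, of m] by (intro summable_on_cmult_right) (simp add: m_def)
    fix y
    have "(1 + norm y) powr m \<le> exp (norm y) powr m"
      using exp_ge_add_one_self[of "norm y"] by (intro powr_mono2) (auto simp: m_def)
    also have "\<dots> = exp (m * norm y)" by (simp add: exp_powr_real mult.commute)
    also have "\<dots> \<le> exp (m\<^sup>2 / (4 * t) + t * (norm y)\<^sup>2)"
    proof -
      \<comment> \<open>Completing the square; this is the origin of the constant
        \<open>exp (m\<^sup>2 / (4 * t))\<close>.\<close>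
      have "0 \<le> (m - 2 * t * norm y)\<^sup>2 / (4 * t)" using t by simp
      also have "\<dots> = m\<^sup>2 / (4 * t) - m * norm y + t * (norm y)\<^sup>2"
        using t by (simp add: power2_diff field_simps power2_eq_square)
      finally show ?thesis by simp
    qed
    finally have "(1 + norm y) powr m * exp (- t * (norm y)\<^sup>2) \<le> exp (m\<^sup>2 / (4 * t) + t * (norm y)\<^sup>2) * exp (- t * (norm y)\<^sup>2)"
      by (intro mult_right_mono) auto
    also have "\<dots> = exp (m\<^sup>2 / (4 * t))" by (simp add: exp_add[symmetric])
    finally have le: "(1 + norm y) powr m * exp (- t * (norm y)\<^sup>2) \<le> exp (m\<^sup>2 / (4 * t))" .
    show "exp (- t * (norm y)\<^sup>2) \<le> exp (m\<^sup>2 / (4 * t)) * (1 + norm y) powr (- m)"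
    proof -
      have "1 + norm y > 0" by (simp add: add_pos_nonneg)
      then have "(1 + norm y) powr m > 0" by simp
      then show ?thesis
        using le by (simp add: powr_minus field_simps)
    qed
  qed auto
qed

lemma zeta_summable_int_span:
  fixes B :: "'a::euclidean_space list"
  assumes "gvol B \<noteq> 0" "s > length B / 2" "q \<ge> 0"
  shows "(\<lambda>y. zterm s q y) summable_on (int_span B - {0})"
proof -
  have "discrete_set (int_span B - {0})"
    using discrete_int_span[OF assms(1)] discrete_set_subset by blast
  then obtain d where d: "d > 0" "\<And>y. y \<in> int_span B - {0} \<Longrightarrow> d \<le> norm (y - 0)"
    using discrete_set_gap[of "int_span B - {0}" 0] by auto
  \<comment> \<open>Nonzero lattice vectors have norm at least \<open>d\<close>, so
    \<open>1 + norm y \<le> C * norm y\<close>.\<close>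
  define C where "C = 1 + 1 / d"
  have C: "C > 0" using d by (simp add: C_def add_pos_pos)
  have s0: "s > 0" using assms(2) by (meson divide_nonneg_pos le_less_trans of_nat_0_le_iff zero_less_numeral)
  show ?thesis
  proof (rule summable_on_comparison_test)
    have "(\<lambda>y. (1 + norm y) powr (- (2 * s))) summable_on int_span B"
      using int_span_powr_summable[OF assms(1), of "2 * s"] assms(2) by simp
    then have "(\<lambda>y. (1 + norm y) powr (- (2 * s))) summable_on (int_span B - {0})"
      by (rule summable_on_subset_banach) auto
    then show "(\<lambda>y. C powr (2 * s) * (1 + norm y) powr (- (2 * s))) summable_on (int_span B - {0})"
      by (rule summable_on_cmult_right)
    fix y assume y: "y \<in> int_span B - {0}"
    then have n: "norm y > 0" "d \<le> norm y" using d(2)[OF y] by auto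
    then have "1 \<le> norm y / d" using d(1) by simp
    then have "1 + norm y \<le> C * norm y" by (simp add: C_def algebra_simps)
    then have *: "norm y powr (- (2 * s)) \<le> C powr (2 * s) * (1 + norm y) powr (- (2 * s))"
      using C n s0 by (intro powr_minus_scale) (auto intro: add_pos_nonneg)
    have "zterm s q y \<le> ((norm y)\<^sup>2) powr (- s)"
      using assms(3) s0 n by (intro powr_mono2') auto
    also have "((norm y)\<^sup>2) powr (- s) = norm y powr (- (2 * s))"
    proof -
      have e: "(norm y)\<^sup>2 = norm y powr 2" using n by simp
      show ?thesis unfolding e powr_powr by simp
    qed
    finally show "zterm s q y \<le> C powr (2 * s) * (1 + norm y) powr (- (2 * s))"
      using * by linarith
  qed auto
qed

section \<open>Existence of a maximizer\<close>

lemma zeta_summable_candidate: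
  fixes L :: "'a::euclidean_space set"
  assumes "candidate D L" "s > DIM('a) / 2" "q \<ge> 0"
  shows "(\<lambda>y. zterm s q y) summable_on (L - {0})"
  using assms zeta_summable_int_span unfolding candidate_def by (metis (mono_tags, lifting))

lemma zeta_image:
  assumes "linear T" "inj_on T L" "0 \<in> L"
  shows "zeta' (T ` L) s q = (\<Sum>\<^sub>\<infinity>y\<in>L - {0}. zterm s q (T y))"
    and "(\<lambda>y. zterm s q y) summable_on (T ` L - {0}) \<longleftrightarrow>
      (\<lambda>y. zterm s q (T y)) summable_on (L - {0})"
proof -
  have "T y \<noteq> 0" if "y \<in> L - {0}" for y
    using that inj_onD[OF assms(2), of y 0] assms(3) linear_0[OF assms(1)] by auto
  then have eq: "T ` L - {0} = T ` (L - {0})" using linear_0[OF assms(1)] by auto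
  have inj: "inj_on T (L - {0})" using assms(2) by (rule inj_on_subset) auto
  show "zeta' (T ` L) s q = (\<Sum>\<^sub>\<infinity>y\<in>L - {0}. zterm s q (T y))"
    unfolding zeta'_def eq by (subst infsum_reindex[OF inj]) (simp add: o_def)
  show "(\<lambda>y. zterm s q y) summable_on (T ` L - {0}) \<longleftrightarrow>
      (\<lambda>y. zterm s q (T y)) summable_on (L - {0})"
    unfolding eq by (subst summable_on_reindex[OF inj]) (simp add: o_def)
qed

text \<open>Each term grows at most by the stated factor, since (1 - \<epsilon>)^2 \<le> 1 absorbs
  \<open>q\<close>. This is the upper semicontinuity on which the existence of a maximum
  rests.\<close>

lemma zeta_expansion_le:
  fixes L :: "'a::euclidean_space set"
  assumes T: "linear T" and L: "addgroup L" and \<epsilon>: "\<epsilon> < 1" and lower: "\<And>y. y \<in> L \<Longrightarrow> (1 - \<epsilon>) * norm y \<le> norm (T y)" "0 \<le> \<epsilon>"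
    and s: "s > 0" "q \<ge> 0"
    and sum: "(\<lambda>y. zterm s q y) summable_on (L - {0})"
  shows "zeta' (T ` L) s q \<le> ((1 - \<epsilon>)\<^sup>2) powr (- s) * zeta' L s q"
proof -
  have inj: "inj_on T L"
  proof (rule inj_onI)
    fix x y assume "x \<in> L" "y \<in> L" "T x = T y"
    then have "(1 - \<epsilon>) * norm (x - y) \<le> 0"
      using lower(1)[OF addgroupD(4)[OF L, of x y]] by (simp add: linear_diff[OF T])
    then show "x = y" using \<epsilon> by (simp add: mult_le_0_iff)
  qed
  have *: "zterm s q (T y) \<le> ((1 - \<epsilon>)\<^sup>2) powr (- s) * zterm s q y" if y: "y \<in> L - {0}" for y
  proof -
    have "((1 - \<epsilon>) * norm y)\<^sup>2 \<le> (norm (T y))\<^sup>2" using y \<epsilon> lower by (intro power_mono) auto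
    moreover have "(1 - \<epsilon>)\<^sup>2 * q \<le> 1 * q" using \<epsilon> lower(2) s by (intro mult_right_mono power_le_one) auto
    ultimately have "(1 - \<epsilon>)\<^sup>2 * ((norm y)\<^sup>2 + q) \<le> (norm (T y))\<^sup>2 + q"
      unfolding power_mult_distrib distrib_left by linarith
    moreover have "(1 - \<epsilon>)\<^sup>2 * ((norm y)\<^sup>2 + q) > 0" using \<epsilon> y s by (intro mult_pos_pos add_pos_nonneg) auto
    ultimately have "zterm s q (T y) \<le> ((1 - \<epsilon>)\<^sup>2 * ((norm y)\<^sup>2 + q)) powr (- s)"
      using s by (intro powr_mono2') auto
    then show ?thesis using s by (simp add: powr_mult)
  qed
  have sum': "(\<lambda>y. ((1 - \<epsilon>)\<^sup>2) powr (- s) * zterm s q y) summable_on (L - {0})"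
    by (rule summable_on_cmult_right[OF sum])
  have "zeta' (T ` L) s q \<le> (\<Sum>\<^sub>\<infinity>y\<in>L - {0}. ((1 - \<epsilon>)\<^sup>2) powr (- s) * zterm s q y)"
    unfolding zeta_image(1)[OF T inj addgroupD(1)[OF L]]
    using * by (intro infsum_mono summable_on_comparison_test[OF sum'] sum') auto
  then show ?thesis by (simp add: infsum_cmult_right' zeta'_def)
qed

lemma coordinates_bounded:
  fixes B :: "'a::euclidean_space list"
  assumes "gvol B \<noteq> 0"
  shows "\<exists>K\<ge>0. \<forall>c. \<forall>i<length B. \<bar>c i\<bar> \<le> K * norm (\<Sum>j<length B. c j *\<^sub>R B ! j)"
  using assms
proof (induction B)
  case (Cons w B)
  let ?d = "infdist w (span (set B))"
  have d: "?d > 0" using Cons.prems infdist_nonneg[of w "span (set B)"] by (auto simp: less_le)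
  obtain K where K: "K \<ge> 0" "\<And>c i. i < length B \<Longrightarrow> \<bar>c i\<bar> \<le> K * norm (\<Sum>j<length B. c j *\<^sub>R B ! j)"
    using Cons by auto
  let ?K = "1 / ?d + K * (1 + norm w / ?d)"
  have pos: "1 / ?d \<ge> 0" "K * (1 + norm w / ?d) \<ge> 0" using d K(1) by auto
  have "\<bar>c i\<bar> \<le> ?K * norm (\<Sum>j<length (w # B). c j *\<^sub>R (w # B) ! j)" if i: "i < length (w # B)" for c i
  proof -
    let ?y = "\<Sum>j<length B. c (Suc j) *\<^sub>R B ! j" and ?z = "\<Sum>j<length (w # B). c j *\<^sub>R (w # B) ! j"
    have z: "?z = c 0 *\<^sub>R w + ?y" by (simp add: sum.lessThan_Suc_shift del: sum.lessThan_Suc)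
    have "?y \<in> span (set B)" by (intro span_sum span_scale span_base) auto
    then have c0: "\<bar>c 0\<bar> \<le> 1 / ?d * norm ?z"
      using infdist_scale_le_norm[of ?y "set B" "c 0" w] d unfolding z by (simp add: field_simps)
    show ?thesis
    proof (cases i)
      case 0
      then show ?thesis using c0 mult_right_mono[OF pos(2) norm_ge_zero, of ?z] by (simp only: distrib_right)
    next
      case (Suc i')
      have "norm ?y \<le> norm ?z + \<bar>c 0\<bar> * norm w"
        using norm_triangle_ineq4[of ?z "c 0 *\<^sub>R w"] unfolding z by simp
      also have "\<dots> \<le> norm ?z + 1 / ?d * norm ?z * norm w"
        using c0 by (intro add_left_mono mult_right_mono) auto
      finally have "norm ?y \<le> (1 + norm w / ?d) * norm ?z" by (simp add: algebra_simps)
      then have "K * norm ?y \<le> K * ((1 + norm w / ?d) * norm ?z)" using K(1) by (rule mult_left_mono)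
      moreover have "\<bar>c i\<bar> \<le> K * norm ?y" using K(2)[of i' "\<lambda>j. c (Suc j)"] i Suc by simp
      ultimately show ?thesis
        using mult_right_mono[OF pos(1) norm_ge_zero, of ?z] by (simp only: distrib_right mult.assoc)
    qed
  qed
  then show ?case using pos by (intro exI[of _ ?K]) auto
qed auto

text \<open>The Leibniz formula is a polynomial in the inner products. The recursive form
  \<open>gvol\<close> does not show this continuity, as distances to spans can jump when the span
  degenerates.\<close>

lemma gram_det_tendsto:
  assumes "\<And>m. length (Xs m) = length X" "\<And>i. i < length X \<Longrightarrow> (\<lambda>m. Xs m ! i) \<longlonglongrightarrow> X ! i"
  shows "(\<lambda>m. gram_det (Xs m)) \<longlonglongrightarrow> gram_det X"
  unfolding gram_det_def assms(1)
proof (intro tendsto_sum tendsto_mult tendsto_const tendsto_prod)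
  fix p i assume "p \<in> {p. p permutes {..<length X}}" "i \<in> {..<length X}"
  then have "i < length X" "p i < length X" by (auto dest: permutes_in_image)
  then show "(\<lambda>m. Xs m ! i \<bullet> Xs m ! p i) \<longlonglongrightarrow> X ! i \<bullet> X ! p i"
    by (intro tendsto_inner assms(2))
qed

lemma bounded_lists_subsequence:
  fixes Bs :: "nat \<Rightarrow> 'a::euclidean_space list"
  assumes "\<And>m i. i < k \<Longrightarrow> norm (Bs m ! i) \<le> R"
  shows "\<exists>r l. strict_mono (r :: nat \<Rightarrow> nat) \<and> (\<forall>i<k. (\<lambda>m. Bs (r m) ! i) \<longlonglongrightarrow> l i)"
  using assms
proof (induction k)
  case 0
  show ?case by (intro exI[of _ id]) (auto simp: strict_mono_def)
next
  case (Suc k)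
  then obtain r l where r: "strict_mono (r :: nat \<Rightarrow> nat)" "\<And>i. i < k \<Longrightarrow> (\<lambda>m. Bs (r m) ! i) \<longlonglongrightarrow> l i"
    by auto
  obtain l' r' where r': "strict_mono (r' :: nat \<Rightarrow> nat)" "((\<lambda>m. Bs (r m) ! k) \<circ> r') \<longlonglongrightarrow> l'"
    using compact_cball[of "0 :: 'a" R, unfolded compact_def, THEN spec[of _ "\<lambda>m. Bs (r m) ! k"]] Suc.prems
    by auto
  have "(\<lambda>m. Bs ((r \<circ> r') m) ! i) \<longlonglongrightarrow> (l(k := l')) i" if "i < Suc k" for i
  proof (cases "i = k")
    case True
    then show ?thesis using r'(2) by (simp add: o_def)
  next
    case False
    then have "((\<lambda>m. Bs (r m) ! i) \<circ> r') \<longlonglongrightarrow> l i"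
      using r(2) r'(1) that by (intro LIMSEQ_subseq_LIMSEQ) auto
    then show ?thesis using False by (simp add: o_def)
  qed
  then show ?case using strict_mono_o[OF r(1) r'(1)] by blast
qed

text \<open>Reduced bases along a maximizing sequence lie in a fixed ball, so a subsequence
  converges entrywise. The limit is admissible because the permitted squared volumes form closed
  sets, and upper semicontinuity shows that it attains the supremum.\<close>

theorem maximizer_exists:
  fixes L0 :: "'a::euclidean_space set"
  assumes L0: "candidate D L0" and s: "s > DIM('a) / 2" "q \<ge> 0"
  shows "\<exists>M :: 'a set. candidate D M \<and> (\<forall>L :: 'a set. candidate D L \<longrightarrow> zeta' L s q \<le> zeta' M s q)"
proof -
  let ?n = "DIM('a)"
  have s0: "s > 0" using s(1) by (meson divide_nonneg_pos le_less_trans of_nat_0_le_iff zero_less_numeral)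
  \<comment> \<open>Extended reals, because finiteness of the supremum is not known in
    advance.\<close>
  define A where "A = {ereal (zeta' L s q) | L :: 'a set. candidate D L}"
  have "ereal (zeta' L0 s q) \<in> A" unfolding A_def using L0 by blast
  then have "A \<noteq> {}" by blast
  then obtain f :: "nat \<Rightarrow> ereal" where f: "incseq f" "range f \<subseteq> A" "Sup A = (SUP i. f i)"
    using Sup_countable_SUP[of A] by auto
  have flim: "f \<longlonglongrightarrow> Sup A" using LIMSEQ_SUP[OF f(1)] f(3) by simp
  define R where "R = D * 4 ^ (?n * Suc ?n) * 2 ^ ?n"
  have "\<exists>B :: 'a list. f m = ereal (zeta' (int_span B) s q) \<and> dets_ge_1 (int_span B) \<and> length B = ?n
      \<and> gvol B \<noteq> 0 \<and> gvol B \<le> D \<and> (\<forall>b\<in>set B. norm b \<le> R)" for m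
  proof -
    have "f m \<in> A" using f(2) by blast
    then obtain L :: "'a set" where L: "f m = ereal (zeta' L s q)" "candidate D L"
      unfolding A_def by blast
    then obtain B where B: "L = int_span B" "gvol B \<noteq> 0" "length B = ?n" "gvol B \<le> D"
      unfolding candidate_def by auto
    obtain B' where B': "set B' \<subseteq> L" "L \<subseteq> int_span B'" "gvol B' \<noteq> 0" "\<forall>b\<in>set B'. norm b \<le> R"
      using reduced_basis_exists[OF candidate_addgroup[OF L(2)] candidate_discrete[OF L(2)] candidate_dets[OF L(2)], of B D]
        B set_subset_int_span[of B] int_span_subset_span[of B] unfolding R_def by auto
    show ?thesis
      using candidate_basis[OF L(2) B'(1-3)] L B' candidate_dets[OF L(2)]
      by (intro exI[of _ B'] conjI) simp_all
  qed
  then obtain Bs :: "nat \<Rightarrow> 'a list" where Bs: "\<And>m. f m = ereal (zeta' (int_span (Bs m)) s q)" "\<And>m. dets_ge_1 (int_span (Bs m))"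
      "\<And>m. length (Bs m) = ?n" "\<And>m. gvol (Bs m) \<noteq> 0" "\<And>m. gvol (Bs m) \<le> D" "\<And>m b. b \<in> set (Bs m) \<Longrightarrow> norm b \<le> R"
    by metis
  obtain r l where r: "strict_mono (r :: nat \<Rightarrow> nat)" "\<And>i. i < ?n \<Longrightarrow> (\<lambda>m. Bs (r m) ! i) \<longlonglongrightarrow> l i"
  proof -
    have "norm (Bs m ! i) \<le> R" if "i < ?n" for m i
      using that by (intro Bs(6)[of _ m] nth_mem) (simp add: Bs(3))
    from bounded_lists_subsequence[of ?n Bs R, OF this] show ?thesis using that by blast
  qed
  define C where "C = (\<lambda>m. Bs (r m))"
  define B where "B = map l [0..<?n]"
  have len: "length B = ?n" "\<And>m. length (C m) = ?n" using Bs(3) by (auto simp: B_def C_def)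
  have lim: "(\<lambda>m. C m ! i) \<longlonglongrightarrow> B ! i" if "i < ?n" for i
    using r(2)[OF that] that by (simp add: B_def C_def)
  have gC: "(\<lambda>m. gvol (C m)) \<longlonglongrightarrow> gvol B"
    using gram_det_tendsto[of C B] len lim by (simp add: gram_det_eq_gvol)
  have "gvol (C m) \<in> {1..D}" for m
    using Bs(4,5) dets_ge_1D[OF Bs(2) set_subset_int_span] by (auto simp: C_def)
  from closed_sequentially[OF closed_atLeastAtMost this gC] have gB: "gvol B \<in> {1..D}" .
  have dets: "dets_ge_1 (int_span B)"
    unfolding dets_ge_1_def
  proof (intro allI impI)
    fix X assume X: "set X \<subseteq> int_span B"
    then have "\<forall>j<length X. \<exists>c :: nat \<Rightarrow> int. X ! j = (\<Sum>i<?n. of_int (c i) *\<^sub>R B ! i)"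
      using nth_mem[of _ X] by (fastforce simp: int_span_def len)
    then obtain c :: "nat \<Rightarrow> nat \<Rightarrow> int" where c: "\<And>j. j < length X \<Longrightarrow> X ! j = (\<Sum>i<?n. of_int (c j i) *\<^sub>R B ! i)"
      by metis
    \<comment> \<open>The same integral combinations, formed from the approximating bases. Their
      volumes lie in {0} or [1, \<infinity>), a closed set, and converge to that of
      \<open>X\<close>.\<close>
    define Xs where "Xs = (\<lambda>m. map (\<lambda>j. \<Sum>i<?n. of_int (c j i) *\<^sub>R C m ! i) [0..<length X])"
    have gX: "(\<lambda>m. gvol (Xs m)) \<longlonglongrightarrow> gvol X"
      unfolding gram_det_eq_gvol[symmetric]
    proof (rule gram_det_tendsto)
      fix j assume j: "j < length X"
      show "(\<lambda>m. Xs m ! j) \<longlonglongrightarrow> X ! j"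
        using j unfolding c[OF j] by (simp add: Xs_def) (intro tendsto_sum tendsto_scaleR tendsto_const lim, simp)
    qed (simp add: Xs_def)
    have "gvol (Xs m) \<in> {0} \<union> {1..}" for m
    proof -
      have "set (Xs m) \<subseteq> int_span (C m)"
        unfolding Xs_def int_span_def using len by auto
      then show ?thesis using Bs(2) unfolding C_def dets_ge_1_def by auto
    qed
    from closed_sequentially[OF closed_Un[OF closed_singleton closed_atLeast] this gX]
    show "gvol X = 0 \<or> 1 \<le> gvol X" by auto
  qed
  have M: "candidate D (int_span B)"
    using dets gB len(1) unfolding candidate_def by (intro conjI exI[of _ B]) auto
  have nz: "gvol B \<noteq> 0" using gB by auto
  obtain K where K: "K \<ge> 0" "\<And>c i. i < ?n \<Longrightarrow> \<bar>c i\<bar> \<le> K * norm (\<Sum>j<?n. c j *\<^sub>R B ! j)"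
    using coordinates_bounded[OF nz] len(1) by auto
  \<comment> \<open>Bounds the relative displacement of lattice vectors by the linear map taking
    \<open>B\<close> to \<open>C m\<close>, as coordinates are at most \<open>K\<close> times the
    norm.\<close>
  define e where "e = (\<lambda>m. K * (\<Sum>i<?n. norm (C m ! i - B ! i)))"
  have "e \<longlonglongrightarrow> K * (\<Sum>i<?n. norm (B ! i - B ! i))"
    unfolding e_def by (intro tendsto_mult tendsto_const tendsto_sum tendsto_norm tendsto_diff lim) auto
  then have e: "e \<longlonglongrightarrow> 0" by simp
  have e0: "e m \<ge> 0" for m unfolding e_def using K(1) by (intro mult_nonneg_nonneg sum_nonneg) auto
  have bound: "zeta' (int_span (C m)) s q \<le> ((1 - e m)\<^sup>2) powr (- s) * zeta' (int_span B) s q" if em: "e m < 1" for m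
  proof -
    have "distinct B" "independent (set B)" using nz by (auto simp: gvol_nonzero_iff)
    define g where "g = (\<lambda>x. C m ! (THE i. i < ?n \<and> B ! i = x))"
    obtain T where T: "linear T" "\<And>x. x \<in> set B \<Longrightarrow> T x = g x"
      using linear_independent_extend[OF \<open>independent (set B)\<close>, of g] by auto
    have TB: "T (B ! i) = C m ! i" if i: "i < ?n" for i
    proof -
      have "(THE j. j < ?n \<and> B ! j = B ! i) = i"
        using \<open>distinct B\<close> i len(1) by (intro the_equality) (auto simp: nth_eq_iff_index_eq)
      then show ?thesis using T(2)[of "B ! i"] i len(1) by (simp add: g_def)
    qed
    then have map: "map T B = C m" using len by (intro nth_equalityI) auto
    have "zeta' (T ` int_span B) s q \<le> ((1 - e m)\<^sup>2) powr (- s) * zeta' (int_span B) s q"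
    proof (rule zeta_expansion_le[OF T(1) addgroup_int_span em _ e0 s0 s(2) zeta_summable_candidate[OF M s]])
      fix y assume "y \<in> int_span B"
      then obtain c :: "nat \<Rightarrow> int" where c: "y = (\<Sum>i<?n. of_int (c i) *\<^sub>R B ! i)"
        by (auto simp: int_span_def len)
      have "T y - y = (\<Sum>i<?n. of_int (c i) *\<^sub>R (C m ! i - B ! i))"
        unfolding c linear_sum[OF T(1)] sum_subtractf[symmetric]
        by (intro sum.cong) (auto simp: linear_cmul[OF T(1)] TB scaleR_diff_right)
      also have "norm \<dots> \<le> (\<Sum>i<?n. \<bar>of_int (c i)\<bar> * norm (C m ! i - B ! i))"
        by (rule order_trans[OF norm_sum]) simp
      also have "\<dots> \<le> (\<Sum>i<?n. (K * norm y) * norm (C m ! i - B ! i))"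
        using K(2)[of _ "\<lambda>i. of_int (c i)"] by (intro sum_mono mult_right_mono) (auto simp: c)
      also have "\<dots> = e m * norm y" by (simp add: e_def sum_distrib_left mult_ac)
      finally have "norm (T y - y) \<le> e m * norm y" .
      moreover have "norm y - norm (T y - y) \<le> norm (T y)"
        using norm_triangle_ineq4[of "T y" "T y - y"] by simp
      ultimately show "(1 - e m) * norm y \<le> norm (T y)" by (simp add: algebra_simps)
    qed
    then show ?thesis by (simp add: int_span_map[OF T(1), symmetric] map)
  qed
  have "(\<lambda>m. ((1 - e m)\<^sup>2) powr (- s) * zeta' (int_span B) s q) \<longlonglongrightarrow> ((1 - 0)\<^sup>2) powr (- s) * zeta' (int_span B) s q"
    by (intro tendsto_mult tendsto_powr tendsto_power tendsto_diff tendsto_const e) auto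
  then have rhs: "(\<lambda>m. ereal (((1 - e m)\<^sup>2) powr (- s) * zeta' (int_span B) s q)) \<longlonglongrightarrow> ereal (zeta' (int_span B) s q)"
    by simp
  have lhs: "(\<lambda>m. ereal (zeta' (int_span (C m)) s q)) \<longlonglongrightarrow> Sup A"
    using LIMSEQ_subseq_LIMSEQ[OF flim r(1)] Bs(1) by (simp add: o_def C_def)
  have "eventually (\<lambda>m. e m < 1) sequentially" using e by (rule order_tendstoD) simp
  then have "Sup A \<le> ereal (zeta' (int_span B) s q)"
    using bound by (intro tendsto_le[OF _ rhs lhs]) (auto elim!: eventually_mono)
  have "zeta' L s q \<le> zeta' (int_span B) s q" if "candidate D L" for L :: "'a set"
  proof -
    have "ereal (zeta' L s q) \<in> A" unfolding A_def using that by blast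
    then have "ereal (zeta' L s q) \<le> Sup A" by (rule Sup_upper)
    also note \<open>Sup A \<le> _\<close>
    finally show ?thesis by simp
  qed
  then show ?thesis using M by blast
qed

section \<open>Second variation under shears\<close>

lemma has_sum_minus:
  fixes f g :: "'i \<Rightarrow> real"
  assumes "(f has_sum a) A" "(g has_sum b) A"
  shows "((\<lambda>i. f i - g i) has_sum (a - b)) A"
  using has_sum_add[OF assms(1) has_sum_cmult_right[OF assms(2), of "- 1"]] by simp

definition powr_taylor3 :: "real \<Rightarrow> real \<Rightarrow> real" where
  "powr_taylor3 s z = 1 - s * z + s * (s + 1) / 2 * z\<^sup>2 - s * (s + 1) * (s + 2) / 6 * z ^ 3"

text \<open>By Taylor's formula the remainder has the sign of the fourth derivative of (1 + t)^(-s),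
  which is positive for t > -1. The odd degree 3 makes the bound valid on both sides of 0.\<close>

lemma powr_cubic_lower_bound:
  fixes z s :: real
  assumes "z > -1" "s > 0"
  shows "powr_taylor3 s z \<le> (1 + z) powr (- s)"
proof (cases "z = 0")
  case False
  define diff where "diff = (\<lambda>m t. (- 1) ^ m * pochhammer s m * (1 + t) powr (- s - real m))"
  have deriv: "DERIV (diff m) t :> diff (Suc m) t" if "t > -1" for m t
  proof -
    have "((\<lambda>t. (1 + t) powr (- s - real m)) has_real_derivative (- s - real m) * (1 + t) powr (- s - real m - 1)) (at t)"
      using DERIV_fun_powr[of "\<lambda>t. 1 + t" 1 t "- s - real m"] that by (auto intro!: derivative_eq_intros)
    from DERIV_cmult[OF this, of "(- 1) ^ m * pochhammer s m"]
    show ?thesis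
      unfolding diff_def by (simp add: pochhammer_Suc algebra_simps)
  qed
  obtain t where t: "if z < 0 then z < t \<and> t < 0 else 0 < t \<and> t < z"
    and eq: "(1 + z) powr (- s) = (\<Sum>m<4. diff m 0 / fact m * (z - 0) ^ m) + diff 4 t / fact 4 * (z - 0) ^ 4"
  proof -
    have "\<exists>t. (if z < 0 then z < t \<and> t < 0 else 0 < t \<and> t < z) \<and>
      (1 + z) powr (- s) = (\<Sum>m<4. diff m 0 / fact m * (z - 0) ^ m) + diff 4 t / fact 4 * (z - 0) ^ 4"
      using assms(1) False deriv
      by (intro Taylor[where a = "min z 0" and b = "max z 0"]) (auto simp: diff_def fun_eq_iff)
    then show ?thesis using that by blast
  qed
  have "diff 4 t \<ge> 0" using assms(2) by (simp add: diff_def pochhammer_nonneg)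
  then have "(\<Sum>m<4. diff m 0 / fact m * (z - 0) ^ m) \<le> (1 + z) powr (- s)"
    unfolding eq by simp
  moreover have "(\<Sum>m<4. diff m 0 / fact m * (z - 0) ^ m)
      = powr_taylor3 s z"
    by (simp add: powr_taylor3_def diff_def eval_nat_numeral pochhammer_rec field_simps)
  ultimately show ?thesis by simp
qed (simp add: powr_taylor3_def)

text \<open>Second variation of \<open>(\<parallel>y\<parallel>\<^sup>2 + q)\<^sup>-\<^sup>s\<close> along \<^term>\<open>\<lambda>\<epsilon>. shear u v \<epsilon> y\<close>.\<close>

definition shear_var :: "real \<Rightarrow> real \<Rightarrow> 'a::euclidean_space \<Rightarrow> 'a \<Rightarrow> 'a \<Rightarrow> real" where
  "shear_var s q u v y = zterm s q y *
     (4 * s * (s + 1) * (u \<bullet> y)\<^sup>2 * (v \<bullet> y)\<^sup>2 / ((norm y)\<^sup>2 + q)\<^sup>2 - 2 * s * (v \<bullet> y)\<^sup>2 / ((norm y)\<^sup>2 + q))"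

lemma norm_shear_sq:
  assumes "norm u = 1"
  shows "(norm (shear u v \<epsilon> y))\<^sup>2 = (norm y)\<^sup>2 + 2 * \<epsilon> * (u \<bullet> y) * (v \<bullet> y) + \<epsilon>\<^sup>2 * (v \<bullet> y)\<^sup>2"
proof -
  have "u \<bullet> u = 1" using assms by (simp add: norm_eq_1)
  then show ?thesis
    unfolding power2_norm_eq_inner shear_def
    by (simp add: inner_simps inner_commute[of y u] power2_eq_square algebra_simps)
qed

text \<open>The shears with parameters \<epsilon> and -\<epsilon> multiply the base of the power by
  1 + 2 \<alpha> + \<beta> and 1 - 2 \<alpha> + \<beta>, where \<alpha> is of order \<epsilon> and
  \<beta> of order \<epsilon>^2. In the sum of the two cubic bounds the odd powers of \<alpha>
  cancel. The error is a multiple of the term itself, so it can be summed over the lattice.\<close>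

lemma shear_second_difference:
  fixes u v y :: "'a::euclidean_space"
  assumes uv: "u \<bullet> v = 0" "norm u = 1" "norm v = 1" and y: "y \<noteq> 0" and s: "s > 0" "q \<ge> 0" and \<epsilon>: "\<bar>\<epsilon>\<bar> \<le> 1"
  shows "\<epsilon>\<^sup>2 * shear_var s q u v y - 5 * s * (s + 1) * (s + 2) * \<epsilon> ^ 4 * zterm s q y
    \<le> zterm s q (shear u v \<epsilon> y) + zterm s q (shear u v (- \<epsilon>) y)
      - 2 * zterm s q y"
proof -
  define X where "X = (norm y)\<^sup>2 + q"
  define a b where "a = u \<bullet> y" and "b = v \<bullet> y"
  define \<alpha> \<beta> where "\<alpha> = \<epsilon> * a * b / X" and "\<beta> = \<epsilon>\<^sup>2 * b\<^sup>2 / X"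
  have X: "X > 0" using y s by (simp add: X_def add_pos_nonneg)
  have tm: "X powr (- s) * powr_taylor3 s (2 * \<sigma> * \<alpha> + \<beta>) \<le> zterm s q (shear u v (\<sigma> * \<epsilon>) y)"
    if \<sigma>: "\<sigma>\<^sup>2 = 1" for \<sigma>
  proof -
    have ne: "shear u v (\<sigma> * \<epsilon>) y \<noteq> 0"
      using linear_injective_0[OF linear_shear] inj_shear[OF uv(1)] y by blast
    have eq: "(norm (shear u v (\<sigma> * \<epsilon>) y))\<^sup>2 + q = X * (1 + (2 * \<sigma> * \<alpha> + \<beta>))"
      unfolding norm_shear_sq[OF uv(2)] using X \<sigma>
      by (simp add: \<alpha>_def \<beta>_def a_def b_def power_mult_distrib field_simps) (simp add: X_def algebra_simps)
    have "X * (1 + (2 * \<sigma> * \<alpha> + \<beta>)) > 0" using ne s unfolding eq[symmetric] by (simp add: add_pos_nonneg)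
    then have z: "2 * \<sigma> * \<alpha> + \<beta> > -1" using X by (simp add: zero_less_mult_iff)
    have "zterm s q (shear u v (\<sigma> * \<epsilon>) y) = X powr (- s) * (1 + (2 * \<sigma> * \<alpha> + \<beta>)) powr (- s)"
      unfolding eq using X z by (subst powr_mult) auto
    then show ?thesis using powr_cubic_lower_bound[OF z s(1)] by (simp add: mult_left_mono)
  qed
  have b2: "b\<^sup>2 \<le> X" "a\<^sup>2 \<le> X"
    using Cauchy_Schwarz_ineq[of v y] Cauchy_Schwarz_ineq[of u y] uv s
    by (auto simp: X_def a_def b_def power2_norm_eq_inner norm_eq_1)
  have e2: "\<epsilon>\<^sup>2 \<le> 1" using \<epsilon> by (simp add: abs_square_le_1)
  have \<beta>: "0 \<le> \<beta>" "\<beta> \<le> \<epsilon>\<^sup>2"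
    using X mult_left_mono[OF b2(1), of "\<epsilon>\<^sup>2"] by (auto simp: \<beta>_def field_simps)
  have \<alpha>: "\<alpha>\<^sup>2 \<le> \<epsilon>\<^sup>2"
  proof -
    have "a\<^sup>2 * b\<^sup>2 \<le> X * X" using b2 X by (intro mult_mono) auto
    then have "\<epsilon>\<^sup>2 * (a\<^sup>2 * b\<^sup>2) \<le> \<epsilon>\<^sup>2 * (X * X)" by (intro mult_left_mono) auto
    then show ?thesis using X by (simp add: \<alpha>_def power_divide power_mult_distrib field_simps power2_eq_square)
  qed
  have e4: "\<epsilon> ^ 4 = \<epsilon>\<^sup>2 * \<epsilon>\<^sup>2" by (simp add: power_add[symmetric])
  have "\<alpha>\<^sup>2 * \<beta> \<le> \<epsilon> ^ 4" unfolding e4 using \<alpha> \<beta> by (intro mult_mono) auto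
  moreover have "\<beta> ^ 3 \<le> \<epsilon> ^ 4"
  proof -
    have "\<beta> * \<beta> * \<beta> \<le> \<epsilon>\<^sup>2 * \<epsilon>\<^sup>2 * 1" using \<beta> e2 by (intro mult_mono) auto
    then show ?thesis by (simp only: e4 power3_eq_cube mult_1_right)
  qed
  moreover have "0 \<le> \<epsilon> ^ 4" by simp
  \<comment> \<open>The estimates give 26; rounding up to 30 makes the constant 5 after division by
    6. The nonnegative \<beta>^2 contribution is dropped afterwards.\<close>
  ultimately have "2 * \<beta> ^ 3 + 24 * (\<alpha>\<^sup>2 * \<beta>) \<le> 30 * \<epsilon> ^ 4" by linarith
  then have "s * (s + 1) * (s + 2) / 6 * (2 * \<beta> ^ 3 + 24 * (\<alpha>\<^sup>2 * \<beta>)) \<le> s * (s + 1) * (s + 2) / 6 * (30 * \<epsilon> ^ 4)"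
    using s by (intro mult_left_mono) auto
  moreover have "0 \<le> s * (s + 1) * \<beta>\<^sup>2" using s by simp
  moreover have "powr_taylor3 s z + powr_taylor3 s z' - 2
      = - s * (z + z') + s * (s + 1) / 2 * (z\<^sup>2 + z'\<^sup>2) - s * (s + 1) * (s + 2) / 6 * (z ^ 3 + z' ^ 3)" for z z'
    unfolding powr_taylor3_def distrib_left by simp
  moreover have "(2 * 1 * \<alpha> + \<beta>) + (2 * (- 1) * \<alpha> + \<beta>) = 2 * \<beta>" by simp
  moreover have "(2 * 1 * \<alpha> + \<beta>)\<^sup>2 + (2 * (- 1) * \<alpha> + \<beta>)\<^sup>2 = 8 * \<alpha>\<^sup>2 + 2 * \<beta>\<^sup>2"
    by (simp add: power2_eq_square algebra_simps)
  moreover have "(2 * 1 * \<alpha> + \<beta>) ^ 3 + (2 * (- 1) * \<alpha> + \<beta>) ^ 3 = 2 * \<beta> ^ 3 + 24 * (\<alpha>\<^sup>2 * \<beta>)"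
    by (simp add: power2_eq_square power3_eq_cube algebra_simps)
  moreover have "s * (s + 1) / 2 * (8 * \<alpha>\<^sup>2 + 2 * \<beta>\<^sup>2) = 4 * s * (s + 1) * \<alpha>\<^sup>2 + s * (s + 1) * \<beta>\<^sup>2"
    unfolding distrib_left by simp
  moreover have "s * (s + 1) * (s + 2) / 6 * (30 * \<epsilon> ^ 4) = 5 * s * (s + 1) * (s + 2) * \<epsilon> ^ 4"
    by simp
  ultimately have "4 * s * (s + 1) * \<alpha>\<^sup>2 - 2 * s * \<beta> - 5 * s * (s + 1) * (s + 2) * \<epsilon> ^ 4
      \<le> powr_taylor3 s (2 * 1 * \<alpha> + \<beta>)
       + powr_taylor3 s (2 * (- 1) * \<alpha> + \<beta>) - 2"
    by (simp only:)
  then have "X powr (- s) * (4 * s * (s + 1) * \<alpha>\<^sup>2 - 2 * s * \<beta> - 5 * s * (s + 1) * (s + 2) * \<epsilon> ^ 4)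
      \<le> X powr (- s) * (powr_taylor3 s (2 * 1 * \<alpha> + \<beta>)
       + powr_taylor3 s (2 * (- 1) * \<alpha> + \<beta>) - 2)"
    by (intro mult_left_mono) auto
  also have "\<dots> \<le> zterm s q (shear u v \<epsilon> y) + zterm s q (shear u v (- \<epsilon>) y) - 2 * X powr (- s)"
    using add_mono[OF tm[of 1] tm[of "- 1"]] unfolding right_diff_distrib[of "X powr (- s)" _ 2] distrib_left[of "X powr (- s)"] by simp
  also have "X powr (- s) * (4 * s * (s + 1) * \<alpha>\<^sup>2 - 2 * s * \<beta> - 5 * s * (s + 1) * (s + 2) * \<epsilon> ^ 4)
      = \<epsilon>\<^sup>2 * shear_var s q u v y - 5 * s * (s + 1) * (s + 2) * \<epsilon> ^ 4 * X powr (- s)"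
    unfolding shear_var_def X_def[symmetric] \<alpha>_def \<beta>_def a_def[symmetric] b_def[symmetric] using X
    by (simp add: power_mult_distrib power_divide field_simps)
  finally show ?thesis by (simp add: X_def)
qed

lemma shear_var_bound:
  fixes u v y :: "'a::euclidean_space"
  assumes uv: "norm u = 1" "norm v = 1" and y: "y \<noteq> 0" and s: "s > 0" "q \<ge> 0"
  shows "\<bar>shear_var s q u v y\<bar> \<le> (4 * s * (s + 1) + 2 * s) * zterm s q y"
proof -
  define X where "X = (norm y)\<^sup>2 + q"
  have X: "X > 0" using y s by (simp add: X_def add_pos_nonneg)
  have b2: "(v \<bullet> y)\<^sup>2 \<le> X" "(u \<bullet> y)\<^sup>2 \<le> X"
    using Cauchy_Schwarz_ineq[of v y] Cauchy_Schwarz_ineq[of u y] uv s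
    by (auto simp: X_def power2_norm_eq_inner norm_eq_1)
  have "(u \<bullet> y)\<^sup>2 * (v \<bullet> y)\<^sup>2 \<le> X * X" using b2 X by (intro mult_mono) auto
  then have 1: "4 * s * (s + 1) * ((u \<bullet> y)\<^sup>2 * (v \<bullet> y)\<^sup>2 / X\<^sup>2) \<le> 4 * s * (s + 1) * 1"
    using X s by (intro mult_left_mono) (auto simp: power2_eq_square)
  have 2: "2 * s * ((v \<bullet> y)\<^sup>2 / X) \<le> 2 * s * 1" using b2 X s by (intro mult_left_mono) auto
  have 3: "0 \<le> 4 * s * (s + 1) * ((u \<bullet> y)\<^sup>2 * (v \<bullet> y)\<^sup>2 / X\<^sup>2)" "0 \<le> 2 * s * ((v \<bullet> y)\<^sup>2 / X)"
    using s X by auto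
  have "\<bar>4 * s * (s + 1) * ((u \<bullet> y)\<^sup>2 * (v \<bullet> y)\<^sup>2 / X\<^sup>2) - 2 * s * ((v \<bullet> y)\<^sup>2 / X)\<bar> \<le> 4 * s * (s + 1) + 2 * s"
    using 1 2 3 by linarith
  then have "X powr (- s) * \<bar>4 * s * (s + 1) * ((u \<bullet> y)\<^sup>2 * (v \<bullet> y)\<^sup>2 / X\<^sup>2) - 2 * s * ((v \<bullet> y)\<^sup>2 / X)\<bar>
      \<le> X powr (- s) * (4 * s * (s + 1) + 2 * s)"
    by (intro mult_left_mono) auto
  then show ?thesis
    unfolding shear_var_def X_def[symmetric] by (simp add: abs_mult mult_ac)
qed

lemma shear_var_summable:
  fixes u v :: "'a::euclidean_space"
  assumes uv: "norm u = 1" "norm v = 1" and s: "s > 0" "q \<ge> 0"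
    and sum: "(\<lambda>y. zterm s q y) summable_on (L - {0})"
  shows "shear_var s q u v summable_on (L - {0})"
proof (rule Infinite_Sum.abs_summable_summable[OF Infinite_Sum.abs_summable_on_comparison_test'])
  show "(\<lambda>y. (4 * s * (s + 1) + 2 * s) * zterm s q y) summable_on (L - {0})"
    by (rule summable_on_cmult_right[OF sum])
qed (use shear_var_bound[OF uv _ s] in auto)

text \<open>The image may violate the determinant condition, as happens for shears across summands;
  it still has a basis of full length, and that decides convergence.\<close>

lemma candidate_linear_summable:
  fixes L :: "'a::euclidean_space set"
  assumes L: "candidate D L" and T: "linear T" "inj (T :: 'a \<Rightarrow> 'a)" and s: "s > DIM('a) / 2" "q \<ge> 0"
  shows "(\<lambda>y. zterm s q (T y)) summable_on (L - {0})"
proof -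
  obtain B where B: "L = int_span B" "gvol B \<noteq> 0" "length B = DIM('a)"
    using L unfolding candidate_def by auto
  have "independent (T ` set B)"
    using B(2) T(2) by (intro linear_independent_injective_image[OF T(1)]) (auto simp: gvol_nonzero_iff intro: inj_on_subset)
  then have "gvol (map T B) \<noteq> 0"
    using B(2) T(2) unfolding gvol_nonzero_iff by (auto simp: distinct_map intro: inj_on_subset)
  then have "(\<lambda>y. zterm s q y) summable_on (int_span (map T B) - {0})"
    using B(3) s by (intro zeta_summable_int_span) auto
  then show ?thesis
    using zeta_image(2)[OF T(1) inj_on_subset[OF T(2)], of L q s] addgroupD(1)[OF candidate_addgroup[OF L]]
    by (simp add: int_span_map[OF T(1)] B(1))
qed

text \<open>Neither of the two opposite shears raises the zeta value. Summing the second differences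
  therefore bounds the total variation by a constant times \<epsilon>^2, and \<epsilon> tends to 0;
  this replaces differentiation under the sum.\<close>

lemma shear_var_nonpos:
  fixes L :: "'a::euclidean_space set"
  assumes L: "candidate D L" and s: "s > DIM('a) / 2" "q \<ge> 0"
    and uv: "u \<bullet> v = 0" "norm u = 1" "norm v = 1"
    and \<epsilon>0: "\<epsilon>0 > 0" "\<And>\<epsilon>. \<bar>\<epsilon>\<bar> \<le> \<epsilon>0 \<Longrightarrow> zeta' (shear u v \<epsilon> ` L) s q \<le> zeta' L s q"
  shows "(\<Sum>\<^sub>\<infinity>y\<in>L - {0}. shear_var s q u v y) \<le> 0"
proof -
  have s0: "s > 0" using s(1) by (meson divide_nonneg_pos le_less_trans of_nat_0_le_iff zero_less_numeral)
  define C where "C = 5 * s * (s + 1) * (s + 2)"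
  let ?Q = "\<Sum>\<^sub>\<infinity>y\<in>L - {0}. shear_var s q u v y" and ?Z = "zeta' L s q"
  note zero = addgroupD(1)[OF candidate_addgroup[OF L]]
  have hZ: "((\<lambda>y. zterm s q y) has_sum ?Z) (L - {0})"
    unfolding zeta'_def by (intro has_sum_infsum zeta_summable_candidate[OF L s])
  have hQ: "(shear_var s q u v has_sum ?Q) (L - {0})"
    by (intro has_sum_infsum shear_var_summable[OF uv(2,3) s0 s(2)] zeta_summable_candidate[OF L s])
  have hS: "((\<lambda>y. zterm s q (shear u v \<epsilon> y)) has_sum zeta' (shear u v \<epsilon> ` L) s q) (L - {0})" for \<epsilon>
    unfolding zeta_image(1)[OF linear_shear inj_on_subset[OF inj_shear[OF uv(1)] subset_UNIV] zero]
    by (intro has_sum_infsum candidate_linear_summable[OF L linear_shear inj_shear[OF uv(1)] s])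
  have key: "?Q \<le> C * \<epsilon>\<^sup>2 * ?Z" if \<epsilon>: "0 < \<epsilon>" "\<epsilon> \<le> 1" "\<epsilon> \<le> \<epsilon>0" for \<epsilon>
  proof -
    have "\<epsilon>\<^sup>2 * ?Q - C * \<epsilon> ^ 4 * ?Z \<le> zeta' (shear u v \<epsilon> ` L) s q + zeta' (shear u v (- \<epsilon>) ` L) s q - 2 * ?Z"
    proof (rule has_sum_mono)
      show "((\<lambda>y. \<epsilon>\<^sup>2 * shear_var s q u v y - C * \<epsilon> ^ 4 * zterm s q y) has_sum (\<epsilon>\<^sup>2 * ?Q - C * \<epsilon> ^ 4 * ?Z)) (L - {0})"
        by (intro has_sum_minus has_sum_cmult_right hQ hZ)
      show "((\<lambda>y. zterm s q (shear u v \<epsilon> y) + zterm s q (shear u v (- \<epsilon>) y)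
          - 2 * zterm s q y) has_sum (zeta' (shear u v \<epsilon> ` L) s q + zeta' (shear u v (- \<epsilon>) ` L) s q - 2 * ?Z)) (L - {0})"
        by (intro has_sum_minus has_sum_add has_sum_cmult_right hS hZ)
    qed (use shear_second_difference[OF uv _ s0 s(2)] \<epsilon> in \<open>auto simp: C_def\<close>)
    also have "\<dots> \<le> 0" using \<epsilon>0(2)[of \<epsilon>] \<epsilon>0(2)[of "- \<epsilon>"] \<epsilon> by simp
    finally have "\<epsilon>\<^sup>2 * ?Q \<le> \<epsilon>\<^sup>2 * (C * \<epsilon>\<^sup>2 * ?Z)"
      by (simp add: power_add[symmetric] mult_ac)
    then show ?thesis using \<epsilon>(1) by (simp add: mult_le_cancel_left)
  qed
  show ?thesis
  proof (rule tendsto_le[OF _ _ tendsto_const])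
    show "((\<lambda>\<epsilon>. C * \<epsilon>\<^sup>2 * ?Z) \<longlongrightarrow> 0) (at_right 0)"
      by (rule tendsto_eq_intros refl | simp)+
    have "eventually (\<lambda>\<epsilon>. \<epsilon> \<in> {0<..<min 1 \<epsilon>0}) (at_right (0::real))"
      using \<epsilon>0(1) by (intro eventually_at_right_real) auto
    then show "eventually (\<lambda>\<epsilon>. ?Q \<le> C * \<epsilon>\<^sup>2 * ?Z) (at_right 0)"
      by (rule eventually_mono) (intro key, auto)
  qed simp
qed

section \<open>Structure of a maximizer\<close>

definition orth_compl :: "'a::euclidean_space set \<Rightarrow> 'a set" where
  "orth_compl V = {y. \<forall>x\<in>V. y \<bullet> x = 0}"

lemma subspace_orth_compl: "subspace (orth_compl V)"
  unfolding subspace_def orth_compl_def by (auto simp: inner_simps)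

lemma perp_in_orth_compl: "subspace V \<Longrightarrow> perp V y \<in> orth_compl V"
  by (simp add: orth_compl_def perp_orthogonal)

lemma perp_orth_compl:
  assumes "subspace V"
  shows "perp (orth_compl V) y = y - perp V y"
proof (rule perp_unique[OF subspace_orth_compl])
  show "y - (y - perp V y) \<in> orth_compl V" using perp_in_orth_compl[OF assms] by simp
  show "(y - perp V y) \<bullet> x = 0" if "x \<in> orth_compl V" for x
    using that perp_diff_in[OF assms, of y] by (auto simp: orth_compl_def inner_commute)
qed

text \<open>\<open>l\<close> is a section of the projection along \<open>V\<close>: an element of
  \<open>K\<close> is the representative of its fibre plus an element of
  \<open>K \<inter> V\<close>. The normalization \<open>l 0 = 0\<close> lets the zero vector
  correspond to the pair (0, 0).\<close>

lemma has_sum_fibration: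
  fixes K V :: "'a::euclidean_space set" and f :: "'a \<Rightarrow> real"
  assumes V: "subspace V" and K: "addgroup K"
    and l: "\<And>b. b \<in> perp V ` K \<Longrightarrow> l b \<in> K" "\<And>b. b \<in> perp V ` K \<Longrightarrow> perp V (l b) = b" "l 0 = 0"
  shows "((\<lambda>(b, a). f (a + l b)) has_sum c) (perp V ` K \<times> (K \<inter> V) - {(0, 0)}) \<longleftrightarrow> (f has_sum c) (K - {0})"
proof (rule has_sum_reindex_bij_witness[where j = "\<lambda>(b, a). a + l b" and i = "\<lambda>y. (perp V y, y - l (perp V y))"])
  note lin = linear_perp[OF V]
  fix z assume "z \<in> perp V ` K \<times> (K \<inter> V) - {(0, 0)}"
  then obtain b a where z: "z = (b, a)" "b \<in> perp V ` K" "a \<in> K" "a \<in> V" "b \<noteq> 0 \<or> a \<noteq> 0" by auto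
  have p: "perp V (a + l b) = b"
    using z l by (simp add: linear_add[OF lin] perp_eq_0[OF V])
  show "(\<lambda>y. (perp V y, y - l (perp V y))) (case z of (b, a) \<Rightarrow> a + l b) = z" using p z by simp
  have "a + l b \<noteq> 0"
  proof
    assume 0: "a + l b = 0"
    then have "b = 0" using p linear_0[OF lin] by simp
    then show False using 0 z(5) l(3) by simp
  qed
  then show "(case z of (b, a) \<Rightarrow> a + l b) \<in> K - {0}"
    using z l(1)[OF z(2)] addgroupD(2)[OF K] by simp
  show "f (case z of (b, a) \<Rightarrow> a + l b) = (case z of (b, a) \<Rightarrow> f (a + l b))"
    using z by simp
next
  fix y assume y: "y \<in> K - {0}"
  then have b: "perp V y \<in> perp V ` K" by auto
  show "(case (perp V y, y - l (perp V y)) of (b, a) \<Rightarrow> a + l b) = y" by simp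
  have "y - l (perp V y) \<in> K" using y l(1)[OF b] addgroupD(4)[OF K] by blast
  moreover have "y - l (perp V y) \<in> V"
    using perp_diff_in[OF V, of "y - l (perp V y)"] l(2)[OF b] by (simp add: linear_diff[OF linear_perp[OF V]])
  moreover have "perp V y \<noteq> 0 \<or> y - l (perp V y) \<noteq> 0" using y l(3) by auto
  ultimately show "(perp V y, y - l (perp V y)) \<in> perp V ` K \<times> (K \<inter> V) - {(0, 0)}" using b by auto
qed simp

locale maximizer =
  fixes D s q :: real and M :: "'a::euclidean_space set"
  assumes M: "candidate D M" and max: "\<And>L :: 'a set. candidate D L \<Longrightarrow> zeta' L s q \<le> zeta' M s q"
    and s: "s > DIM('a) / 2" and q: "q \<ge> 0" "q \<le> (2 * s - real DIM('a)) / (real DIM('a) + 2)"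
begin

lemma s_pos: "s > 0"
  using s by (meson divide_nonneg_pos le_less_trans of_nat_0_le_iff zero_less_numeral)

lemmas add = candidate_addgroup[OF M]
lemmas disc = candidate_discrete[OF M]
lemmas dets = candidate_dets[OF M]

lemma gauss_summable_candidate: "candidate D L \<Longrightarrow> gauss_summable (L :: 'a set)"
  unfolding candidate_def using gauss_summable_int_span by blast

text \<open>\<open>M\<close> and its split sum have the same base \<open>H\<close> and the same
  fibre lattice \<open>G\<close>, and differ only by the shifts \<open>x\<close> of the fibres. A
  projection outside \<open>M\<close> means a shift outside \<open>G\<close>, and then the split sum
  has the strictly larger zeta value.\<close>

lemma split_of_unit_det:
  assumes X0: "set X0 \<subseteq> M" "gvol X0 = 1"
  defines "V \<equiv> span (set X0)"
  shows "perp V ` M \<subseteq> M"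
proof (rule ccontr)
  assume not: "\<not> ?thesis"
  have V: "subspace V" by (simp add: V_def)
  note lin = linear_perp[OF V]
  let ?L = "split_sum V M"
  have L: "candidate D ?L" unfolding V_def by (rule candidate_split_sum[OF M X0])
  define G H where "G = M \<inter> V" and "H = perp V ` M"
  have pp: "perp V (perp V y) = perp V y" for y
    by (rule perp_eq_self[OF V perp_orthogonal[OF V]])
  have "\<forall>b\<in>H. \<exists>y. y \<in> M \<and> perp V y = b" by (auto simp: H_def)
  then obtain l0 where l0: "\<And>b. b \<in> H \<Longrightarrow> l0 b \<in> M" "\<And>b. b \<in> H \<Longrightarrow> perp V (l0 b) = b" by metis
  \<comment> \<open>The representative over 0 is reset to 0, so that the fibre \<open>G\<close>
    itself remains unshifted and the zero vector is matched with itself.\<close>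
  define l where "l = l0(0 := 0)"
  have l0_0: "l 0 = 0" by (simp add: l_def)
  have l: "l b \<in> M" "perp V (l b) = b" if "b \<in> H" for b
    using l0[OF that] addgroupD(1)[OF add] linear_0[OF lin] by (auto simp: l_def)
  define x where "x = (\<lambda>b. l b - b)"
  have xV: "x b \<in> V" if "b \<in> H" for b
    using perp_diff_in[OF V, of "l b"] l(2)[OF that] by (simp add: x_def)
  have H0: "0 \<in> H" using addgroupD(1)[OF add] linear_0[OF lin] unfolding H_def by force
  have HL: "H \<subseteq> ?L"
  proof (rule subsetI)
    fix b assume "b \<in> H"
    then obtain y where "y \<in> M" "b = perp V y" by (auto simp: H_def)
    then show "b \<in> ?L"
      unfolding split_sum_def using addgroupD(1)[OF add] subspace_0[OF V]
      by (intro CollectI exI[of _ 0] exI[of _ y]) simp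
  qed
  have Hp: "perp V b = b" if "b \<in> H" for b using that pp by (auto simp: H_def)
  have Horth: "b \<bullet> v = 0" if "b \<in> H" "v \<in> V" for b v
    using that perp_orthogonal[OF V] by (auto simp: H_def)
  have GM: "G \<subseteq> M" by (auto simp: G_def)
  have "int_span X0 \<subseteq> G"
    using X0(1) by (intro int_span_minimal) (auto simp: G_def V_def intro: addgroup_Int[OF add] addgroup_subspace span_base)
  then have cover: "\<exists>y\<in>G. norm (z - y) \<le> (\<Sum>b\<leftarrow>X0. norm b)" if "z \<in> V" for z
    using int_span_round[of z X0] that unfolding V_def by blast
  let ?I = "H \<times> G - {(0, 0)}"
  have LV: "?L \<inter> V = G"
  proof (rule subset_antisym; rule subsetI)
    fix y assume y: "y \<in> ?L \<inter> V"
    then obtain c w where w: "y = c + perp V w" "c \<in> M" "c \<in> V" by (auto simp: split_sum_def)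
    have "perp V y = perp V w" using w by (simp add: linear_add[OF lin] perp_eq_0[OF V] pp)
    then show "y \<in> G" using w y perp_eq_0[OF V] by (simp add: G_def)
  next
    fix y assume "y \<in> G"
    then show "y \<in> ?L \<inter> V"
      using addgroupD(1)[OF add] linear_0[OF lin] unfolding G_def split_sum_def
      by (intro IntI CollectI exI[of _ y] exI[of _ 0]) simp_all
  qed
  have LP: "perp V ` ?L = H"
  proof (rule subset_antisym; rule subsetI)
    fix b assume "b \<in> perp V ` ?L"
    then show "b \<in> H" by (auto simp: split_sum_def H_def linear_add[OF lin] perp_eq_0[OF V] pp)
  next
    fix b assume "b \<in> H"
    then show "b \<in> perp V ` ?L" using HL Hp[of b] by force
  qed
  have hM: "((\<lambda>(b, a). zterm s q (a + x b + b)) has_sum zeta' M s q) ?I"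
    using has_sum_fibration[OF V add, of l "\<lambda>y. zterm s q y"] l l0_0
      has_sum_infsum[OF zeta_summable_candidate[OF M s q(1)]]
    by (simp add: x_def zeta'_def G_def H_def)
  have hL: "((\<lambda>(b, a). zterm s q (a + b)) has_sum zeta' ?L s q) ?I"
    using has_sum_fibration[OF V candidate_addgroup[OF L], of "\<lambda>b. b" "\<lambda>y. zterm s q y"]
      has_sum_infsum[OF zeta_summable_candidate[OF L s q(1)]] HL Hp
    unfolding LV LP by (auto simp: zeta'_def)
  obtain y0 where y0: "y0 \<in> M" "perp V y0 \<notin> M" using not by auto
  have b0: "perp V y0 \<in> H" using y0 by (auto simp: H_def)
  have "x (perp V y0) \<notin> G"
  proof
    assume "x (perp V y0) \<in> G"
    then have "l (perp V y0) - x (perp V y0) \<in> M"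
      using l(1)[OF b0] GM addgroupD(4)[OF add] by blast
    then show False using y0(2) by (simp add: x_def)
  qed
  then have "(\<Sum>\<^sub>\<infinity>(b, a)\<in>?I. zterm s q (a + x b + b)) < (\<Sum>\<^sub>\<infinity>(b, a)\<in>?I. zterm s q (a + b))"
    using has_sum_imp_summable[OF hM] has_sum_imp_summable[OF hL] b0
  proof (intro zeta_shift_less[where V = V and R = "\<Sum>b\<leftarrow>X0. norm b"])
    show "addgroup G" unfolding G_def by (intro addgroup_Int add addgroup_subspace V)
    show "gauss_summable G" by (rule gauss_summable_subset[OF gauss_summable_candidate[OF M] GM])
    show "discrete_set G" by (rule discrete_set_subset[OF disc GM])
    show "gauss_summable H" by (rule gauss_summable_subset[OF gauss_summable_candidate[OF L] HL])
    show "discrete_set H" by (rule discrete_set_subset[OF candidate_discrete[OF L] HL])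
    show "x 0 = 0" by (simp add: x_def l_def)
    show "G \<subseteq> V" by (auto simp: G_def)
  qed (use H0 V cover Horth xV s_pos q(1) in auto)
  then have "zeta' M s q < zeta' ?L s q" using infsumI[OF hM] infsumI[OF hL] by simp
  then show False using max[OF L] by simp
qed

text \<open>The roles of base and fibre are exchanged compared with
  \<open>split_of_unit_det\<close>: the base is \<open>M \<inter> V\<close>, the fibres lie in the
  complement, and the fibre over \<open>c\<close> moves by
  \<open>(\<epsilon> * (v \<bullet> c)) *\<^sub>R u\<close>. The coset inequality covers every
  \<epsilon>, even when the sheared lattice has left the class.\<close>

lemma zeta_shear_across_le:
  assumes V: "subspace V" and split: "perp V ` M \<subseteq> M" and v: "v \<in> V" and u: "u \<in> orth_compl V"
  shows "zeta' (shear u v \<epsilon> ` M) s q \<le> zeta' M s q"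
proof -
  define W where "W = orth_compl V"
  have W: "subspace W" by (simp add: W_def subspace_orth_compl)
  define G H where "G = M \<inter> W" and "H = M \<inter> V"
  let ?x = "\<lambda>c. (\<epsilon> * (v \<bullet> c)) *\<^sub>R u" and ?I = "H \<times> G - {(0, 0)}"
  have uv: "u \<bullet> v = 0" using u v by (auto simp: orth_compl_def)
  have inj: "inj (shear u v \<epsilon>)" by (rule inj_shear[OF uv])
  have pM: "perp V y \<in> M" "y - perp V y \<in> M" if "y \<in> M" for y
    using split that addgroupD(4)[OF add] by auto
  have HG: "H \<subseteq> M" "G \<subseteq> M" by (auto simp: G_def H_def)
  obtain B where B: "M = int_span B" "gvol B \<noteq> 0" "length B = DIM('a)"
    using M unfolding candidate_def by auto
  have spB: "span (set B) = UNIV"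
    using candidate_span[OF M] span_mono[OF int_span_subset_span[of B]] unfolding B(1) by (auto simp: span_span)
  have cover: "\<exists>y\<in>G. norm (z - y) \<le> (\<Sum>b\<leftarrow>B. norm b)" if z: "z \<in> W" for z
  proof -
    obtain y where y: "y \<in> M" "norm (z - y) \<le> (\<Sum>b\<leftarrow>B. norm b)"
      using int_span_round[of z B] spB B(1) by auto
    have "perp V z = z" using z by (intro perp_eq_self[OF V]) (auto simp: W_def orth_compl_def)
    \<comment> \<open>Projecting the approximating lattice point to the complement does not increase
      its distance to \<open>z\<close>, and by \<open>split\<close> the result is again in
      \<open>M\<close>.\<close>
    then have "norm (z - perp V y) \<le> norm (z - y)"
      using norm_perp_le[OF V, of "z - y"] by (simp add: linear_diff[OF linear_perp[OF V]])
    then show ?thesis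
      using y pM(1)[OF y(1)] perp_in_orth_compl[OF V, of y] by (intro bexI[of _ "perp V y"]) (auto simp: G_def W_def)
  qed
  have pW: "perp W y = y - perp V y" for y unfolding W_def by (rule perp_orth_compl[OF V])
  have PW: "perp W b = b" if "b \<in> V" for b unfolding pW using that by (simp add: perp_eq_0[OF V])
  have HP: "perp W ` M = H"
  proof (rule subset_antisym; rule subsetI)
    fix b assume "b \<in> perp W ` M"
    then show "b \<in> H" using pM perp_diff_in[OF V] unfolding pW by (auto simp: H_def)
  next
    fix b assume "b \<in> H"
    then show "b \<in> perp W ` M" using PW[of b] by (force simp: H_def)
  qed
  have rep: "((\<lambda>(b, a). zterm s q (f (a + b))) has_sum c) ?I
      \<longleftrightarrow> ((\<lambda>y. zterm s q (f y)) has_sum c) (M - {0})" for c and f :: "'a \<Rightarrow> 'a"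
    using has_sum_fibration[OF W add, of "\<lambda>b. b" "\<lambda>y. zterm s q (f y)"] PW
    unfolding HP G_def[symmetric] by (auto simp: H_def)
  have "((\<lambda>(b, a). zterm s q (shear u v \<epsilon> (a + b))) has_sum zeta' (shear u v \<epsilon> ` M) s q) ?I"
    unfolding rep zeta_image(1)[OF linear_shear inj_on_subset[OF inj subset_UNIV] addgroupD(1)[OF add]]
    by (intro has_sum_infsum candidate_linear_summable[OF M linear_shear inj s q(1)])
  also have "?this \<longleftrightarrow> ((\<lambda>(b, a). zterm s q (a + ?x b + b)) has_sum zeta' (shear u v \<epsilon> ` M) s q) ?I"
  proof (rule has_sum_cong)
    fix z assume "z \<in> ?I"
    then obtain b a where z: "z = (b, a)" "a \<in> W" by (auto simp: G_def)
    have "v \<bullet> a = 0" using z v by (auto simp: W_def orth_compl_def inner_commute)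
    then have "shear u v \<epsilon> (a + b) = a + ?x b + b" by (simp add: shear_def inner_add_right)
    then show "(case z of (b, a) \<Rightarrow> zterm s q (shear u v \<epsilon> (a + b)))
        = (case z of (b, a) \<Rightarrow> zterm s q (a + ?x b + b))" using z by simp
  qed
  finally have h1: "((\<lambda>(b, a). zterm s q (a + ?x b + b)) has_sum zeta' (shear u v \<epsilon> ` M) s q) ?I" .
  have h2: "((\<lambda>(b, a). zterm s q (a + b)) has_sum zeta' M s q) ?I"
    using rep[of id "zeta' M s q"] zeta_summable_candidate[OF M s q(1)] by (simp add: zeta'_def)
  have "(\<Sum>\<^sub>\<infinity>(b, a)\<in>?I. zterm s q (a + ?x b + b)) \<le> (\<Sum>\<^sub>\<infinity>(b, a)\<in>?I. zterm s q (a + b))"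
    using has_sum_imp_summable[OF h1] has_sum_imp_summable[OF h2]
  proof (intro zeta_shift_le[where V = W and R = "\<Sum>b\<leftarrow>B. norm b"])
    show "addgroup G" unfolding G_def by (intro addgroup_Int add addgroup_subspace W)
    show "gauss_summable G" "gauss_summable H"
      using gauss_summable_subset[OF gauss_summable_candidate[OF M]] HG by auto
    show "discrete_set G" "discrete_set H" using discrete_set_subset[OF disc] HG by auto
    show "0 \<in> H" using addgroupD(1)[OF add] subspace_0[OF V] by (simp add: H_def)
    show "b \<bullet> w = 0" if "b \<in> H" "w \<in> W" for b w
      using that by (auto simp: H_def W_def orth_compl_def inner_commute)
    show "?x b \<in> W" for b using u by (auto simp: W_def intro: subspace_scale subspace_orth_compl)
    show "G \<subseteq> W" by (auto simp: G_def)
  qed (use W cover s_pos q(1) in auto)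
  then show ?thesis using infsumI[OF h1] infsumI[OF h2] by simp
qed

lemma norm_ge_1:
  assumes "y \<in> M" "y \<noteq> 0"
  shows "norm y \<ge> 1"
proof -
  have "gvol [y] = (norm y)\<^sup>2"
    using infdist_eq_norm_perp[of "span {}" y] perp_eq_self[of "span {}" y] by simp
  then have "1\<^sup>2 \<le> (norm y)\<^sup>2" using dets_ge_1D[OF dets, of "[y]"] assms by simp
  then show ?thesis by (rule power2_le_imp_le) simp
qed

end

lemma has_sum_sum_finite:
  fixes f :: "'i \<Rightarrow> 'j \<Rightarrow> real"
  assumes "finite S" "\<And>i. i \<in> S \<Longrightarrow> (f i has_sum a i) A"
  shows "((\<lambda>j. \<Sum>i\<in>S. f i j) has_sum (\<Sum>i\<in>S. a i)) A"
  using assms by (induction S rule: finite_induct) (auto intro!: has_sum_add)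

lemma orthonormal_parseval:
  fixes S :: "'a::euclidean_space set"
  assumes S: "pairwise real_inner_class.orthogonal S" "\<And>i. i \<in> S \<Longrightarrow> norm i = 1" "span S = UNIV" "finite S"
  shows "(\<Sum>u\<in>S. (u \<bullet> y)\<^sup>2) = (norm y)\<^sup>2"
proof -
  have y: "(\<Sum>i\<in>S. (y \<bullet> i) *\<^sub>R i) = y" using S by (intro orthonormal_basis_expand) auto
  have "(norm y)\<^sup>2 = y \<bullet> (\<Sum>i\<in>S. (y \<bullet> i) *\<^sub>R i)" unfolding y by (simp add: power2_norm_eq_inner)
  then show ?thesis by (simp add: inner_sum_right inner_commute power2_eq_square)
qed

text \<open>Summing the second variation over a full orthonormal frame \<open>u\<close> and over the plane of
  \<open>e1, e2\<close>, where the diagonal terms missing from the frame are supplied by the rotated pair \<open>f1, f2\<close>.\<close>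

lemma shear_var_total:
  fixes S :: "'a::euclidean_space set" and y e1 e2 :: 'a
  assumes S: "pairwise real_inner_class.orthogonal S" "\<And>i. i \<in> S \<Longrightarrow> norm i = 1" "span S = UNIV" "finite S"
      "card S = DIM('a)"
    and e: "e1 \<in> S" "e2 \<in> S" "e1 \<noteq> e2" and X: "(norm y)\<^sup>2 + q > 0"
  defines "f1 \<equiv> (1 / sqrt 2) *\<^sub>R (e1 + e2)" and "f2 \<equiv> (1 / sqrt 2) *\<^sub>R (e1 - e2)"
    and "p \<equiv> (e1 \<bullet> y)\<^sup>2 + (e2 \<bullet> y)\<^sup>2"
  shows "(\<Sum>u\<in>S - {e1, e2}. shear_var s q u e1 y + shear_var s q u e2 y)
     + 2 * (shear_var s q e1 e2 y + shear_var s q e2 e1 y + shear_var s q f1 f2 y + shear_var s q f2 f1 y)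
    = zterm s q y * (2 * s * p / ((norm y)\<^sup>2 + q)\<^sup>2)
      * (2 * (s + 1) * (norm y)\<^sup>2 - (real DIM('a) + 2) * ((norm y)\<^sup>2 + q))"
proof -
  define r where "r = (norm y)\<^sup>2"
  define X where "X = r + q"
  define K where "K = X powr (- s)"
  define c d where "c = 4 * s * (s + 1) / X\<^sup>2" and "d = 2 * s / X"
  define a b where "a = (e1 \<bullet> y)\<^sup>2" and "b = (e2 \<bullet> y)\<^sup>2"
  have Xpos: "X > 0" using X by (simp add: X_def r_def)
  have sv: "shear_var s q u v y = K * (c * (u \<bullet> y)\<^sup>2 * (v \<bullet> y)\<^sup>2 - d * (v \<bullet> y)\<^sup>2)" for u v
    unfolding shear_var_def r_def[symmetric] X_def[symmetric] K_def c_def d_def by simp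
  have pab: "p = a + b" by (simp add: p_def a_def b_def)
  have sub: "{e1, e2} \<subseteq> S" using e by auto
  have "(\<Sum>u\<in>S. (u \<bullet> y)\<^sup>2) = r" unfolding r_def by (rule orthonormal_parseval[OF S(1-4)])
  moreover have "(\<Sum>u\<in>S. (u \<bullet> y)\<^sup>2) = (\<Sum>u\<in>S - {e1, e2}. (u \<bullet> y)\<^sup>2) + (\<Sum>u\<in>{e1, e2}. (u \<bullet> y)\<^sup>2)"
    by (rule sum.subset_diff[OF sub S(4)])
  ultimately have rest: "(\<Sum>u\<in>S - {e1, e2}. (u \<bullet> y)\<^sup>2) = r - p" using e(3) by (simp add: p_def)
  have "card S \<ge> 2" using card_mono[OF S(4) sub] e(3) by simp
  then have cardS: "real (card (S - {e1, e2})) = real DIM('a) - 2"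
    using card_Diff_subset[of "{e1, e2}" S] sub e(3) S(5) by (simp add: of_nat_diff)
  have 1: "(\<Sum>u\<in>S - {e1, e2}. shear_var s q u e1 y + shear_var s q u e2 y)
      = K * (c * (r - p) * p - d * (real DIM('a) - 2) * p)"
  proof -
    have "(\<Sum>u\<in>S - {e1, e2}. shear_var s q u e1 y + shear_var s q u e2 y)
        = (\<Sum>u\<in>S - {e1, e2}. K * c * p * (u \<bullet> y)\<^sup>2 - K * d * p)"
      unfolding sv pab a_def b_def by (intro sum.cong) (auto simp: algebra_simps)
    also have "\<dots> = K * c * p * (r - p) - real (card (S - {e1, e2})) * (K * d * p)"
      by (simp only: sum_subtractf sum_distrib_left[symmetric] rest sum_constant) (simp add: mult_ac)
    finally show ?thesis unfolding cardS by (simp add: algebra_simps)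
  qed
  define F1 F2 where "F1 = (f1 \<bullet> y)\<^sup>2" and "F2 = (f2 \<bullet> y)\<^sup>2"
  have F: "F1 = (e1 \<bullet> y + e2 \<bullet> y)\<^sup>2 / 2" "F2 = (e1 \<bullet> y - e2 \<bullet> y)\<^sup>2 / 2"
    by (simp_all add: F1_def F2_def f1_def f2_def inner_simps power_divide add_divide_distrib[symmetric] diff_divide_distrib[symmetric])
  have Fsum: "F1 + F2 = p" unfolding F p_def by (simp add: power2_eq_square field_simps)
  have Fprod: "4 * (F1 * F2) = (a - b)\<^sup>2"
    unfolding F a_def b_def by (simp add: power2_eq_square field_simps)
  have 2: "2 * (shear_var s q e1 e2 y + shear_var s q e2 e1 y + shear_var s q f1 f2 y + shear_var s q f2 f1 y)
      = K * (c * (4 * a * b + 4 * (F1 * F2)) - d * (2 * (a + b) + 2 * (F1 + F2)))"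
    unfolding sv a_def[symmetric] b_def[symmetric] F1_def[symmetric] F2_def[symmetric] by (simp add: algebra_simps)
  \<comment> \<open>The pair e1, e2 gives 4 a b and the rotated pair gives (a - b)^2; together they
    form the square (a + b)^2 that the terms with u = v would have completed.\<close>
  have 3: "4 * a * b + 4 * (F1 * F2) = p * p"
    unfolding Fprod pab by (simp add: power2_eq_square algebra_simps)
  have "c * r * p - d * (real DIM('a) + 2) * p = 2 * s * p / X\<^sup>2 * (2 * (s + 1) * r - (real DIM('a) + 2) * X)"
    unfolding c_def d_def using Xpos by (simp add: field_simps power2_eq_square)
  \<comment> \<open>Here n + 2 arises: n - 2 from the frame vectors outside the plane, 4 from the
    two weighted pairs inside it.\<close>
  moreover have "K * (c * (r - p) * p - d * (real DIM('a) - 2) * p) + K * (c * (p * p) - d * (2 * p + 2 * p))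
      = K * (c * r * p - d * (real DIM('a) + 2) * p)"
    by (simp add: algebra_simps)
  ultimately have "K * (c * (r - p) * p - d * (real DIM('a) - 2) * p) + K * (c * (p * p) - d * (2 * p + 2 * p))
      = K * (2 * s * p / X\<^sup>2 * (2 * (s + 1) * r - (real DIM('a) + 2) * X))"
    by simp
  then show ?thesis
    unfolding 1 2 3 Fsum pab[symmetric] unfolding K_def X_def r_def by (simp add: mult.assoc)
qed

section \<open>Irreducible summands and orthonormal bases of a maximizer\<close>

primrec orthonormal :: "'a::euclidean_space list \<Rightarrow> bool" where
  "orthonormal [] \<longleftrightarrow> True"
| "orthonormal (w # A) \<longleftrightarrow> orthonormal A \<and> norm w = 1 \<and> (\<forall>x\<in>set A. w \<bullet> x = 0)"

lemma orthonormal_gvol: "orthonormal A \<Longrightarrow> gvol A = 1"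
proof (induction A)
  case (Cons w A)
  have "w \<bullet> x = 0" if "x \<in> span (set A)" for x
    using that by (induction rule: span_induct_alt) (use Cons.prems in \<open>auto simp: inner_simps\<close>)
  then have "infdist w (span (set A)) = 1"
    using Cons.prems by (simp add: infdist_eq_norm_perp perp_eq_self)
  then show ?case using Cons by simp
qed simp

lemma orthonormal_inner:
  assumes "orthonormal A" "i < length A" "j < length A"
  shows "A ! i \<bullet> A ! j = (if i = j then 1 else 0)"
  using assms
proof (induction A arbitrary: i j)
  case (Cons w A)
  then show ?case
    by (cases i; cases j) (auto simp: norm_eq_1 inner_commute)
qed simp

context maximizer
begin

text \<open>\<open>J\<close> expresses irreducibility: a unit-volume list in the summand is empty or
  of full rank. A frame adapted to \<open>V\<close> and its complement is used, so that each frame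
  vector \<open>u\<close> falls under exactly one of the facts \<open>inside\<close> and
  \<open>across\<close>.\<close>

lemma no_irreducible_summand:
  assumes X: "set X \<subseteq> M" "gvol X = 1"
  defines "V \<equiv> span (set X)"
  assumes J: "\<And>Z. set Z \<subseteq> M \<inter> V \<Longrightarrow> gvol Z = 1 \<Longrightarrow> Z = [] \<or> length Z = dim V" and dim: "dim V \<ge> 2"
  shows False
proof -
  have V: "subspace V" by (simp add: V_def)
  have split: "perp V ` M \<subseteq> M" unfolding V_def by (rule split_of_unit_det[OF X])
  define W where "W = orth_compl V"
  have W: "subspace W" by (simp add: W_def subspace_orth_compl)
  obtain BV where BV: "BV \<subseteq> V" "pairwise real_inner_class.orthogonal BV" "\<And>x. x \<in> BV \<Longrightarrow> norm x = 1"
      "independent BV" "card BV = dim V" "span BV = V"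
    by (rule orthonormal_basis_subspace[OF V]) (rule that, auto)
  obtain BW where BW: "BW \<subseteq> W" "pairwise real_inner_class.orthogonal BW" "\<And>x. x \<in> BW \<Longrightarrow> norm x = 1"
      "independent BW" "card BW = dim W" "span BW = W"
    by (rule orthonormal_basis_subspace[OF W]) (rule that, auto)
  define S where "S = BV \<union> BW"
  have fin: "finite BV" "finite BW" "finite S"
    using BV(4) BW(4) by (auto simp: S_def independent_imp_finite)
  have orthVW: "v \<bullet> w = 0" "w \<bullet> v = 0" if "v \<in> V" "w \<in> W" for v w
    using that by (auto simp: W_def orth_compl_def inner_commute)
  have S: "pairwise real_inner_class.orthogonal S" "\<And>i. i \<in> S \<Longrightarrow> norm i = 1"
    using BV BW orthVW unfolding S_def pairwise_def real_inner_class.orthogonal_def by blast+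
  have spanS: "span S = UNIV"
  proof -
    have "y \<in> span S" for y
    proof -
      have "y - perp V y \<in> span BV" "perp V y \<in> span BW"
        using perp_diff_in[OF V] perp_in_orth_compl[OF V] BV(6) BW(6) by (auto simp: W_def)
      then have "y - perp V y \<in> span S" "perp V y \<in> span S"
        using span_mono[of BV S] span_mono[of BW S] by (auto simp: S_def)
      then have "(y - perp V y) + perp V y \<in> span S" by (rule span_add)
      then show ?thesis by simp
    qed
    then show ?thesis by auto
  qed
  have "0 \<notin> S" using S(2) by force
  then have "independent S" using S(1) by (intro pairwise_orthogonal_independent)
  then have "card S = dim (span S)" by (simp add: dim_eq_card_independent)
  then have cardS: "card S = DIM('a)" unfolding spanS by simp
  have "card BV \<noteq> 0" using BV(5) dim by linarith
  then have "BV \<noteq> {}" by auto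
  then obtain e1 where e1: "e1 \<in> BV" by blast
  have "card (BV - {e1}) \<ge> 1" using BV(5) dim e1 fin by simp
  then have "BV - {e1} \<noteq> {}" by force
  then obtain e2 where e2: "e2 \<in> BV" "e1 \<noteq> e2" by blast
  have e: "e1 \<in> S" "e2 \<in> S" "e1 \<in> V" "e2 \<in> V" using e1 e2 BV(1) by (auto simp: S_def)
  have ee: "e1 \<bullet> e2 = 0" "e1 \<bullet> e1 = 1" "e2 \<bullet> e2 = 1"
    using S e e2(2) by (auto simp: pairwise_def real_inner_class.orthogonal_def norm_eq_1)
  define f1 f2 where "f1 = (1 / sqrt 2) *\<^sub>R (e1 + e2)" and "f2 = (1 / sqrt 2) *\<^sub>R (e1 - e2)"
  have f: "f1 \<in> V" "f2 \<in> V" using e V by (auto simp: f1_def f2_def subspace_scale subspace_add subspace_diff)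
  have "f1 \<bullet> f1 = 1" "f2 \<bullet> f2 = 1"
    using ee by (simp_all add: f1_def f2_def inner_simps inner_commute[of e2 e1])
  then have nf: "norm f1 = 1" "norm f2 = 1" by (simp_all add: norm_eq_1)
  have "f1 \<bullet> f2 = 0"
    using ee by (simp add: f1_def f2_def inner_simps inner_commute[of e2 e1])
  then have ff: "f1 \<bullet> f2 = 0" "f2 \<bullet> f1 = 0" "norm f1 = 1" "norm f2 = 1"
    using nf by (simp_all add: inner_commute[of f2 f1])
  let ?P = "\<lambda>u v. \<Sum>\<^sub>\<infinity>y\<in>M - {0}. shear_var s q u v y"
  have hs: "(shear_var s q u v has_sum ?P u v) (M - {0})" if "norm u = 1" "norm v = 1" for u v
    by (intro has_sum_infsum shear_var_summable[OF that s_pos q(1)] zeta_summable_candidate[OF M s q(1)])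
  have inside: "?P u v \<le> 0" if uv: "u \<in> V" "v \<in> V" "u \<bullet> v = 0" "norm u = 1" "norm v = 1" for u v
  proof -
    obtain \<epsilon>0 where "\<epsilon>0 > 0" "\<And>\<epsilon>. \<bar>\<epsilon>\<bar> \<le> \<epsilon>0 \<Longrightarrow> candidate D (shear u v \<epsilon> ` M)"
      using candidate_shear[OF M V split J uv] by blast
    then show ?thesis using max by (intro shear_var_nonpos[OF M s q(1) uv(3-5)]) auto
  qed
  have across: "?P u v \<le> 0" if uv: "u \<in> W" "v \<in> V" "norm u = 1" "norm v = 1" for u v
  proof (rule shear_var_nonpos[OF M s q(1) orthVW(2)[OF uv(2,1)] uv(3,4), of 1])
    show "zeta' (shear u v \<epsilon> ` M) s q \<le> zeta' M s q" for \<epsilon>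
      using zeta_shear_across_le[OF V split uv(2)] uv(1) unfolding W_def by blast
  qed simp
  let ?T = "\<lambda>y. (\<Sum>u\<in>S - {e1, e2}. shear_var s q u e1 y + shear_var s q u e2 y)
     + 2 * (shear_var s q e1 e2 y + shear_var s q e2 e1 y + shear_var s q f1 f2 y + shear_var s q f2 f1 y)"
  let ?tot = "(\<Sum>u\<in>S - {e1, e2}. ?P u e1 + ?P u e2) + 2 * (?P e1 e2 + ?P e2 e1 + ?P f1 f2 + ?P f2 f1)"
  have hT: "(?T has_sum ?tot) (M - {0})"
    using S(2) e ff fin
    by (intro has_sum_add has_sum_cmult_right has_sum_sum_finite hs) auto
  have "?P u e1 + ?P u e2 \<le> 0" if u: "u \<in> S - {e1, e2}" for u
  proof -
    have u0: "u \<bullet> e1 = 0" "u \<bullet> e2 = 0" using u e S(1) by (auto simp: pairwise_def real_inner_class.orthogonal_def)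
    have n: "norm u = 1" "norm e1 = 1" "norm e2 = 1" using S(2) u e by auto
    show ?thesis
    proof (cases "u \<in> BV")
      case True
      then have "u \<in> V" using BV(1) by auto
      then show ?thesis using inside[of u e1] inside[of u e2] u0 n e by simp
    next
      case False
      then have "u \<in> W" using u BW(1) by (auto simp: S_def)
      then show ?thesis using across[of u e1] across[of u e2] n e by simp
    qed
  qed
  then have "(\<Sum>u\<in>S - {e1, e2}. ?P u e1 + ?P u e2) \<le> 0" by (intro sum_nonpos)
  moreover have "?P e1 e2 \<le> 0" "?P e2 e1 \<le> 0" "?P f1 f2 \<le> 0" "?P f2 f1 \<le> 0"
    using S(2) e ee f ff by (auto intro!: inside simp: inner_commute[of e2 e1])
  ultimately have tot: "?tot \<le> 0" by (intro add_nonpos_nonpos mult_nonneg_nonpos) simp_all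
  define p where "p = (\<lambda>y. (e1 \<bullet> y)\<^sup>2 + (e2 \<bullet> y)\<^sup>2)"
  have T: "?T y = zterm s q y * (2 * s * p y / ((norm y)\<^sup>2 + q)\<^sup>2)
      * (2 * (s + 1) * (norm y)\<^sup>2 - (real DIM('a) + 2) * ((norm y)\<^sup>2 + q))" if "y \<in> M - {0}" for y
  proof -
    have "(norm y)\<^sup>2 > 0" using that by simp
    then have "(norm y)\<^sup>2 + q > 0" using q(1) by linarith
    from shear_var_total[OF S spanS fin(3) cardS e(1,2) e2(2) this]
    show ?thesis unfolding f1_def f2_def p_def .
  qed
  have qn: "(real DIM('a) + 2) * q \<le> 2 * s - real DIM('a)"
    using q(2) by (simp add: field_simps)
  have s2: "2 * s - real DIM('a) > 0" using s by simp
  \<comment> \<open>The left-hand side equals (2 s - n) r - (n + 2) q. The bound on \<open>q\<close>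
    is used here, and r - 1 is nonnegative for squared norms of nonzero lattice vectors.\<close>
  have fac: "2 * (s + 1) * r - (real DIM('a) + 2) * (r + q) \<ge> (2 * s - real DIM('a)) * (r - 1)" for r
    using qn by (simp add: algebra_simps)
  have Tnonneg: "?T y \<ge> 0" if y: "y \<in> M - {0}" for y
  proof -
    have "1\<^sup>2 \<le> (norm y)\<^sup>2" using norm_ge_1 y by (intro power_mono) auto
    then have "0 \<le> (2 * s - real DIM('a)) * ((norm y)\<^sup>2 - 1)" using s2 by simp
    also note fac
    finally show ?thesis
      unfolding T[OF y] p_def using s_pos by (intro mult_nonneg_nonneg divide_nonneg_nonneg) auto
  qed
  have "\<exists>x\<in>set X. e1 \<bullet> x \<noteq> 0"
  proof (rule ccontr)
    assume *: "\<not> ?thesis"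
    have "e1 \<bullet> x = 0" if "x \<in> span (set X)" for x
      using that by (induction rule: span_induct_alt) (use * in \<open>auto simp: inner_simps\<close>)
    then show False using e(3) ee(2) by (simp add: V_def)
  qed
  then obtain x where x: "x \<in> set X" "e1 \<bullet> x \<noteq> 0" by blast
  \<comment> \<open>Doubling yields norm at least 2, so the factor is strictly positive even for
    \<open>q\<close> at its upper limit and \<open>x\<close> of norm 1.\<close>
  define y where "y = 2 *\<^sub>R x"
  have "x \<noteq> 0" using x(2) by auto
  have xM: "x \<in> M" using x X(1) by auto
  have "y \<noteq> 0" using \<open>x \<noteq> 0\<close> by (simp add: y_def)
  then have y: "y \<in> M - {0}" using addgroupD(2)[OF add xM xM] by (simp add: y_def scaleR_2)
  have "2 * 1 \<le> norm y" using norm_ge_1[OF xM \<open>x \<noteq> 0\<close>] by (simp add: y_def)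
  then have "2\<^sup>2 \<le> (norm y)\<^sup>2" by (intro power_mono) auto
  then have "0 < (2 * s - real DIM('a)) * ((norm y)\<^sup>2 - 1)" using s2 by (intro mult_pos_pos) auto
  also note fac
  finally have fac_pos: "0 < 2 * (s + 1) * (norm y)\<^sup>2 - (real DIM('a) + 2) * ((norm y)\<^sup>2 + q)" .
  have "0 < (e1 \<bullet> y)\<^sup>2" using x(2) by (simp add: y_def)
  then have "p y > 0" unfolding p_def by (simp add: add_pos_nonneg)
  moreover have "(norm y)\<^sup>2 + q > 0" using \<open>2\<^sup>2 \<le> _\<close> q(1) by simp
  ultimately have "0 < ?T y"
    unfolding T[OF y] using s_pos fac_pos by simp
  then have "0 < ?tot"
    using Tnonneg y by (intro has_sum_strict_mono[OF has_sum_0_simp hT, of y]) auto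
  then show False using tot by simp
qed

text \<open>A slight contraction of \<open>V\<close> would stay in the class while raising every
  term weakly and that of a nonzero vector of \<open>M \<inter> V\<close> strictly.\<close>

lemma no_free_summand:
  assumes V: "subspace V" and split: "perp V ` M \<subseteq> M" and ne: "\<not> M \<inter> V \<subseteq> {0}"
  shows "\<exists>X. set X \<subseteq> M \<inter> V \<and> X \<noteq> [] \<and> gvol X = 1"
proof (rule ccontr)
  assume "\<not> ?thesis"
  then have J: "\<And>X. set X \<subseteq> M \<inter> V \<Longrightarrow> gvol X = 1 \<Longrightarrow> X = []" by blast
  obtain \<epsilon> where \<epsilon>: "0 < \<epsilon>" "\<epsilon> < 1" "candidate D ((\<lambda>y. y - \<epsilon> *\<^sub>R (y - perp V y)) ` M)"
    using candidate_shrink[OF M V split J] by blast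
  let ?T = "\<lambda>y. y - \<epsilon> *\<^sub>R (y - perp V y)"
  have lin: "linear ?T"
    by (rule linearI) (simp_all add: linear_add[OF linear_perp[OF V]] linear_cmul[OF linear_perp[OF V]] algebra_simps)
  have nT: "(norm (?T y))\<^sup>2 = (1 - \<epsilon>)\<^sup>2 * (norm (y - perp V y))\<^sup>2 + (norm (perp V y))\<^sup>2" for y
  proof -
    have "perp V (?T y) = perp V y"
      by (rule perp_diff_subspace[OF V subspace_scale[OF V perp_diff_in[OF V]]])
    moreover from this have "?T y - perp V (?T y) = (1 - \<epsilon>) *\<^sub>R (y - perp V y)" by (simp add: algebra_simps)
    ultimately show ?thesis using norm_sq_perp[OF V, of "?T y"] by (simp add: power_mult_distrib)
  qed
  have e2: "0 < (1 - \<epsilon>)\<^sup>2" "(1 - \<epsilon>)\<^sup>2 < 1" using \<epsilon> by (auto simp: power_less_one_iff abs_square_less_1)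
  have le: "(norm (?T y))\<^sup>2 \<le> (norm y)\<^sup>2" for y
    unfolding nT norm_sq_perp[OF V, of y]
    using mult_right_mono[of "(1 - \<epsilon>)\<^sup>2" 1 "(norm (y - perp V y))\<^sup>2"] e2 by simp
  have ne0: "?T y \<noteq> 0" if "y \<noteq> 0" for y
  proof
    assume "?T y = 0"
    then have "(1 - \<epsilon>)\<^sup>2 * (norm (y - perp V y))\<^sup>2 + (norm (perp V y))\<^sup>2 = 0" using nT[of y] by simp
    then have "perp V y = 0" "y - perp V y = 0" using \<epsilon> by (auto simp: add_nonneg_eq_0_iff)
    then show False using that by simp
  qed
  have inj: "inj ?T" unfolding linear_injective_0[OF lin] using ne0 by blast
  obtain x where x: "x \<in> M - {0}" "x \<in> V" using ne by auto
  have lt: "(norm (?T x))\<^sup>2 < (norm x)\<^sup>2"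
    unfolding nT using x e2 by (simp add: perp_eq_0[OF V])
  have h1: "((\<lambda>y. zterm s q y) has_sum zeta' M s q) (M - {0})"
    unfolding zeta'_def by (intro has_sum_infsum zeta_summable_candidate[OF M s q(1)])
  have h2: "((\<lambda>y. zterm s q (?T y)) has_sum zeta' (?T ` M) s q) (M - {0})"
    unfolding zeta_image(1)[OF lin inj_on_subset[OF inj subset_UNIV] addgroupD(1)[OF add]]
    by (intro has_sum_infsum candidate_linear_summable[OF M lin inj s q(1)])
  have "zeta' M s q < zeta' (?T ` M) s q"
  proof (rule has_sum_strict_mono[OF h1 h2 _ x(1)])
    show "zterm s q y \<le> zterm s q (?T y)" if "y \<in> M - {0}" for y
      using that ne0[of y] le[of y] q(1) s_pos by (intro powr_mono2') (auto simp: add_pos_nonneg)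
    show "zterm s q x < zterm s q (?T x)"
      using x ne0[of x] lt q(1) s_pos by (intro powr_less_mono2_neg) (auto simp: add_pos_nonneg)
  qed
  then show False using max[OF \<epsilon>(3)] by simp
qed

text \<open>Let \<open>A\<close> be a longest orthonormal list in \<open>M\<close>. If
  \<open>M\<close> had a nonzero vector orthogonal to \<open>A\<close>, a shortest nonempty
  unit-volume list in the complement would either be a unit vector extending \<open>A\<close> or
  span an irreducible summand of rank at least 2.\<close>

theorem orthonormal_basis:
  "\<exists>A. orthonormal A \<and> length A = DIM('a) \<and> M = int_span A"
proof -
  let ?Q = "\<lambda>A. orthonormal A \<and> set A \<subseteq> M"
  have len: "length A \<le> DIM('a)" if "orthonormal A" for A :: "'a list"
    using gvol_nonzero_length[of A] orthonormal_gvol[OF that] dim_subset_UNIV[of "span (set A)"] by simp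
  have "?Q []" by simp
  moreover have "\<forall>A. ?Q A \<longrightarrow> length A < Suc DIM('a)" using len by (simp add: le_imp_less_Suc)
  ultimately obtain A where A: "orthonormal A" "set A \<subseteq> M" "\<And>A'. ?Q A' \<Longrightarrow> length A' \<le> length A"
    using ex_has_greatest_nat[of ?Q "[]" length "Suc DIM('a)"] by blast
  note gA = orthonormal_gvol[OF A(1)]
  define VA where "VA = span (set A)"
  have VA: "subspace VA" by (simp add: VA_def)
  have splitA: "perp VA ` M \<subseteq> M" unfolding VA_def by (rule split_of_unit_det[OF A(2) gA])
  define H where "H = orth_compl VA"
  have H: "subspace H" by (simp add: H_def subspace_orth_compl)
  have splitH: "perp H ` M \<subseteq> M"
    using splitA addgroupD(4)[OF add] by (auto simp: H_def perp_orth_compl[OF VA])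
  have "M \<inter> H \<subseteq> {0}"
  proof (rule ccontr)
    assume "\<not> ?thesis"
    let ?P = "\<lambda>X. set X \<subseteq> M \<inter> H \<and> X \<noteq> [] \<and> gvol X = 1"
    obtain X0 where "?P X0" using no_free_summand[OF H splitH \<open>\<not> M \<inter> H \<subseteq> {0}\<close>] by (elim exE)
    \<comment> \<open>Minimal length is what makes the span irreducible: a nonempty unit-volume list
      inside it can be neither shorter nor, being independent, longer.\<close>
    then have "\<exists>X. ?P X \<and> (\<forall>Z. ?P Z \<longrightarrow> length X \<le> length Z)" by (rule ex_has_least_nat)
    then obtain X where XX: "?P X \<and> (\<forall>Z. ?P Z \<longrightarrow> length X \<le> length Z)" ..
    from XX have PX: "?P X" by (rule conjunct1)
    from XX have minP: "\<forall>Z. ?P Z \<longrightarrow> length X \<le> length Z" by (rule conjunct2)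
    have X: "set X \<subseteq> M \<inter> H" "X \<noteq> []" "gvol X = 1" using PX by simp_all
    have min: "length X \<le> length Z" if "set Z \<subseteq> M \<inter> H" "Z \<noteq> []" "gvol Z = 1" for Z
      using minP that by simp
    let ?V = "span (set X)"
    have VH: "?V \<subseteq> H" using X(1) H by (intro span_minimal) auto
    have dimV: "dim ?V = length X" using gvol_nonzero_length[of X] X(3) by simp
    have "length X \<noteq> 1"
    proof
      assume "length X = 1"
      then obtain x where x: "X = [x]" by (auto simp: length_Suc_conv)
      have "gvol [x] = (norm x)\<^sup>2"
        using infdist_eq_norm_perp[of "span {}" x] perp_eq_self[of "span {}" x] by simp
      then have "(norm x)\<^sup>2 = 1\<^sup>2" using X(3) by (simp add: x)
      then have "norm x = 1" by (rule power2_eq_imp_eq) auto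
      moreover have "\<forall>a\<in>set A. x \<bullet> a = 0"
        using X(1) by (auto simp: x H_def orth_compl_def VA_def span_base)
      ultimately have "?Q (x # A)" using A(1,2) X(1) by (simp add: x)
      then show False using A(3)[of "x # A"] by simp
    qed
    then have dim2: "dim ?V \<ge> 2" using X(2) unfolding dimV by (cases X) (auto simp: Suc_le_eq)
    show False
    proof (rule no_irreducible_summand[OF _ X(3) _ dim2])
      show "set X \<subseteq> M" using X(1) by auto
      fix Z assume Z: "set Z \<subseteq> M \<inter> ?V" "gvol Z = 1"
      show "Z = [] \<or> length Z = dim ?V"
      proof (cases "Z = []")
        case False
        have "length X \<le> length Z" using Z VH False by (intro min) auto
        moreover have "length Z \<le> dim ?V"
        proof -
          have "span (set Z) \<subseteq> ?V" using Z(1) by (intro span_minimal) auto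
          then have "dim (span (set Z)) \<le> dim ?V" by (rule dim_subset)
          then show ?thesis using gvol_nonzero_length[of Z] Z(2) by simp
        qed
        ultimately show ?thesis using dimV by simp
      qed simp
    qed
  qed
  then have "perp VA y = 0" if "y \<in> M" for y
    using that splitA perp_in_orth_compl[OF VA, of y] unfolding H_def by blast
  then have MVA: "M \<subseteq> VA" using perp_diff_in[OF VA] by (metis diff_zero subsetI)
  have "VA = UNIV" using span_mono[OF MVA] candidate_span[OF M] span_eq_iff[THEN iffD2, OF VA] by auto
  then have lenA: "length A = DIM('a)"
    using gvol_nonzero_length[of A] gA by (simp add: VA_def)
  have "M \<subseteq> int_span A"
  proof
    fix y assume y: "y \<in> M"
    have coeff: "y \<bullet> A ! i = of_int \<lfloor>y \<bullet> A ! i\<rfloor>" if i: "i < length A" for i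
    proof -
      let ?a = "A ! i"
      have a: "?a \<in> M" "?a \<bullet> ?a = 1" using A(2) i orthonormal_inner[OF A(1) i i] by auto
      then have na: "norm ?a = 1" by (simp add: norm_eq_1)
      \<comment> \<open>Splitting along the line of \<open>?a\<close> puts
        \<open>(y \<bullet> ?a) *\<^sub>R ?a\<close> into \<open>M\<close>; a nonzero fractional
        part would leave a nonzero lattice vector of norm below 1.\<close>
      have "perp (span {?a}) y = y - (y \<bullet> ?a) *\<^sub>R ?a"
      proof (rule perp_unique)
        show "y - (y - (y \<bullet> ?a) *\<^sub>R ?a) \<in> span {?a}" by (simp add: span_base span_scale)
        fix z assume "z \<in> span {?a}"
        then obtain k where "z = k *\<^sub>R ?a" by (auto simp: span_singleton)
        then show "(y - (y \<bullet> ?a) *\<^sub>R ?a) \<bullet> z = 0" using a(2) by (simp add: inner_simps)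
      qed simp
      moreover have "gvol [?a] = 1" by (rule orthonormal_gvol) (simp add: na)
      ultimately have "y - (y \<bullet> ?a) *\<^sub>R ?a \<in> M" using split_of_unit_det[of "[?a]"] a(1) y by auto
      then have "y - (y - (y \<bullet> ?a) *\<^sub>R ?a) \<in> M" by (rule addgroupD(4)[OF add y])
      then have "y - (y - (y \<bullet> ?a) *\<^sub>R ?a) - of_int \<lfloor>y \<bullet> ?a\<rfloor> *\<^sub>R ?a \<in> M"
        by (rule addgroupD(4)[OF add _ addgroup_of_int[OF add a(1)]])
      then have *: "frac (y \<bullet> ?a) *\<^sub>R ?a \<in> M" by (simp add: frac_def scaleR_diff_left)
      have "frac (y \<bullet> ?a) = 0"
      proof (rule ccontr)
        assume "frac (y \<bullet> ?a) \<noteq> 0"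
        then have "frac (y \<bullet> ?a) *\<^sub>R ?a \<noteq> 0" using na by force
        from norm_ge_1[OF * this] show False using frac_lt_1[of "y \<bullet> ?a"] frac_ge_0[of "y \<bullet> ?a"] na by simp
      qed
      then show ?thesis by (simp add: frac_def)
    qed
    obtain c where c: "y = (\<Sum>j<length A. c j *\<^sub>R A ! j)"
      using span_set_list_comb[of y A] MVA y by (auto simp: VA_def)
    have "y \<bullet> A ! i = c i" if i: "i < length A" for i
    proof -
      have "y \<bullet> A ! i = (\<Sum>j<length A. c j * (if j = i then 1 else 0))"
        unfolding c inner_sum_left using orthonormal_inner[OF A(1) _ i] by (intro sum.cong) auto
      also have "\<dots> = (\<Sum>j<length A. if j = i then c j else 0)" by (intro sum.cong) auto
      also have "\<dots> = c i" using i by simp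
      finally show ?thesis .
    qed
    then have "y = (\<Sum>j<length A. of_int \<lfloor>y \<bullet> A ! j\<rfloor> *\<^sub>R A ! j)"
      using coeff by (subst c) (intro sum.cong, auto)
    then show "y \<in> int_span A"
      unfolding int_span_def by (intro CollectI exI[of _ "\<lambda>j. \<lfloor>y \<bullet> A ! j\<rfloor>"] conjI TrueI)
  qed
  then show ?thesis
    using A(1) lenA int_span_minimal[OF add A(2)] by blast
qed

end

section \<open>Identification with the integer lattice and conclusion\<close>

text \<open>The isometry sends the standard basis to \<open>A\<close>; the bijection
  \<open>h\<close> merely numbers the coordinates.\<close>

lemma orthonormal_isomorphic:
  fixes A :: "(real ^ 'n) list"
  assumes A: "orthonormal A" "length A = CARD('n)"
  shows "lattice_isomorphic (int_span A) (integer_lattice :: (real ^ 'n) set)"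
proof -
  obtain h where h: "bij_betw h (UNIV :: 'n set) {..<CARD('n)}"
    using ex_bij_betw_finite_nat[of "UNIV :: 'n set"] by (auto simp: atLeast0LessThan)
  have hlt: "h i < length A" for i using bij_betwE[OF h] A(2) by auto
  have hinj: "h i = h j \<longleftrightarrow> i = j" for i j using bij_betw_imp_inj_on[OF h] by (auto simp: inj_on_def)
  define R where "R = (\<lambda>x :: real ^ 'n. \<Sum>i\<in>UNIV. x $ i *\<^sub>R A ! h i)"
  have lin: "linear R"
    by (rule linearI) (simp_all add: R_def scaleR_add_left sum.distrib scaleR_sum_right)
  have "R x \<bullet> R y = x \<bullet> y" for x y
  proof -
    have "R x \<bullet> R y = (\<Sum>i\<in>UNIV. \<Sum>j\<in>UNIV. x $ i * (y $ j * (A ! h i \<bullet> A ! h j)))"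
      unfolding R_def inner_sum_left by (simp add: inner_sum_right mult.left_commute)
    also have "\<dots> = (\<Sum>i\<in>UNIV. \<Sum>j\<in>UNIV. if i = j then x $ i * y $ j else 0)"
      by (intro sum.cong refl) (simp add: orthonormal_inner[OF A(1) hlt hlt] hinj)
    also have "\<dots> = x \<bullet> y" by (simp add: inner_vec_def)
    finally show ?thesis .
  qed
  then have "orthogonal_transformation R"
    using lin by (simp add: orthogonal_transformation_def)
  moreover have "R ` integer_lattice = int_span A"
  proof (rule subset_antisym; rule subsetI)
    fix z assume "z \<in> R ` integer_lattice"
    then obtain x where x: "z = R x" "\<And>i. x $ i \<in> \<int>" by (auto simp: integer_lattice_def)
    have "x $ i *\<^sub>R A ! h i \<in> int_span A" for i
    proof -
      obtain k where "x $ i = of_int k" using x(2) by (auto elim: Ints_cases)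
      then show ?thesis
        using addgroup_of_int[OF addgroup_int_span, of "A ! h i" A k] set_subset_int_span[of A] nth_mem[OF hlt[of i]]
        by auto
    qed
    moreover have "(\<Sum>i\<in>F. f i) \<in> int_span A" if "finite F" "\<And>i. i \<in> F \<Longrightarrow> f i \<in> int_span A" for f and F :: "'n set"
      using that by (induction F rule: finite_induct) (auto intro: addgroupD[OF addgroup_int_span])
    ultimately show "z \<in> int_span A" unfolding x(1) R_def by simp
  next
    fix z assume "z \<in> int_span A"
    then obtain c :: "nat \<Rightarrow> int" where c: "z = (\<Sum>i<CARD('n). of_int (c i) *\<^sub>R A ! i)"
      by (auto simp: int_span_def A(2))
    have "z = (\<Sum>i\<in>UNIV. of_int (c (h i)) *\<^sub>R A ! h i)"
      unfolding c by (rule sum.reindex_bij_betw[OF h, symmetric])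
    then have "z = R (\<chi> i. of_int (c (h i)))" by (simp add: R_def)
    then show "z \<in> R ` integer_lattice" by (auto simp: integer_lattice_def)
  qed
  ultimately show ?thesis unfolding lattice_isomorphic_def by blast
qed

lemma zeta_isomorphic:
  assumes "lattice_isomorphic L (integer_lattice :: (real ^ 'n) set)"
  shows "zeta' L s q = zeta' (integer_lattice :: (real ^ 'n) set) s q"
proof -
  obtain R :: "real ^ 'n \<Rightarrow> real ^ 'n" where R: "orthogonal_transformation R" "R ` integer_lattice = L"
    using assms unfolding lattice_isomorphic_def by blast
  have "zeta' (R ` integer_lattice) s q = (\<Sum>\<^sub>\<infinity>y\<in>integer_lattice - {0}. zterm s q (R y))"
    using orthogonal_transformation_inj[OF R(1)]
    by (intro zeta_image orthogonal_transformation_linear[OF R(1)]) (auto simp: integer_lattice_def intro: inj_on_subset)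
  then show ?thesis
    unfolding R(2) zeta'_def by (simp add: orthogonal_transformation_norm[OF R(1)])
qed

text \<open>\<open>lattice_det\<close> is evaluated on a basis \<open>B'\<close> picked by choice,
  possibly different from \<open>B\<close>. Both generate the same lattice, so
  \<open>gvol_le_of_int_span\<close> carries the lower bound over to \<open>B\<close>.\<close>

lemma dets_ge_1_of_sublattices:
  assumes "\<forall>L'. sublattice L' L \<longrightarrow> lattice_det L' \<ge> 1" and L: "addgroup L"
  shows "dets_ge_1 L"
  unfolding dets_ge_1_def
proof (intro allI impI)
  fix B assume B: "set B \<subseteq> L"
  show "gvol B = 0 \<or> 1 \<le> gvol B"
  proof (cases "gvol B = 0")
    case False
    let ?L' = "int_span B"
    have "lattice_basis B ?L'" using False by (simp add: lattice_basis_def gvol_nonzero_iff)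
    then have B': "lattice_basis (SOME B. lattice_basis B ?L') ?L'" by (rule someI)
    define B' where "B' = (SOME B. lattice_basis B ?L')"
    have eq: "int_span B = int_span B'" and nz: "gvol B' \<noteq> 0"
      using B' by (auto simp: lattice_basis_def B'_def gvol_nonzero_iff)
    have "sublattice ?L' L"
      using addgroup_int_span[of B] int_span_minimal[OF L B] by (auto simp: sublattice_def addgroup_def)
    then have "lattice_det ?L' \<ge> 1" using assms(1) by blast
    then have "gvol B' \<ge> 1" by (simp add: lattice_det_def B'_def gram_det_eq_gvol)
    moreover have "gvol B' \<le> gvol B"
    proof (rule gvol_le_of_int_span[OF _ _ False])
      show "set B \<subseteq> int_span B'" using set_subset_int_span[of B] eq by simp
      show "length B = length B'"
        using False nz eq set_subset_int_span[of B] set_subset_int_span[of B'] int_span_subset_span[of B] int_span_subset_span[of B']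
        by (intro dim_eq_of_spans[of _ ?L']) auto
    qed
    ultimately show ?thesis by simp
  qed simp
qed

theorem theorem1p3:
  fixes L :: "(real ^ 'n) set" and s q :: real
  assumes "full_rank_lattice L"
    and "\<forall>L'. sublattice L' L \<longrightarrow> lattice_det L' \<ge> 1"
    and "s > real CARD('n) / 2"
    and "0 \<le> q" and "q \<le> (2 * s - real CARD('n)) / (real CARD('n) + 2)"
  shows "zeta' L s q \<le> zeta' (integer_lattice :: (real ^ 'n) set) s q \<and>
    (zeta' L s q = zeta' (integer_lattice :: (real ^ 'n) set) s q \<longleftrightarrow>
       lattice_isomorphic L (integer_lattice :: (real ^ 'n) set))"
proof -
  have dim: "DIM(real ^ 'n) = CARD('n)" by simp
  obtain B where B: "lattice_basis B L" "length B = CARD('n)"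
    using assms(1) unfolding full_rank_lattice_def by blast
  then have B': "L = int_span B" "gvol B \<noteq> 0" by (auto simp: lattice_basis_def gvol_nonzero_iff)
  \<comment> \<open>The bound is the squared covolume of \<open>L\<close> itself, which places
    \<open>L\<close> in the class.\<close>
  define D where "D = gvol B"
  have L: "candidate D L"
    unfolding candidate_def
    using dets_ge_1_of_sublattices[OF assms(2)] addgroup_int_span[of B] B B'
    by (intro conjI exI[of _ B]) (auto simp: D_def)
  \<comment> \<open>Applied twice: to the lattice from \<open>maximizer_exists\<close>, which fixes
    the maximal value, and to \<open>L\<close> when equality holds.\<close>
  have iso: "lattice_isomorphic M (integer_lattice :: (real ^ 'n) set)"
    if "candidate D M" "\<And>L :: (real ^ 'n) set. candidate D L \<Longrightarrow> zeta' L s q \<le> zeta' M s q" for M :: "(real ^ 'n) set"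
  proof -
    interpret maximizer D s q M
      using that assms(3-5) by unfold_locales (simp_all add: add.commute)
    obtain A where "orthonormal A" "length A = CARD('n)" "M = int_span A" using orthonormal_basis by auto
    then show ?thesis using orthonormal_isomorphic by blast
  qed
  obtain M :: "(real ^ 'n) set" where M: "candidate D M" "\<And>L :: (real ^ 'n) set. candidate D L \<Longrightarrow> zeta' L s q \<le> zeta' M s q"
    using maximizer_exists[OF L, of s q] assms(3,4) dim by auto
  have eq: "zeta' M s q = zeta' (integer_lattice :: (real ^ 'n) set) s q"
    by (rule zeta_isomorphic[OF iso[OF M]])
  have "zeta' L s q \<le> zeta' (integer_lattice :: (real ^ 'n) set) s q" using M(2)[OF L] eq by simp
  moreover have "lattice_isomorphic L (integer_lattice :: (real ^ 'n) set)"
    if "zeta' L s q = zeta' (integer_lattice :: (real ^ 'n) set) s q"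
    using that M(2) eq by (intro iso[OF L]) auto
  ultimately show ?thesis using zeta_isomorphic by blast
qed

end
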